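(* Work constructively (intuitionistic logic with countable/dependent choice). Let $X$ be a complete metric space and $Y$ a metric space, and let $f_n : X \to Y$ ($n \geq 1$) and $f : X \to Y$ be functions with $f_n(z) \to f(z)$ for every $z \in X$. Let $(x_n)_{n\ge1}$ be a sequence in $X$ converging to $x \in X$, and let $\varepsilon > 0$. Then either - there exists $N \in \mathbb{N}$ such that $\rho(f(x_n), f_i(x_n)) < \varepsilon$ for all $n, i \geq N$; - or there exist a sequence $(z_n)_{n\ge1}$ in $X$ converging to $x$ and natural numbers $k_n \geq n$ such that $\rho(f_{k_n}(z_n), f(z_n)) > \varepsilon/4$ for all $n \in \mathbb{N}$. Furthermore, if the second alternative holds, then LPO holds.
   Context: $\rho$ denotes the metric on each metric space. The disjunction is constructive (one can decide which alternative holds). LPO: for every binary sequence $(a_n)$, either $a_n = 0$ for all $n$ or there exists $n$ with $a_n = 1$. *)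

theory Defs
  imports Complex_Main
begin

text \<open>
  Isabelle/HOL is classical, so a theorem of constructive mathematics is stated here as the
  derivability of a formula in an explicit formal system: intuitionistic many-sorted predicate logic
  over all finite types, with natural numbers (full induction), the constructive real numbers
  (Cauchy-complete Archimedean Heyting field with a cotransitive, tight order), function
  extensionality, unique choice, countable choice and dependent choice.  There is no excluded middle.
  The sorts \<open>Base k\<close> carry no axioms; they play the role of arbitrary (inhabited) sets.
\<close>

datatype sort = Nat | Real | Base nat | Fun sort sort (infixr "\<rightarrow>" 60)

text \<open>A variable carries its sort; equally named variables of different sorts are different.\<close>

type_synonym var = "string \<times> sort"

datatype con =
    NZero | NSuc | NAdd
  | RRat rat | RAdd | RMul | RNeg | ROfNat

datatype trm = Var var | Con con | App trm trm (infixl "\<cdot>" 100)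

primrec con_sort :: "con \<Rightarrow> sort" where
  "con_sort NZero = Nat"
| "con_sort NSuc = Nat \<rightarrow> Nat"
| "con_sort NAdd = Nat \<rightarrow> Nat \<rightarrow> Nat"
| "con_sort (RRat q) = Real"
| "con_sort RAdd = Real \<rightarrow> Real \<rightarrow> Real"
| "con_sort RMul = Real \<rightarrow> Real \<rightarrow> Real"
| "con_sort RNeg = Real \<rightarrow> Real"
| "con_sort ROfNat = Nat \<rightarrow> Real"

fun app_sort :: "sort option \<Rightarrow> sort option \<Rightarrow> sort option" where
  "app_sort (Some (\<sigma> \<rightarrow> \<tau>)) (Some \<sigma>') = (if \<sigma>' = \<sigma> then Some \<tau> else None)"
| "app_sort _ _ = None"

primrec sort_of :: "trm \<Rightarrow> sort option" where
  "sort_of (Var v) = Some (snd v)"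
| "sort_of (Con c) = Some (con_sort c)"
| "sort_of (t \<cdot> u) = app_sort (sort_of t) (sort_of u)"

datatype fm =
    Fls ("\<^bold>\<bottom>")
  | Eq trm trm (infix "\<^bold>=" 50)
  | Less trm trm (infix "\<^bold><" 50)
  | And fm fm (infixr "\<^bold>\<and>" 35)
  | Or fm fm (infixr "\<^bold>\<or>" 30)
  | Imp fm fm (infixr "\<^bold>\<longrightarrow>" 25)
  | All var fm
  | Ex var fm

abbreviation Neg :: "fm \<Rightarrow> fm" ("\<^bold>\<not> _" [40] 40) where
  "\<^bold>\<not> \<phi> \<equiv> \<phi> \<^bold>\<longrightarrow> \<^bold>\<bottom>"

abbreviation Iff :: "fm \<Rightarrow> fm \<Rightarrow> fm" (infixr "\<^bold>\<longleftrightarrow>" 25) where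
  "\<phi> \<^bold>\<longleftrightarrow> \<psi> \<equiv> (\<phi> \<^bold>\<longrightarrow> \<psi>) \<^bold>\<and> (\<psi> \<^bold>\<longrightarrow> \<phi>)"

primrec wff :: "fm \<Rightarrow> bool" where
  "wff \<^bold>\<bottom> = True"
| "wff (t \<^bold>= u) = (sort_of t \<noteq> None \<and> sort_of t = sort_of u)"
| "wff (t \<^bold>< u) = (sort_of t = Some Real \<and> sort_of u = Some Real)"
| "wff (\<phi> \<^bold>\<and> \<psi>) = (wff \<phi> \<and> wff \<psi>)"
| "wff (\<phi> \<^bold>\<or> \<psi>) = (wff \<phi> \<and> wff \<psi>)"
| "wff (\<phi> \<^bold>\<longrightarrow> \<psi>) = (wff \<phi> \<and> wff \<psi>)"
| "wff (All v \<phi>) = wff \<phi>"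
| "wff (Ex v \<phi>) = wff \<phi>"

primrec fvt :: "trm \<Rightarrow> var set" where
  "fvt (Var v) = {v}"
| "fvt (Con c) = {}"
| "fvt (t \<cdot> u) = fvt t \<union> fvt u"

primrec fv :: "fm \<Rightarrow> var set" where
  "fv \<^bold>\<bottom> = {}"
| "fv (t \<^bold>= u) = fvt t \<union> fvt u"
| "fv (t \<^bold>< u) = fvt t \<union> fvt u"
| "fv (\<phi> \<^bold>\<and> \<psi>) = fv \<phi> \<union> fv \<psi>"
| "fv (\<phi> \<^bold>\<or> \<psi>) = fv \<phi> \<union> fv \<psi>"
| "fv (\<phi> \<^bold>\<longrightarrow> \<psi>) = fv \<phi> \<union> fv \<psi>"
| "fv (All v \<phi>) = fv \<phi> - {v}"
| "fv (Ex v \<phi>) = fv \<phi> - {v}"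

primrec substt :: "var \<Rightarrow> trm \<Rightarrow> trm \<Rightarrow> trm" where
  "substt x t (Var v) = (if v = x then t else Var v)"
| "substt x t (Con c) = Con c"
| "substt x t (u \<cdot> w) = substt x t u \<cdot> substt x t w"

text \<open>\<open>subst x t \<phi>\<close> replaces the free occurrences of \<open>x\<close> without renaming bound variables;
  it is only used together with \<open>free_for t x \<phi>\<close>, which excludes variable capture.\<close>

primrec subst :: "var \<Rightarrow> trm \<Rightarrow> fm \<Rightarrow> fm" where
  "subst x t \<^bold>\<bottom> = \<^bold>\<bottom>"
| "subst x t (u \<^bold>= w) = (substt x t u \<^bold>= substt x t w)"
| "subst x t (u \<^bold>< w) = (substt x t u \<^bold>< substt x t w)"
| "subst x t (\<phi> \<^bold>\<and> \<psi>) = (subst x t \<phi> \<^bold>\<and> subst x t \<psi>)"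
| "subst x t (\<phi> \<^bold>\<or> \<psi>) = (subst x t \<phi> \<^bold>\<or> subst x t \<psi>)"
| "subst x t (\<phi> \<^bold>\<longrightarrow> \<psi>) = (subst x t \<phi> \<^bold>\<longrightarrow> subst x t \<psi>)"
| "subst x t (All v \<phi>) = All v (if v = x then \<phi> else subst x t \<phi>)"
| "subst x t (Ex v \<phi>) = Ex v (if v = x then \<phi> else subst x t \<phi>)"

primrec free_for :: "trm \<Rightarrow> var \<Rightarrow> fm \<Rightarrow> bool" where
  "free_for t x \<^bold>\<bottom> = True"
| "free_for t x (u \<^bold>= w) = True"
| "free_for t x (u \<^bold>< w) = True"
| "free_for t x (\<phi> \<^bold>\<and> \<psi>) = (free_for t x \<phi> \<and> free_for t x \<psi>)"
| "free_for t x (\<phi> \<^bold>\<or> \<psi>) = (free_for t x \<phi> \<and> free_for t x \<psi>)"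
| "free_for t x (\<phi> \<^bold>\<longrightarrow> \<psi>) = (free_for t x \<phi> \<and> free_for t x \<psi>)"
| "free_for t x (All v \<phi>) = (x \<in> fv (All v \<phi>) \<longrightarrow> v \<notin> fvt t \<and> free_for t x \<phi>)"
| "free_for t x (Ex v \<phi>) = (x \<in> fv (Ex v \<phi>) \<longrightarrow> v \<notin> fvt t \<and> free_for t x \<phi>)"

text \<open>
  \<open>FORALL a \<sigma> (\<lambda>x. \<phi>)\<close> is the formula that quantifies the object variable with name \<open>a\<close> and sort \<open>\<sigma>\<close>,
  which \<open>\<phi>\<close> mentions through the Isabelle variable \<open>x\<close>.  The names are real: a definition below
  that binds a name must not be applied to terms in which that name is free.  For this reason
  each definition binds names with a prefix of its own.
\<close>

abbreviation FORALL :: "string \<Rightarrow> sort \<Rightarrow> (trm \<Rightarrow> fm) \<Rightarrow> fm" where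
  "FORALL a \<sigma> F \<equiv> All (a, \<sigma>) (F (Var (a, \<sigma>)))"

abbreviation EXISTS :: "string \<Rightarrow> sort \<Rightarrow> (trm \<Rightarrow> fm) \<Rightarrow> fm" where
  "EXISTS a \<sigma> F \<equiv> Ex (a, \<sigma>) (F (Var (a, \<sigma>)))"

abbreviation nzero :: trm ("\<^bold>0") where "\<^bold>0 \<equiv> Con NZero"
abbreviation nsuc :: "trm \<Rightarrow> trm" where "nsuc t \<equiv> Con NSuc \<cdot> t"
abbreviation nadd :: "trm \<Rightarrow> trm \<Rightarrow> trm" where "nadd t u \<equiv> Con NAdd \<cdot> t \<cdot> u"
abbreviation rat :: "rat \<Rightarrow> trm" where "rat q \<equiv> Con (RRat q)"
abbreviation radd :: "trm \<Rightarrow> trm \<Rightarrow> trm" (infixl "\<^bold>+" 65) where "t \<^bold>+ u \<equiv> Con RAdd \<cdot> t \<cdot> u"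
abbreviation rmul :: "trm \<Rightarrow> trm \<Rightarrow> trm" (infixl "\<^bold>*" 70) where "t \<^bold>* u \<equiv> Con RMul \<cdot> t \<cdot> u"
abbreviation rneg :: "trm \<Rightarrow> trm" where "rneg t \<equiv> Con RNeg \<cdot> t"
abbreviation rnat :: "trm \<Rightarrow> trm" where "rnat t \<equiv> Con ROfNat \<cdot> t"

definition nle :: "trm \<Rightarrow> trm \<Rightarrow> fm" (infix "\<^bold>\<preceq>" 50) where
  "(m \<^bold>\<preceq> n) = EXISTS ''le.d'' Nat (\<lambda>d. nadd m d \<^bold>= n)"

definition rle :: "trm \<Rightarrow> trm \<Rightarrow> fm" (infix "\<^bold>\<le>" 50) where
  "(t \<^bold>\<le> u) = (\<^bold>\<not> (u \<^bold>< t))"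

text \<open>
  The axioms are schemes in arbitrary terms and formulas; the derivation system only admits their
  well-sorted instances, and this is what forces the sorts of the schematic terms.
  Instead of substituting \<open>f x\<close> for \<open>y\<close> in \<open>\<phi>\<close>, the choice schemes say \<open>\<forall>y. y = f x \<longrightarrow> \<phi>\<close>.
  There are no product sorts, so the relation in dependent choice may depend on the stage \<open>n\<close>.
  Multiplication on the natural numbers and primitive recursion in all sorts need no axioms:
  they follow from dependent and unique choice.
\<close>

inductive_set axs :: "fm set" where
  nat_suc_neq_zero: "(\<^bold>\<not> (nsuc t \<^bold>= \<^bold>0)) \<in> axs"
| nat_suc_inj: "(nsuc t \<^bold>= nsuc u \<^bold>\<longrightarrow> t \<^bold>= u) \<in> axs"
| nat_add_zero: "(nadd t \<^bold>0 \<^bold>= t) \<in> axs"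
| nat_add_suc: "(nadd t (nsuc u) \<^bold>= nsuc (nadd t u)) \<in> axs"
| nat_induct:
    "x = (a, Nat) \<Longrightarrow>
     (subst x \<^bold>0 \<phi> \<^bold>\<and> All x (\<phi> \<^bold>\<longrightarrow> subst x (nsuc (Var x)) \<phi>) \<^bold>\<longrightarrow> All x \<phi>) \<in> axs"

| real_add_assoc: "((r \<^bold>+ s) \<^bold>+ t \<^bold>= r \<^bold>+ (s \<^bold>+ t)) \<in> axs"
| real_add_commute: "(s \<^bold>+ t \<^bold>= t \<^bold>+ s) \<in> axs"
| real_add_zero: "(t \<^bold>+ rat 0 \<^bold>= t) \<in> axs"
| real_add_neg: "(t \<^bold>+ rneg t \<^bold>= rat 0) \<in> axs"
| real_mul_assoc: "((r \<^bold>* s) \<^bold>* t \<^bold>= r \<^bold>* (s \<^bold>* t)) \<in> axs"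
| real_mul_commute: "(s \<^bold>* t \<^bold>= t \<^bold>* s) \<in> axs"
| real_mul_one: "(t \<^bold>* rat 1 \<^bold>= t) \<in> axs"
| real_distrib: "(r \<^bold>* (s \<^bold>+ t) \<^bold>= r \<^bold>* s \<^bold>+ r \<^bold>* t) \<in> axs"
| real_inverse:
    "(a, Real) \<notin> fvt t \<Longrightarrow>
     (t \<^bold>< rat 0 \<^bold>\<or> rat 0 \<^bold>< t \<^bold>\<longrightarrow> EXISTS a Real (\<lambda>y. t \<^bold>* y \<^bold>= rat 1)) \<in> axs"
| real_less_asym: "(s \<^bold>< t \<^bold>\<and> t \<^bold>< s \<^bold>\<longrightarrow> \<^bold>\<bottom>) \<in> axs"
| real_less_cotrans: "(s \<^bold>< t \<^bold>\<longrightarrow> s \<^bold>< r \<^bold>\<or> r \<^bold>< t) \<in> axs"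
| real_less_tight: "((\<^bold>\<not> (s \<^bold>< t)) \<^bold>\<and> (\<^bold>\<not> (t \<^bold>< s)) \<^bold>\<longrightarrow> s \<^bold>= t) \<in> axs"
| real_less_add: "(s \<^bold>< t \<^bold>\<longrightarrow> s \<^bold>+ r \<^bold>< t \<^bold>+ r) \<in> axs"
| real_less_mul: "(rat 0 \<^bold>< s \<^bold>\<and> rat 0 \<^bold>< t \<^bold>\<longrightarrow> rat 0 \<^bold>< s \<^bold>* t) \<in> axs"
| real_rat_add: "(rat p \<^bold>+ rat q \<^bold>= rat (p + q)) \<in> axs"
| real_rat_mul: "(rat p \<^bold>* rat q \<^bold>= rat (p * q)) \<in> axs"
| real_rat_less: "p < q \<Longrightarrow> (rat p \<^bold>< rat q) \<in> axs"
| real_of_nat_zero: "(rnat \<^bold>0 \<^bold>= rat 0) \<in> axs"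
| real_of_nat_suc: "(rnat (nsuc t) \<^bold>= rnat t \<^bold>+ rat 1) \<in> axs"
| real_archimedean:
    "(a, Nat) \<notin> fvt t \<Longrightarrow> (EXISTS a Nat (\<lambda>n. t \<^bold>< rnat n)) \<in> axs"
| real_complete:
    "(FORALL ''rc.s'' (Nat \<rightarrow> Real) (\<lambda>s.
        FORALL ''rc.e'' Real (\<lambda>e. rat 0 \<^bold>< e \<^bold>\<longrightarrow>
          EXISTS ''rc.N'' Nat (\<lambda>N. FORALL ''rc.m'' Nat (\<lambda>m. FORALL ''rc.n'' Nat (\<lambda>n.
            N \<^bold>\<preceq> m \<^bold>\<and> N \<^bold>\<preceq> n \<^bold>\<longrightarrow> s \<cdot> m \<^bold>< s \<cdot> n \<^bold>+ e))))
        \<^bold>\<longrightarrow>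
        EXISTS ''rc.l'' Real (\<lambda>l. FORALL ''rc.e'' Real (\<lambda>e. rat 0 \<^bold>< e \<^bold>\<longrightarrow>
          EXISTS ''rc.N'' Nat (\<lambda>N. FORALL ''rc.n'' Nat (\<lambda>n.
            N \<^bold>\<preceq> n \<^bold>\<longrightarrow> s \<cdot> n \<^bold>< l \<^bold>+ e \<^bold>\<and> l \<^bold>< s \<cdot> n \<^bold>+ e)))))) \<in> axs"

| extensionality:
    "(a, \<sigma>) \<notin> fvt t \<union> fvt u \<Longrightarrow> (FORALL a \<sigma> (\<lambda>x. t \<cdot> x \<^bold>= u \<cdot> x) \<^bold>\<longrightarrow> t \<^bold>= u) \<in> axs"
| unique_choice:
    "\<lbrakk>x = (a, \<sigma>); y = (b, \<tau>); z = (c, \<tau>); f = (d, \<sigma> \<rightarrow> \<tau>);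
      x \<noteq> y; z \<noteq> x; z \<noteq> y; z \<notin> fv \<phi>; f \<notin> fv \<phi>\<rbrakk> \<Longrightarrow>
     (All x (Ex z (All y (\<phi> \<^bold>\<longleftrightarrow> Var y \<^bold>= Var z)))
      \<^bold>\<longrightarrow> Ex f (All x (All y (Var y \<^bold>= Var f \<cdot> Var x \<^bold>\<longrightarrow> \<phi>)))) \<in> axs"
| countable_choice:
    "\<lbrakk>n = (a, Nat); y = (b, \<tau>); f = (d, Nat \<rightarrow> \<tau>); n \<noteq> y; f \<notin> fv \<phi>\<rbrakk> \<Longrightarrow>
     (All n (Ex y \<phi>)
      \<^bold>\<longrightarrow> Ex f (All n (All y (Var y \<^bold>= Var f \<cdot> Var n \<^bold>\<longrightarrow> \<phi>)))) \<in> axs"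
| dependent_choice:
    "\<lbrakk>n = (a, Nat); x = (b, \<tau>); y = (c, \<tau>); z = (z', \<tau>); f = (d, Nat \<rightarrow> \<tau>);
      n \<noteq> x; n \<noteq> y; x \<noteq> y; z \<notin> fv \<phi>; f \<notin> fv \<phi>\<rbrakk> \<Longrightarrow>
     (All n (All x (Ex y \<phi>))
      \<^bold>\<longrightarrow> All z (Ex f (Var f \<cdot> \<^bold>0 \<^bold>= Var z \<^bold>\<and>
             All n (All x (All y
               (Var x \<^bold>= Var f \<cdot> Var n \<^bold>\<and> Var y \<^bold>= Var f \<cdot> nsuc (Var n) \<^bold>\<longrightarrow> \<phi>)))))) \<in> axs"

inductive derives :: "fm set \<Rightarrow> fm \<Rightarrow> bool" (infix "\<turnstile>" 20) where
  axiom: "\<lbrakk>\<phi> \<in> axs; wff \<phi>\<rbrakk> \<Longrightarrow> \<Gamma> \<turnstile> \<phi>"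
| assm: "\<lbrakk>\<phi> \<in> \<Gamma>; wff \<phi>\<rbrakk> \<Longrightarrow> \<Gamma> \<turnstile> \<phi>"
| flsE: "\<lbrakk>\<Gamma> \<turnstile> \<^bold>\<bottom>; wff \<phi>\<rbrakk> \<Longrightarrow> \<Gamma> \<turnstile> \<phi>"
| andI: "\<lbrakk>\<Gamma> \<turnstile> \<phi>; \<Gamma> \<turnstile> \<psi>\<rbrakk> \<Longrightarrow> \<Gamma> \<turnstile> \<phi> \<^bold>\<and> \<psi>"
| andE1: "\<Gamma> \<turnstile> \<phi> \<^bold>\<and> \<psi> \<Longrightarrow> \<Gamma> \<turnstile> \<phi>"
| andE2: "\<Gamma> \<turnstile> \<phi> \<^bold>\<and> \<psi> \<Longrightarrow> \<Gamma> \<turnstile> \<psi>"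
| orI1: "\<lbrakk>\<Gamma> \<turnstile> \<phi>; wff \<psi>\<rbrakk> \<Longrightarrow> \<Gamma> \<turnstile> \<phi> \<^bold>\<or> \<psi>"
| orI2: "\<lbrakk>\<Gamma> \<turnstile> \<psi>; wff \<phi>\<rbrakk> \<Longrightarrow> \<Gamma> \<turnstile> \<phi> \<^bold>\<or> \<psi>"
| orE: "\<lbrakk>\<Gamma> \<turnstile> \<phi> \<^bold>\<or> \<psi>; insert \<phi> \<Gamma> \<turnstile> \<chi>; insert \<psi> \<Gamma> \<turnstile> \<chi>\<rbrakk> \<Longrightarrow> \<Gamma> \<turnstile> \<chi>"
| impI: "\<lbrakk>insert \<phi> \<Gamma> \<turnstile> \<psi>; wff \<phi>\<rbrakk> \<Longrightarrow> \<Gamma> \<turnstile> \<phi> \<^bold>\<longrightarrow> \<psi>"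
| impE: "\<lbrakk>\<Gamma> \<turnstile> \<phi> \<^bold>\<longrightarrow> \<psi>; \<Gamma> \<turnstile> \<phi>\<rbrakk> \<Longrightarrow> \<Gamma> \<turnstile> \<psi>"
| allI: "\<lbrakk>\<Gamma> \<turnstile> \<phi>; x \<notin> (\<Union>\<psi>\<in>\<Gamma>. fv \<psi>)\<rbrakk> \<Longrightarrow> \<Gamma> \<turnstile> All x \<phi>"
| allE: "\<lbrakk>\<Gamma> \<turnstile> All x \<phi>; sort_of t = Some (snd x); free_for t x \<phi>\<rbrakk> \<Longrightarrow> \<Gamma> \<turnstile> subst x t \<phi>"
| exI: "\<lbrakk>\<Gamma> \<turnstile> subst x t \<phi>; sort_of t = Some (snd x); free_for t x \<phi>\<rbrakk> \<Longrightarrow> \<Gamma> \<turnstile> Ex x \<phi>"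
| exE: "\<lbrakk>\<Gamma> \<turnstile> Ex x \<phi>; insert \<phi> \<Gamma> \<turnstile> \<chi>; x \<notin> fv \<chi> \<union> (\<Union>\<psi>\<in>\<Gamma>. fv \<psi>)\<rbrakk> \<Longrightarrow> \<Gamma> \<turnstile> \<chi>"
| eq_refl: "wff (t \<^bold>= t) \<Longrightarrow> \<Gamma> \<turnstile> t \<^bold>= t"
| eq_subst:
    "\<lbrakk>\<Gamma> \<turnstile> t \<^bold>= u; \<Gamma> \<turnstile> subst x t \<phi>; sort_of t = Some (snd x); free_for t x \<phi>; free_for u x \<phi>\<rbrakk>
     \<Longrightarrow> \<Gamma> \<turnstile> subst x u \<phi>"

lemma sort_of_substt [simp]:
  "sort_of t = Some (snd x) \<Longrightarrow> sort_of (substt x t u) = sort_of u"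
  by (induction u) auto

lemma wf_subst [simp]: "sort_of t = Some (snd x) \<Longrightarrow> wff (subst x t \<phi>) = wff \<phi>"
  by (induction \<phi>) auto

lemma derives_wff: "\<Gamma> \<turnstile> \<phi> \<Longrightarrow> wff \<phi>"
  by (induction rule: derives.induct) auto

text \<open>
  Metric spaces.  The sort \<open>\<sigma>\<close> is the underlying set and the term \<open>d\<close> of sort \<open>\<sigma> \<rightarrow> \<sigma> \<rightarrow> Real\<close> the
  metric; equality on the space is \<open>d x y = 0\<close>.  Sequences are indexed from \<open>0\<close>.
  In \<open>converges\<close> the sequence is given by its general term, a function from index terms to terms.
\<close>

definition metric :: "sort \<Rightarrow> trm \<Rightarrow> fm" where
  "metric \<sigma> d =
     FORALL ''met.x'' \<sigma> (\<lambda>x. FORALL ''met.y'' \<sigma> (\<lambda>y. FORALL ''met.z'' \<sigma> (\<lambda>z.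
       rat 0 \<^bold>\<le> d \<cdot> x \<cdot> y
       \<^bold>\<and> (d \<cdot> x \<cdot> y \<^bold>= rat 0 \<^bold>\<longleftrightarrow> x \<^bold>= y)
       \<^bold>\<and> d \<cdot> x \<cdot> y \<^bold>= d \<cdot> y \<cdot> x
       \<^bold>\<and> d \<cdot> x \<cdot> z \<^bold>\<le> d \<cdot> x \<cdot> y \<^bold>+ d \<cdot> y \<cdot> z)))"

definition converges :: "trm \<Rightarrow> (trm \<Rightarrow> trm) \<Rightarrow> trm \<Rightarrow> fm" where
  "converges d s l =
     FORALL ''con.e'' Real (\<lambda>e. rat 0 \<^bold>< e \<^bold>\<longrightarrow>
       EXISTS ''con.N'' Nat (\<lambda>N. FORALL ''con.n'' Nat (\<lambda>n. N \<^bold>\<preceq> n \<^bold>\<longrightarrow> d \<cdot> s n \<cdot> l \<^bold>< e)))"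

definition cauchy :: "trm \<Rightarrow> (trm \<Rightarrow> trm) \<Rightarrow> fm" where
  "cauchy d s =
     FORALL ''cau.e'' Real (\<lambda>e. rat 0 \<^bold>< e \<^bold>\<longrightarrow>
       EXISTS ''cau.N'' Nat (\<lambda>N. FORALL ''cau.m'' Nat (\<lambda>m. FORALL ''cau.n'' Nat (\<lambda>n.
         N \<^bold>\<preceq> m \<^bold>\<and> N \<^bold>\<preceq> n \<^bold>\<longrightarrow> d \<cdot> s m \<cdot> s n \<^bold>< e))))"

definition complete_metric :: "sort \<Rightarrow> trm \<Rightarrow> fm" where
  "complete_metric \<sigma> d = (metric \<sigma> d \<^bold>\<and>
     FORALL ''cmp.s'' (Nat \<rightarrow> \<sigma>) (\<lambda>s. cauchy d (\<lambda>n. s \<cdot> n) \<^bold>\<longrightarrow>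
       EXISTS ''cmp.l'' \<sigma> (\<lambda>l. converges d (\<lambda>n. s \<cdot> n) l)))"

definition LPO :: fm where
  "LPO = FORALL ''lpo.a'' (Nat \<rightarrow> Nat) (\<lambda>a.
     FORALL ''lpo.n'' Nat (\<lambda>n. a \<cdot> n \<^bold>= \<^bold>0 \<^bold>\<or> a \<cdot> n \<^bold>= nsuc \<^bold>0) \<^bold>\<longrightarrow>
     FORALL ''lpo.n'' Nat (\<lambda>n. a \<cdot> n \<^bold>= \<^bold>0) \<^bold>\<or> EXISTS ''lpo.n'' Nat (\<lambda>n. a \<cdot> n \<^bold>= nsuc \<^bold>0))"

text \<open>In the next two formulas \<open>\<rho>\<close> is the metric of the codomain, respectively \<open>\<rho>X\<close> and \<open>\<rho>Y\<close> are
  those of the domain and the codomain; \<open>F \<cdot> n\<close> is the function \<open>f\<^sub>n\<close>, and \<open>X\<close> the sort of the domain.\<close>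

definition uniformly_close_along :: "trm \<Rightarrow> trm \<Rightarrow> trm \<Rightarrow> trm \<Rightarrow> trm \<Rightarrow> fm" where
  "uniformly_close_along \<rho> F f xs \<epsilon> =
     EXISTS ''ucl.N'' Nat (\<lambda>N. FORALL ''ucl.n'' Nat (\<lambda>n. FORALL ''ucl.i'' Nat (\<lambda>i.
       N \<^bold>\<preceq> n \<^bold>\<and> N \<^bold>\<preceq> i \<^bold>\<longrightarrow> \<rho> \<cdot> (f \<cdot> (xs \<cdot> n)) \<cdot> (F \<cdot> i \<cdot> (xs \<cdot> n)) \<^bold>< \<epsilon>)))"

definition apart_near :: "sort \<Rightarrow> trm \<Rightarrow> trm \<Rightarrow> trm \<Rightarrow> trm \<Rightarrow> trm \<Rightarrow> trm \<Rightarrow> fm" where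
  "apart_near X \<rho>X \<rho>Y F f x \<epsilon> =
     EXISTS ''apn.z'' (Nat \<rightarrow> X) (\<lambda>z. EXISTS ''apn.k'' (Nat \<rightarrow> Nat) (\<lambda>k.
       converges \<rho>X (\<lambda>n. z \<cdot> n) x
       \<^bold>\<and> FORALL ''apn.n'' Nat (\<lambda>n. n \<^bold>\<preceq> k \<cdot> n
          \<^bold>\<and> rat (1/4) \<^bold>* \<epsilon> \<^bold>< \<rho>Y \<cdot> (F \<cdot> (k \<cdot> n) \<cdot> (z \<cdot> n)) \<cdot> (f \<cdot> (z \<cdot> n)))))"

end

theory Submission
  imports Defs "HOL-Library.Countable"
begin

text \<open>
  The mathematical argument.  Write \<open>g\<^sub>i(z) = \<rho>(f\<^sub>i(z), f(z))\<close>.  For a binary sequence \<open>a\<close> and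
  \<open>z\<^sub>n \<longlonglongrightarrow> x\<close> completeness yields a point \<open>y\<close> with \<open>y = x\<close> if \<open>a\<close> vanishes and \<open>y = z\<^sub>n\<close> if the
  first \<open>1\<close> of \<open>a\<close> is at \<open>n\<close>.  Pointwise convergence at this \<open>y\<close> replaces strong extensionality.
  If \<open>k\<^sub>n \<ge> n\<close> and \<open>g\<^bsub>k\<^sub>n\<^esub>(z\<^sub>n) > \<epsilon>/4\<close>, then the first \<open>1\<close> of \<open>a\<close> cannot be beyond the modulus of
  convergence at \<open>y\<close>; hence \<open>a\<close> is decided, which is LPO.  For fixed \<open>k\<close> let \<open>a\<^sub>m = 1\<close> if
  \<open>g\<^sub>i(x\<^bsub>k+m\<^esub>) > \<epsilon>/2\<close> for some \<open>i \<ge> k\<close>, and \<open>a\<^sub>m = 0\<close> if \<open>g\<^sub>i(x\<^bsub>k+m\<^esub>) < \<epsilon>\<close> for all \<open>i \<ge> k\<close>.  At the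
  corresponding \<open>y\<close> one decides between \<open>g\<^sub>i(y) > \<epsilon>/4\<close> for some \<open>i \<ge> k\<close>, when \<open>y\<close> can serve as \<open>z\<^sub>k\<close>,
  and \<open>g\<^sub>i(y) < \<epsilon>/2\<close> for all \<open>i \<ge> k\<close>, which forces \<open>a = 0\<close> and so the first alternative.  The first
  argument, applied to the sequence of these decisions, chooses between the alternatives for all \<open>k\<close>.

  The formal system is complete for Kripke models whose worlds are prime theories with witnesses, so
  the argument can be carried out in the worlds.  There disjunction and existence have their
  classical meaning, and only implication and universal quantification refer to later worlds.
\<close>

text \<open>The choice between some i \<ge> k and all i \<ge> k is possible because pointwise
  convergence at the given point settles all large i, so that cotransitivity is used finitely often.
  Each such choice spends a gap between two thresholds: \<epsilon>/2 < \<epsilon> at the points of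
  \<open>xs\<close>, then \<epsilon>/4 < \<epsilon>/2 at the switch point. This is the origin of
  \<epsilon>/4.

  Two obstacles arise when the stages are joined. The chosen points must converge to x, so each
  comes with the condition that its distance from x obeys every bound valid for the tail of
  \<open>xs\<close>. And the LPO argument asks for large g at z_n for all n, which only the second
  alternative would provide; but it uses this at the first 1 of the binary sequence alone. Shifting
  the decisions by one index makes it true there: unless the initial decision settles the matter,
  the unshifted sequence is still 0 at the first 1 of the shifted one.

  In a world, induction and choice are available only for properties given by formulas, and equality
  is a fact between terms. Hence the formula counterparts of predicates on worlds and the explicit
  congruence steps.\<close>

section \<open>Variables and substitution\<close>

text \<open>The level of a variable is the number of leading underscores of its name.  Bound variables will
  have level 0, and a world of level \<open>l\<close> has its free variables at the levels from 1 to \<open>l\<close>.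
  So there is no capture, and the next level has infinitely many fresh variables.\<close>

definition level :: "var \<Rightarrow> nat" where
  "level v = length (takeWhile (\<lambda>c. c = CHR ''_'') (fst v))"

primrec bv :: "fm \<Rightarrow> var set" where
  "bv \<^bold>\<bottom> = {}"
| "bv (t \<^bold>= u) = {}"
| "bv (t \<^bold>< u) = {}"
| "bv (\<phi> \<^bold>\<and> \<psi>) = bv \<phi> \<union> bv \<psi>"
| "bv (\<phi> \<^bold>\<or> \<psi>) = bv \<phi> \<union> bv \<psi>"
| "bv (\<phi> \<^bold>\<longrightarrow> \<psi>) = bv \<phi> \<union> bv \<psi>"
| "bv (All v \<phi>) = insert v (bv \<phi>)"
| "bv (Ex v \<phi>) = insert v (bv \<phi>)"

lemma finite_fvt [simp]: "finite (fvt t)"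
  by (induction t) auto

lemma finite_fv [simp]: "finite (fv \<phi>)"
  by (induction \<phi>) auto

lemma fresh_var:
  assumes "finite V"
  obtains y where "level y = Suc l" "snd y = \<sigma>" "y \<notin> V"
proof -
  define g where "g n = (replicate (Suc l) (CHR ''_'') @ replicate n (CHR ''x''), \<sigma>)" for n
  have "inj g"
    by (rule injI) (simp add: g_def)
  then have "infinite (range g)"
    using finite_imageD by blast
  then obtain n where "g n \<notin> V"
    using assms by (metis finite_subset image_subsetI)
  moreover have "level (g n) = Suc l"
  proof -
    have "takeWhile (\<lambda>c. c = CHR ''_'') (replicate n (CHR ''x'')) = []"
      by (cases n) auto
    then show ?thesis
      by (simp add: level_def g_def takeWhile_append)
  qed
  moreover have "snd (g n) = \<sigma>"
    by (simp add: g_def)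
  ultimately show thesis
    using that by blast
qed

lemma substt_fresh [simp]: "x \<notin> fvt t \<Longrightarrow> substt x u t = t"
  by (induction t) auto

lemma subst_fresh [simp]: "x \<notin> fv \<phi> \<Longrightarrow> subst x u \<phi> = \<phi>"
  by (induction \<phi>) auto

lemma substt_substt_Var: "y \<notin> fvt t \<Longrightarrow> substt y u (substt x (Var y) t) = substt x u t"
  by (induction t) auto

lemma substt_Var_self [simp]: "substt x (Var x) t = t"
  by (induction t) auto

lemma subst_subst_Var:
  "\<lbrakk>y \<notin> fv \<phi>; y \<notin> bv \<phi>; y \<noteq> x\<rbrakk> \<Longrightarrow> subst y (Var x) (subst x (Var y) \<phi>) = \<phi>"
  by (induction \<phi>) (auto simp: substt_substt_Var)

lemma free_for_fresh: "x \<notin> fv \<phi> \<Longrightarrow> free_for t x \<phi>"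
  by (induction \<phi>) auto

lemma free_for_subst_Var:
  "\<lbrakk>y \<notin> fv \<phi>; y \<notin> bv \<phi>; y \<noteq> x\<rbrakk> \<Longrightarrow> free_for (Var x) y (subst x (Var y) \<phi>)"
  by (induction \<phi>) (auto simp: free_for_fresh)

lemma free_for_bv: "fvt t \<inter> bv \<phi> = {} \<Longrightarrow> free_for t x \<phi>"
  by (induction \<phi>) auto

lemma fvt_substt: "fvt (substt x u t) = (if x \<in> fvt t then fvt t - {x} \<union> fvt u else fvt t)"
  by (induction t) auto

lemma fv_subst_sub: "fv (subst x u \<phi>) \<subseteq> fv \<phi> - {x} \<union> fvt u"
  by (induction \<phi>) (auto simp: fvt_substt split: if_splits)

lemma fv_substD: "v \<in> fv (subst x u \<phi>) \<Longrightarrow> v \<in> fv \<phi> \<and> v \<noteq> x \<or> v \<in> fvt u"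
  using fv_subst_sub by blast

lemma bv_subst [simp]: "bv (subst x u \<phi>) = bv \<phi>"
  by (induction \<phi>) auto

text \<open>\<open>allI\<close> generalises only over the variable that occurs. So the proof for
  \<open>y\<close> is generalised over \<open>y\<close>, instantiated with \<open>x\<close> and
  generalised over \<open>x\<close>; freshness of \<open>y\<close> for \<open>\<phi>\<close> makes
  the second substitution undo the first.\<close>

lemma allI_renamed:
  assumes "\<Gamma> \<turnstile> subst x (Var y) \<phi>" "y \<notin> fv \<phi> \<union> bv \<phi> \<union> (\<Union>\<psi>\<in>\<Gamma>. fv \<psi>)"
    "x \<notin> (\<Union>\<psi>\<in>\<Gamma>. fv \<psi>)" "snd y = snd x" "y \<noteq> x"
  shows "\<Gamma> \<turnstile> All x \<phi>"
proof -
  have "\<Gamma> \<turnstile> All y (subst x (Var y) \<phi>)"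
    using assms by (intro derives.allI) auto
  then have "\<Gamma> \<turnstile> subst y (Var x) (subst x (Var y) \<phi>)"
    using assms by (intro derives.allE free_for_subst_Var) auto
  then show ?thesis
    using assms by (intro derives.allI) (auto simp: subst_subst_Var)
qed

text \<open>The existential formula is first turned into one over \<open>y\<close>, by eliminating
  it with \<open>x\<close> itself and offering \<open>Var x\<close> as the witness.\<close>

lemma exE_renamed:
  assumes "\<Gamma> \<turnstile> Ex x \<phi>" "insert (subst x (Var y) \<phi>) \<Gamma> \<turnstile> \<chi>"
    "y \<notin> fv \<phi> \<union> bv \<phi> \<union> fv \<chi> \<union> (\<Union>\<psi>\<in>\<Gamma>. fv \<psi>)" "x \<notin> (\<Union>\<psi>\<in>\<Gamma>. fv \<psi>)" "snd y = snd x" "y \<noteq> x"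
  shows "\<Gamma> \<turnstile> \<chi>"
proof (rule derives.exE)
  have wf: "wff \<phi>"
    using derives_wff[OF assms(1)] by simp
  show "\<Gamma> \<turnstile> Ex y (subst x (Var y) \<phi>)"
  proof (rule derives.exE[OF assms(1)])
    show "insert \<phi> \<Gamma> \<turnstile> Ex y (subst x (Var y) \<phi>)"
    proof (rule derives.exI)
      show "insert \<phi> \<Gamma> \<turnstile> subst y (Var x) (subst x (Var y) \<phi>)"
        using assms wf by (auto simp: subst_subst_Var intro: derives.assm)
    qed (use assms in \<open>auto intro: free_for_subst_Var\<close>)
    show "x \<notin> fv (Ex y (subst x (Var y) \<phi>)) \<union> (\<Union>\<psi>\<in>\<Gamma>. fv \<psi>)"
      using assms fv_subst_sub[of x "Var y" \<phi>] by auto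
  qed
qed (use assms in auto)

section \<open>Renaming of parameters\<close>

primrec rnt :: "(var \<Rightarrow> var) \<Rightarrow> trm \<Rightarrow> trm" where
  "rnt \<pi> (Var v) = Var (\<pi> v)"
| "rnt \<pi> (Con c) = Con c"
| "rnt \<pi> (t \<cdot> u) = rnt \<pi> t \<cdot> rnt \<pi> u"

text \<open>Bound variables are renamed together with the free ones. An injective
  \<open>\<pi>\<close> therefore never causes capture, and derivations can be renamed rule by
  rule.\<close>

primrec rn :: "(var \<Rightarrow> var) \<Rightarrow> fm \<Rightarrow> fm" where
  "rn \<pi> \<^bold>\<bottom> = \<^bold>\<bottom>"
| "rn \<pi> (t \<^bold>= u) = (rnt \<pi> t \<^bold>= rnt \<pi> u)"
| "rn \<pi> (t \<^bold>< u) = (rnt \<pi> t \<^bold>< rnt \<pi> u)"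
| "rn \<pi> (\<phi> \<^bold>\<and> \<psi>) = (rn \<pi> \<phi> \<^bold>\<and> rn \<pi> \<psi>)"
| "rn \<pi> (\<phi> \<^bold>\<or> \<psi>) = (rn \<pi> \<phi> \<^bold>\<or> rn \<pi> \<psi>)"
| "rn \<pi> (\<phi> \<^bold>\<longrightarrow> \<psi>) = (rn \<pi> \<phi> \<^bold>\<longrightarrow> rn \<pi> \<psi>)"
| "rn \<pi> (All v \<phi>) = All (\<pi> v) (rn \<pi> \<phi>)"
| "rn \<pi> (Ex v \<phi>) = Ex (\<pi> v) (rn \<pi> \<phi>)"

lemma rnt_id: "\<forall>v\<in>fvt t. \<pi> v = v \<Longrightarrow> rnt \<pi> t = t"
  by (induction t) auto

lemma rn_id: "\<forall>v\<in>fv \<phi> \<union> bv \<phi>. \<pi> v = v \<Longrightarrow> rn \<pi> \<phi> = \<phi>"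
  by (induction \<phi>) (auto simp: rnt_id)

lemma rnt_rnt [simp]: "\<forall>v. \<pi> (\<pi> v) = v \<Longrightarrow> rnt \<pi> (rnt \<pi> t) = t"
  by (induction t) auto

lemma rn_rn [simp]: "\<forall>v. \<pi> (\<pi> v) = v \<Longrightarrow> rn \<pi> (rn \<pi> \<phi>) = \<phi>"
  by (induction \<phi>) auto

lemma fvt_rnt [simp]: "fvt (rnt \<pi> t) = \<pi> ` fvt t"
  by (induction t) auto

text \<open>Variables of level 0 stay fixed because the axiom \<open>real_complete\<close> has
  particular bound names, so the set of axioms is not closed under renaming those.\<close>

locale renaming =
  fixes \<pi> :: "var \<Rightarrow> var"
  assumes inj: "inj \<pi>" and snd_\<pi> [simp]: "snd (\<pi> v) = snd v"
    and level_0: "level v = 0 \<Longrightarrow> \<pi> v = v"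
begin

lemma \<pi>_eq [simp]: "\<pi> v = \<pi> u \<longleftrightarrow> v = u"
  using inj by (auto dest: injD)

lemma \<pi>_pair: obtains b where "\<pi> (a, \<sigma>) = (b, \<sigma>)"
  using snd_\<pi>[of "(a, \<sigma>)"] by (metis prod.collapse snd_conv)

lemma \<pi>_mem [simp]: "\<pi> v \<in> \<pi> ` V \<longleftrightarrow> v \<in> V"
  using inj by (auto dest: injD)

lemma fv_rn [simp]: "fv (rn \<pi> \<phi>) = \<pi> ` fv \<phi>"
  by (induction \<phi>) auto

lemma sort_of_rnt [simp]: "sort_of (rnt \<pi> t) = sort_of t"
  by (induction t) auto

lemma wff_rn [simp]: "wff (rn \<pi> \<phi>) = wff \<phi>"
  by (induction \<phi>) auto

lemma rnt_substt [simp]: "rnt \<pi> (substt x u t) = substt (\<pi> x) (rnt \<pi> u) (rnt \<pi> t)"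
  by (induction t) auto

lemma rn_subst [simp]: "rn \<pi> (subst x u \<phi>) = subst (\<pi> x) (rnt \<pi> u) (rn \<pi> \<phi>)"
  by (induction \<phi>) auto

lemma free_for_rn [simp]: "free_for (rnt \<pi> t) (\<pi> x) (rn \<pi> \<phi>) = free_for t x \<phi>"
  by (induction \<phi>) auto

lemma axs_rn: "\<phi> \<in> axs \<Longrightarrow> rn \<pi> \<phi> \<in> axs"
proof (induction rule: axs.induct)
  case (nat_induct x a \<phi>)
  then show ?case
    by (cases rule: \<pi>_pair[of a Nat]) (auto intro: axs.nat_induct)
next
  case (real_inverse a t)
  have "(fst (\<pi> (a, Real)), Real) = \<pi> (a, Real)"
    by (cases rule: \<pi>_pair[of a Real]) simp
  then show ?case
    using axs.real_inverse[of "fst (\<pi> (a, Real))" "rnt \<pi> t"] real_inverse by simp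
next
  case (real_archimedean a t)
  have "(fst (\<pi> (a, Nat)), Nat) = \<pi> (a, Nat)"
    by (cases rule: \<pi>_pair[of a Nat]) simp
  then show ?case
    using axs.real_archimedean[of "fst (\<pi> (a, Nat))" "rnt \<pi> t"] real_archimedean by simp
next
  case real_complete
  show ?case
    using axs.real_complete by (simp add: nle_def level_0 level_def)
next
  case (extensionality a \<sigma> t u)
  have "(fst (\<pi> (a, \<sigma>)), \<sigma>) = \<pi> (a, \<sigma>)"
    by (cases rule: \<pi>_pair[of a \<sigma>]) simp
  then show ?case
    using axs.extensionality[of "fst (\<pi> (a, \<sigma>))" \<sigma> "rnt \<pi> t" "rnt \<pi> u"] extensionality
    by (simp flip: image_Un)
next
  case (unique_choice x a \<sigma> y b \<tau> z c f d \<phi>)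
  obtain a' b' c' d' where "\<pi> x = (a', \<sigma>)" "\<pi> y = (b', \<tau>)" "\<pi> z = (c', \<tau>)" "\<pi> f = (d', \<sigma> \<rightarrow> \<tau>)"
    using unique_choice by (metis \<pi>_pair)
  then show ?case
    unfolding rn.simps rnt.simps
    by (rule axs.unique_choice) (use unique_choice(5-9) in simp_all)
next
  case (countable_choice n a y b \<tau> f d \<phi>)
  obtain a' b' d' where "\<pi> n = (a', Nat)" "\<pi> y = (b', \<tau>)" "\<pi> f = (d', Nat \<rightarrow> \<tau>)"
    using countable_choice by (metis \<pi>_pair)
  then show ?case
    unfolding rn.simps rnt.simps
    by (rule axs.countable_choice) (use countable_choice(4-5) in simp_all)
next
  case (dependent_choice n a x b \<tau> y c z z' f d \<phi>)
  obtain a' b' c' d' e' where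
    "\<pi> n = (a', Nat)" "\<pi> x = (b', \<tau>)" "\<pi> y = (c', \<tau>)" "\<pi> z = (e', \<tau>)" "\<pi> f = (d', Nat \<rightarrow> \<tau>)"
    using dependent_choice by (metis \<pi>_pair)
  then show ?case
    unfolding rn.simps rnt.simps
    by (rule axs.dependent_choice) (use dependent_choice(6-10) in simp_all)
qed (auto intro: axs.intros simp del: One_nat_def)

lemma derives_rn: "\<Gamma> \<turnstile> \<phi> \<Longrightarrow> rn \<pi> ` \<Gamma> \<turnstile> rn \<pi> \<phi>"
proof (induction rule: derives.induct)
  case (exE \<Gamma> x \<phi> \<chi>)
  then show ?case
    by (auto intro!: derives.exE[of "rn \<pi> ` \<Gamma>" "\<pi> x" "rn \<pi> \<phi>"])
next
  case (eq_subst \<Gamma> t u x \<phi>)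
  then show ?case
    using derives.eq_subst[of "rn \<pi> ` \<Gamma>" "rnt \<pi> t" "rnt \<pi> u" "\<pi> x" "rn \<pi> \<phi>"] by simp
next
  case (allE \<Gamma> x \<phi> t)
  then show ?case
    using derives.allE[of "rn \<pi> ` \<Gamma>" "\<pi> x" "rn \<pi> \<phi>" "rnt \<pi> t"] by simp
next
  case (exI \<Gamma> x t \<phi>)
  then show ?case
    using derives.exI[of "rn \<pi> ` \<Gamma>" "\<pi> x" "rnt \<pi> t" "rn \<pi> \<phi>"] by simp
next
  case (orE \<Gamma> \<phi> \<psi> \<chi>)
  then show ?case
    using derives.orE[of "rn \<pi> ` \<Gamma>" "rn \<pi> \<phi>" "rn \<pi> \<psi>"] by simp
next
  case (allI \<Gamma> \<phi> x)
  then show ?case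
    by (auto intro!: derives.allI)
next
  case (impE \<Gamma> \<phi> \<psi>)
  then show ?case
    by (auto intro: derives.impE)
qed (auto intro: derives.intros axs_rn)

end

declare split_paired_All [simp del] split_paired_Ex [simp del]

section \<open>Entailment with weakening\<close>

text \<open>The calculus does not rename bound variables: \<open>\<Gamma> \<turnstile> All x \<phi>\<close> can fail only because \<open>x\<close> is free in
  \<open>\<Gamma>\<close>, and \<open>\<turnstile>\<close> is not monotone in its context.  Weakening by admissible formulas is therefore built
  into the definition of \<open>entails\<close>.\<close>

definition admissible :: "fm set \<Rightarrow> bool" where
  "admissible \<Delta> \<longleftrightarrow> finite \<Delta> \<and> (\<forall>\<delta>\<in>\<Delta>. wff \<delta> \<and> (\<forall>v\<in>fv \<delta>. 0 < level v))"

definition entails :: "fm set \<Rightarrow> fm \<Rightarrow> bool" where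
  "entails T \<phi> \<longleftrightarrow> (\<exists>\<Gamma>\<subseteq>T. finite \<Gamma> \<and> (\<forall>\<Delta>. admissible \<Delta> \<longrightarrow> \<Gamma> \<subseteq> \<Delta> \<longrightarrow> (\<Delta> \<turnstile> \<phi>)))"

lemma admissible_level: "\<lbrakk>admissible \<Delta>; \<delta> \<in> \<Delta>; v \<in> fv \<delta>\<rbrakk> \<Longrightarrow> 0 < level v"
  by (simp add: admissible_def)

definition lang :: "nat \<Rightarrow> fm set" where
  "lang l = {\<phi>. wff \<phi> \<and> (\<forall>v\<in>bv \<phi>. level v = 0) \<and> (\<forall>v\<in>fv \<phi>. 0 < level v \<and> level v \<le> l)}"

lemma lang_mono: "l \<le> m \<Longrightarrow> lang l \<subseteq> lang m"
  by (fastforce simp: lang_def)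

lemma entailsI:
  "\<lbrakk>\<Gamma> \<subseteq> T; finite \<Gamma>; \<And>\<Delta>. \<lbrakk>admissible \<Delta>; \<Gamma> \<subseteq> \<Delta>\<rbrakk> \<Longrightarrow> \<Delta> \<turnstile> \<phi>\<rbrakk> \<Longrightarrow> entails T \<phi>"
  unfolding entails_def by (rule HOL.exI[of _ \<Gamma>]) simp

lemma entailsE:
  assumes "entails T \<phi>"
  obtains \<Gamma> where "\<Gamma> \<subseteq> T" "finite \<Gamma>" "\<And>\<Delta>. \<lbrakk>admissible \<Delta>; \<Gamma> \<subseteq> \<Delta>\<rbrakk> \<Longrightarrow> \<Delta> \<turnstile> \<phi>"
  using assms unfolding entails_def by auto

lemma entails_mono: "\<lbrakk>entails T \<phi>; T \<subseteq> T'\<rbrakk> \<Longrightarrow> entails T' \<phi>"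
  by (erule entailsE, erule (1) entailsI[OF order_trans]) simp

lemma entails_rule0: "(\<And>\<Delta>. admissible \<Delta> \<Longrightarrow> \<Delta> \<turnstile> \<phi>) \<Longrightarrow> entails T \<phi>"
  by (rule entailsI[of "{}"]) auto

lemma entails_rule1:
  "\<lbrakk>entails T \<phi>; \<And>\<Delta>. \<lbrakk>admissible \<Delta>; \<Delta> \<turnstile> \<phi>\<rbrakk> \<Longrightarrow> \<Delta> \<turnstile> \<psi>\<rbrakk> \<Longrightarrow> entails T \<psi>"
  by (erule entailsE, erule (1) entailsI) simp

lemma entails_rule2:
  assumes "entails T \<phi>" "entails T \<psi>" "\<And>\<Delta>. \<lbrakk>admissible \<Delta>; \<Delta> \<turnstile> \<phi>; \<Delta> \<turnstile> \<psi>\<rbrakk> \<Longrightarrow> \<Delta> \<turnstile> \<chi>"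
  shows "entails T \<chi>"
proof -
  obtain \<Gamma> where 1: "\<Gamma> \<subseteq> T" "finite \<Gamma>" "\<And>\<Delta>. \<lbrakk>admissible \<Delta>; \<Gamma> \<subseteq> \<Delta>\<rbrakk> \<Longrightarrow> \<Delta> \<turnstile> \<phi>"
    using assms(1) by (rule entailsE) (rule that)
  obtain \<Gamma>' where 2: "\<Gamma>' \<subseteq> T" "finite \<Gamma>'" "\<And>\<Delta>. \<lbrakk>admissible \<Delta>; \<Gamma>' \<subseteq> \<Delta>\<rbrakk> \<Longrightarrow> \<Delta> \<turnstile> \<psi>"
    using assms(2) by (rule entailsE) (rule that)
  show ?thesis
    by (rule entailsI[of "\<Gamma> \<union> \<Gamma>'"]) (use 1 2 assms(3) in simp_all)
qed

lemma entails_assm: "\<lbrakk>\<phi> \<in> T; wff \<phi>\<rbrakk> \<Longrightarrow> entails T \<phi>"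
  by (rule entailsI[of "{\<phi>}"]) (simp_all add: derives.assm)

text \<open>Taking \<open>\<phi>\<close> out of the finite set is harmless:
  \<open>insert \<phi> \<Delta>\<close> is again admissible, so the given entailment can be used at
  it.\<close>

lemma entails_discharge:
  assumes "entails (insert \<phi> T) \<psi>" "wff \<phi>" "\<forall>v\<in>fv \<phi>. 0 < level v"
  obtains \<Gamma> where "\<Gamma> \<subseteq> T" "finite \<Gamma>"
    "\<And>\<Delta>. \<lbrakk>admissible \<Delta>; \<Gamma> \<subseteq> \<Delta>\<rbrakk> \<Longrightarrow> insert \<phi> \<Delta> \<turnstile> \<psi>"
proof -
  obtain \<Gamma> where \<Gamma>: "\<Gamma> \<subseteq> insert \<phi> T" "finite \<Gamma>" "\<And>\<Delta>. \<lbrakk>admissible \<Delta>; \<Gamma> \<subseteq> \<Delta>\<rbrakk> \<Longrightarrow> \<Delta> \<turnstile> \<psi>"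
    using assms(1) by (rule entailsE) (rule that)
  show thesis
  proof
    show "insert \<phi> \<Delta> \<turnstile> \<psi>" if "admissible \<Delta>" "\<Gamma> - {\<phi>} \<subseteq> \<Delta>" for \<Delta>
      by (rule \<Gamma>(3)) (use that assms in \<open>auto simp: admissible_def\<close>)
  qed (use \<Gamma> in auto)
qed

lemma entails_impI:
  assumes "entails (insert \<phi> T) \<psi>" "wff \<phi>" "\<forall>v\<in>fv \<phi>. 0 < level v"
  shows "entails T (\<phi> \<^bold>\<longrightarrow> \<psi>)"
  by (rule entails_discharge[OF assms], erule (1) entailsI) (simp add: derives.impI assms)

lemma entails_impE: "\<lbrakk>entails T (\<phi> \<^bold>\<longrightarrow> \<psi>); entails T \<phi>\<rbrakk> \<Longrightarrow> entails T \<psi>"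
  by (erule (1) entails_rule2) (rule derives.impE)

lemma entails_cut:
  "\<lbrakk>entails T \<phi>; entails (insert \<phi> T) \<psi>; wff \<phi>; \<forall>v\<in>fv \<phi>. 0 < level v\<rbrakk> \<Longrightarrow> entails T \<psi>"
  by (rule entails_impE[OF entails_impI])

lemma entails_orE:
  assumes "entails T (\<phi> \<^bold>\<or> \<psi>)" "entails (insert \<phi> T) \<chi>" "entails (insert \<psi> T) \<chi>"
    "wff \<phi>" "\<forall>v\<in>fv \<phi>. 0 < level v" "wff \<psi>" "\<forall>v\<in>fv \<psi>. 0 < level v"
  shows "entails T \<chi>"
proof -
  obtain \<Gamma>1 where 1: "\<Gamma>1 \<subseteq> T" "finite \<Gamma>1" "\<And>\<Delta>. \<lbrakk>admissible \<Delta>; \<Gamma>1 \<subseteq> \<Delta>\<rbrakk> \<Longrightarrow> \<Delta> \<turnstile> \<phi> \<^bold>\<or> \<psi>"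
    using assms(1) by (rule entailsE) (rule that)
  obtain \<Gamma>2 where 2: "\<Gamma>2 \<subseteq> T" "finite \<Gamma>2"
    "\<And>\<Delta>. \<lbrakk>admissible \<Delta>; \<Gamma>2 \<subseteq> \<Delta>\<rbrakk> \<Longrightarrow> insert \<phi> \<Delta> \<turnstile> \<chi>"
    using assms(2,4,5) by (rule entails_discharge) (rule that)
  obtain \<Gamma>3 where 3: "\<Gamma>3 \<subseteq> T" "finite \<Gamma>3"
    "\<And>\<Delta>. \<lbrakk>admissible \<Delta>; \<Gamma>3 \<subseteq> \<Delta>\<rbrakk> \<Longrightarrow> insert \<psi> \<Delta> \<turnstile> \<chi>"
    using assms(3,6,7) by (rule entails_discharge) (rule that)
  have "\<Delta> \<turnstile> \<chi>" if "admissible \<Delta>" "\<Gamma>1 \<union> \<Gamma>2 \<union> \<Gamma>3 \<subseteq> \<Delta>" for \<Delta>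
    by (rule derives.orE[OF 1(3) 2(3) 3(3)]) (use that in auto)
  then show ?thesis
    by (intro entailsI[of "\<Gamma>1 \<union> \<Gamma>2 \<union> \<Gamma>3"]) (use 1 2 3 in simp_all)
qed

text \<open>The derivability of \<open>\<phi>\<close> with \<open>y\<close> for \<open>x\<close> is only given from those \<open>\<Delta>\<close> that contain \<open>\<Gamma>\<close>; a
  \<open>\<Delta>\<close> that contains \<open>y\<close> is reached by exchanging \<open>y\<close> with a parameter that is fresh for \<open>\<Delta>\<close>.\<close>

lemma entails_allI:
  assumes "entails T (subst x (Var y) \<phi>)"
    and T: "\<forall>\<psi>\<in>T. y \<notin> fv \<psi> \<and> (\<forall>v\<in>bv \<psi>. level v = 0)"
    and y: "0 < level y" "snd y = snd x" "y \<notin> fv \<phi>"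
    and x: "level x = 0" "\<forall>v\<in>bv \<phi>. level v = 0"
  shows "entails T (All x \<phi>)"
proof -
  obtain \<Gamma> where \<Gamma>: "\<Gamma> \<subseteq> T" "finite \<Gamma>"
    "\<And>\<Delta>. \<lbrakk>admissible \<Delta>; \<Gamma> \<subseteq> \<Delta>\<rbrakk> \<Longrightarrow> \<Delta> \<turnstile> subst x (Var y) \<phi>"
    using assms(1) by (rule entailsE) (rule that)
  have "\<Delta> \<turnstile> All x \<phi>" if \<Delta>: "admissible \<Delta>" "\<Gamma> \<subseteq> \<Delta>" for \<Delta>
  proof -
    have "finite (fv \<phi> \<union> (\<Union>\<psi>\<in>\<Delta>. fv \<psi>))"
      using \<Delta> by (auto simp: admissible_def)
    then obtain z where z: "level z = Suc 0" "snd z = snd x" "z \<notin> fv \<phi> \<union> (\<Union>\<psi>\<in>\<Delta>. fv \<psi>)"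
      by (rule fresh_var)
    define \<pi> where "\<pi> = id(y := z, z := y)"
    have \<pi>\<pi>: "\<forall>v. \<pi> (\<pi> v) = v"
      by (auto simp: \<pi>_def)
    interpret renaming \<pi>
    proof
      show "inj \<pi>"
        using \<pi>\<pi> by (intro injI) metis
      show "snd (\<pi> v) = snd v" for v
        using y z by (simp add: \<pi>_def)
      show "\<pi> v = v" if "level v = 0" for v
        using that y(1) z(1) by (cases "v = y"; cases "v = z") (simp_all add: \<pi>_def)
    qed
    have "\<gamma> \<in> rn \<pi> ` \<Delta>" if "\<gamma> \<in> \<Gamma>" for \<gamma>
    proof -
      have "rn \<pi> \<gamma> = \<gamma>"
      proof (intro rn_id ballI)
        fix v assume "v \<in> fv \<gamma> \<union> bv \<gamma>"
        moreover have "\<gamma> \<in> T" "\<gamma> \<in> \<Delta>"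
          using that \<Gamma>(1) \<Delta>(2) by blast+
        ultimately have "level v = 0 \<or> v \<noteq> y \<and> v \<noteq> z"
          using T z(3) by auto
        then show "\<pi> v = v"
          by (elim disjE) (erule level_0, simp add: \<pi>_def)
      qed
      moreover have "\<gamma> \<in> \<Delta>"
        using that \<Delta>(2) by blast
      ultimately show ?thesis
        using imageI[of \<gamma> \<Delta> "rn \<pi>"] by simp
    qed
    moreover have "0 < level (\<pi> v)" if "0 < level v" for v
      using that y z by (auto simp: \<pi>_def)
    then have "admissible (rn \<pi> ` \<Delta>)"
      using \<Delta> by (auto simp: admissible_def)
    ultimately have "rn \<pi> ` \<Delta> \<turnstile> subst x (Var y) \<phi>"
      by (intro \<Gamma>) auto
    from derives_rn[OF this] have "\<Delta> \<turnstile> rn \<pi> (subst x (Var y) \<phi>)"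
      using \<pi>\<pi> by (simp add: image_image)
    moreover have "rn \<pi> \<phi> = \<phi>"
      using x y z level_0 by (intro rn_id) (auto simp: \<pi>_def)
    moreover have "\<pi> x = x" "\<pi> y = z"
      using x level_0 by (auto simp: \<pi>_def)
    ultimately have "\<Delta> \<turnstile> subst x (Var z) \<phi>"
      by simp
    then show ?thesis
    proof (rule allI_renamed)
      show "x \<notin> (\<Union>\<psi>\<in>\<Delta>. fv \<psi>)"
        using admissible_level[OF \<Delta>(1)] x by fastforce
    qed (use x z in auto)
  qed
  with \<Gamma>(1,2) show ?thesis
    by (rule entailsI)
qed

text \<open>A context \<open>\<Delta>\<close> may already mention \<open>y\<close>. The implication
  from \<open>\<phi>\<close> to \<open>\<chi>\<close>, generalised over \<open>x\<close>, no longer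
  depends on \<open>y\<close> and can be instantiated with a \<open>z\<close> that is fresh for
  \<open>\<Delta>\<close>.\<close>

lemma entails_exE:
  assumes "entails T (Ex x \<phi>)" "entails (insert (subst x (Var y) \<phi>) T) \<chi>"
    and T: "\<forall>\<psi>\<in>T. y \<notin> fv \<psi> \<and> (\<forall>v\<in>bv \<psi>. level v = 0)"
    and y: "0 < level y" "snd y = snd x" "y \<notin> fv \<phi>" "y \<notin> fv \<chi>"
    and x: "level x = 0" "Ex x \<phi> \<in> lang k" "\<chi> \<in> lang l"
  shows "entails T \<chi>"
proof -
  have "entails T (subst x (Var y) \<phi> \<^bold>\<longrightarrow> \<chi>)"
    using assms by (intro entails_impI) (auto simp: lang_def dest!: fv_substD)
  moreover have [simp]: "x \<notin> fv \<chi>"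
    using x by (force simp: lang_def)
  ultimately have "entails T (All x (\<phi> \<^bold>\<longrightarrow> \<chi>))"
    using T y x by (intro entails_allI[of _ _ y]) (auto simp: lang_def)
  then obtain \<Gamma>1 where 1: "\<Gamma>1 \<subseteq> T" "finite \<Gamma>1"
    "\<And>\<Delta>. \<lbrakk>admissible \<Delta>; \<Gamma>1 \<subseteq> \<Delta>\<rbrakk> \<Longrightarrow> \<Delta> \<turnstile> All x (\<phi> \<^bold>\<longrightarrow> \<chi>)"
    by (rule entailsE) (rule that)
  obtain \<Gamma>2 where 2: "\<Gamma>2 \<subseteq> T" "finite \<Gamma>2" "\<And>\<Delta>. \<lbrakk>admissible \<Delta>; \<Gamma>2 \<subseteq> \<Delta>\<rbrakk> \<Longrightarrow> \<Delta> \<turnstile> Ex x \<phi>"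
    using assms(1) by (rule entailsE) (rule that)
  have "\<Delta> \<turnstile> \<chi>" if \<Delta>: "admissible \<Delta>" "\<Gamma>1 \<union> \<Gamma>2 \<subseteq> \<Delta>" for \<Delta>
  proof -
    have "finite (fv \<phi> \<union> fv \<chi> \<union> (\<Union>\<psi>\<in>\<Delta>. fv \<psi>))"
      using \<Delta> by (auto simp: admissible_def)
    then obtain z where z: "level z = Suc 0" "snd z = snd x" "z \<notin> fv \<phi> \<union> fv \<chi> \<union> (\<Union>\<psi>\<in>\<Delta>. fv \<psi>)"
      by (rule fresh_var)
    let ?\<Delta> = "insert (subst x (Var z) \<phi>) \<Delta>"
    have bv: "z \<notin> bv \<phi>"
      using x z by (auto simp: lang_def)
    have "admissible ?\<Delta>"
      using \<Delta> x z by (auto simp: admissible_def lang_def dest!: fv_substD)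
    then have "?\<Delta> \<turnstile> All x (\<phi> \<^bold>\<longrightarrow> \<chi>)"
      using 1 \<Delta> by auto
    then have "?\<Delta> \<turnstile> subst x (Var z) (\<phi> \<^bold>\<longrightarrow> \<chi>)"
      by (rule derives.allE) (use z bv in \<open>auto intro: free_for_bv free_for_fresh\<close>)
    moreover have "?\<Delta> \<turnstile> subst x (Var z) \<phi>"
      using x z by (auto simp: lang_def intro: derives.assm)
    ultimately have "?\<Delta> \<turnstile> \<chi>"
      by (metis derives.impE subst.simps(6) subst_fresh \<open>x \<notin> fv \<chi>\<close>)
    with 2(3)[OF \<Delta>(1)] show ?thesis
    proof (rule exE_renamed)
      show "x \<notin> (\<Union>\<psi>\<in>\<Delta>. fv \<psi>)"
        using admissible_level[OF \<Delta>(1)] x by fastforce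
    qed (use \<Delta>(2) x z bv in auto)
  qed
  then show ?thesis
    by (intro entailsI[of "\<Gamma>1 \<union> \<Gamma>2"]) (use 1 2 in simp_all)
qed

section \<open>Worlds\<close>

datatype world = World (wlevel: nat) (facts: "fm set")

text \<open>The domain of a world consists of terms and not of classes of equal terms. Equality is
  interpreted by \<open>facts\<close>, so replacing equals inside a world takes explicit congruence
  lemmas.\<close>

definition elems :: "world \<Rightarrow> sort \<Rightarrow> trm set" where
  "elems w \<sigma> = {t. sort_of t = Some \<sigma> \<and> (\<forall>v\<in>fvt t. 0 < level v \<and> level v \<le> wlevel w)}"

definition world :: "world \<Rightarrow> bool" where
  "world w \<longleftrightarrow> facts w \<subseteq> lang (wlevel w) \<and> \<^bold>\<bottom> \<notin> facts w
     \<and> (\<forall>\<phi>\<in>lang (wlevel w). entails (facts w) \<phi> \<longrightarrow> \<phi> \<in> facts w)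
     \<and> (\<forall>\<phi> \<psi>. (\<phi> \<^bold>\<or> \<psi>) \<in> facts w \<longrightarrow> \<phi> \<in> facts w \<or> \<psi> \<in> facts w)
     \<and> (\<forall>x \<phi>. Ex x \<phi> \<in> facts w \<longrightarrow> (\<exists>t\<in>elems w (snd x). subst x t \<phi> \<in> facts w))"

section \<open>Lindenbaum extension to prime theories with witnesses\<close>

instance sort :: countable by countable_datatype
instance con :: countable by countable_datatype
instance trm :: countable by countable_datatype
instance fm :: countable by countable_datatype

locale lindenbaum =
  fixes l :: nat and \<chi> :: fm
  assumes \<chi>: "\<chi> \<in> lang (Suc l)"
begin

text \<open>Witnesses are taken from the new level \<open>Suc l\<close>, so it is there that only
  finitely many variables may be in use; at lower levels infinitely many are allowed.\<close>

definition good :: "fm set \<Rightarrow> bool" where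
  "good T \<longleftrightarrow> T \<subseteq> lang (Suc l) \<and> finite {v \<in> (\<Union>\<psi>\<in>T. fv \<psi>). level v = Suc l} \<and> \<not> entails T \<chi>"

text \<open>The first disjunct is rejection: adding \<open>\<phi>\<close> would give
  \<open>\<chi>\<close> away. An accepted existential formula receives its witness in the same
  step.\<close>

definition decided :: "fm \<Rightarrow> fm set \<Rightarrow> fm set \<Rightarrow> bool" where
  "decided \<phi> T T' \<longleftrightarrow> entails (insert \<phi> T) \<chi>
     \<or> \<phi> \<in> T' \<and> (\<forall>x \<psi>. \<phi> = Ex x \<psi> \<longrightarrow> (\<exists>t\<in>elems (World (Suc l) T') (snd x). subst x t \<psi> \<in> T'))"

lemma good_insert:
  assumes "good T" "\<phi> \<in> lang (Suc l)" "\<not> entails (insert \<phi> T) \<chi>"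
  shows "good (insert \<phi> T)"
proof -
  have "{v \<in> (\<Union>\<psi>\<in>insert \<phi> T. fv \<psi>). level v = Suc l}
      \<subseteq> fv \<phi> \<union> {v \<in> (\<Union>\<psi>\<in>T. fv \<psi>). level v = Suc l}"
    by auto
  then have "finite {v \<in> (\<Union>\<psi>\<in>insert \<phi> T. fv \<psi>). level v = Suc l}"
    by (rule finite_subset) (use assms in \<open>auto simp: good_def\<close>)
  then show ?thesis
    using assms by (auto simp: good_def)
qed

lemma decide:
  assumes "good T" "\<phi> \<in> lang (Suc l)"
  obtains T' where "T \<subseteq> T'" "good T'" "decided \<phi> T T'"
proof (cases "entails (insert \<phi> T) \<chi>")
  case True
  then show ?thesis
    using assms that by (auto simp: decided_def)
next
  case False
  then have g: "good (insert \<phi> T)"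
    using assms good_insert by blast
  show ?thesis
  proof (cases "\<exists>x \<psi>. \<phi> = Ex x \<psi>")
    case True
    then obtain x \<psi> where \<phi>: "\<phi> = Ex x \<psi>"
      by blast
    have "finite ({v \<in> (\<Union>\<theta>\<in>insert \<phi> T. fv \<theta>). level v = Suc l} \<union> fv \<chi> \<union> fv \<psi>)"
      using g by (auto simp: good_def)
    then obtain y where y: "level y = Suc l" "snd y = snd x"
      "y \<notin> {v \<in> (\<Union>\<theta>\<in>insert \<phi> T. fv \<theta>). level v = Suc l} \<union> fv \<chi> \<union> fv \<psi>"
      by (rule fresh_var)
    let ?\<theta> = "subst x (Var y) \<psi>"
    \<comment> \<open>The witness \<open>y\<close> is new, so an entailment of \<open>\<chi>\<close>
      that uses it would yield one from the existential formula alone.\<close>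
    have "\<not> entails (insert ?\<theta> (insert \<phi> T)) \<chi>"
    proof
      assume *: "entails (insert ?\<theta> (insert \<phi> T)) \<chi>"
      have "entails (insert \<phi> T) \<chi>"
      proof (rule entails_exE[OF _ *])
        show "entails (insert \<phi> T) (Ex x \<psi>)"
          using assms \<phi> by (auto simp: lang_def intro: entails_assm)
        show "\<forall>\<psi>\<in>insert \<phi> T. y \<notin> fv \<psi> \<and> (\<forall>v\<in>bv \<psi>. level v = 0)"
          using g y by (auto simp: good_def lang_def)
      qed (use y assms(2) \<phi> \<chi> in \<open>auto simp: lang_def\<close>)
      with False show False ..
    qed
    moreover have "?\<theta> \<in> lang (Suc l)"
      using assms(2) \<phi> y by (auto simp: lang_def dest!: fv_substD)
    ultimately have "good (insert ?\<theta> (insert \<phi> T))"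
      using g good_insert by blast
    moreover have "Var y \<in> elems (World (Suc l) T') (snd x)" for T'
      using y by (auto simp: elems_def)
    ultimately show ?thesis
      using that[of "insert ?\<theta> (insert \<phi> T)"] \<phi> by (auto simp: decided_def)
  next
    case False
    then show ?thesis
      using that[of "insert \<phi> T"] g by (auto simp: decided_def)
  qed
qed

text \<open>Each formula is treated at its own number in the enumeration. Avoiding
  \<open>\<chi>\<close> makes the union closed and prime: a rejected consequence would give
  \<open>\<chi>\<close> by a cut, and two rejected disjuncts each entail \<open>\<chi>\<close>,
  hence so would their disjunction.\<close>

lemma extension:
  assumes "good T"
  obtains S where "T \<subseteq> S" "world (World (Suc l) S)" "\<chi> \<notin> S"
proof -
  have "\<exists>C. \<forall>n. (good (C n) \<and> (n = 0 \<longrightarrow> C n = T)) \<and> C n \<subseteq> C (Suc n)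
      \<and> (from_nat n \<in> lang (Suc l) \<longrightarrow> decided (from_nat n) (C n) (C (Suc n)))"
  proof (rule dependent_nat_choice)
    show "\<exists>C. good C \<and> (0 = 0 \<longrightarrow> C = T)"
      using assms by auto
    show "\<exists>C'. (good C' \<and> (Suc n = 0 \<longrightarrow> C' = T)) \<and> C \<subseteq> C'
        \<and> (from_nat n \<in> lang (Suc l) \<longrightarrow> decided (from_nat n) C C')"
      if "good C \<and> (n = 0 \<longrightarrow> C = T)" for C n
      using that decide[of C "from_nat n"] by (cases "from_nat n \<in> lang (Suc l)") (metis nat.distinct(1), auto)
  qed
  then obtain C where C: "\<And>n. good (C n)" "C 0 = T" "\<And>n. C n \<subseteq> C (Suc n)"
    "\<And>n. from_nat n \<in> lang (Suc l) \<Longrightarrow> decided (from_nat n) (C n) (C (Suc n))"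
    by metis
  have mono: "m \<le> n \<Longrightarrow> C m \<subseteq> C n" for m n
    using C(3) by (rule lift_Suc_mono_le)
  define S where "S = (\<Union>n. C n)"
  have nS: "\<not> entails S \<chi>"
  proof
    assume "entails S \<chi>"
    then obtain \<Gamma> where \<Gamma>: "\<Gamma> \<subseteq> S" "finite \<Gamma>" "\<And>\<Delta>. \<lbrakk>admissible \<Delta>; \<Gamma> \<subseteq> \<Delta>\<rbrakk> \<Longrightarrow> \<Delta> \<turnstile> \<chi>"
      by (rule entailsE) (rule that)
    \<comment> \<open>An entailment uses a finite set, which lies in a single stage of the
      increasing chain.\<close>
    have "\<exists>n. \<Gamma> \<subseteq> C n"
      using \<Gamma>(2,1)
    proof (induction \<Gamma>)
      case (insert \<gamma> \<Gamma>)
      then obtain n m where "\<Gamma> \<subseteq> C n" "\<gamma> \<in> C m"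
        by (auto simp: S_def)
      then have "insert \<gamma> \<Gamma> \<subseteq> C (max m n)"
        using mono[of n "max m n"] mono[of m "max m n"] by auto
      then show ?case ..
    qed auto
    then have "\<exists>n. entails (C n) \<chi>"
      using \<Gamma>(2,3) entailsI by blast
    then show False
      using C(1) by (auto simp: good_def)
  qed
  have dec: "entails (insert \<phi> S) \<chi>
      \<or> \<phi> \<in> S \<and> (\<forall>x \<psi>. \<phi> = Ex x \<psi> \<longrightarrow> (\<exists>t\<in>elems (World (Suc l) S) (snd x). subst x t \<psi> \<in> S))"
    if "\<phi> \<in> lang (Suc l)" for \<phi>
  proof -
    have CS: "C n \<subseteq> S" for n
      by (auto simp: S_def)
    have "decided \<phi> (C (to_nat \<phi>)) (C (Suc (to_nat \<phi>)))"
      using C(4)[of "to_nat \<phi>"] that by simp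
    then show ?thesis
      using CS[of "to_nat \<phi>"] CS[of "Suc (to_nat \<phi>)"] entails_mono
      unfolding decided_def elems_def world.sel by blast
  qed
  have sub: "S \<subseteq> lang (Suc l)"
    using C(1) by (auto simp: S_def good_def)
  have closed: "\<phi> \<in> S" if "\<phi> \<in> lang (Suc l)" "entails S \<phi>" for \<phi>
    using dec[OF that(1)] entails_cut[OF that(2)] nS that(1) by (auto simp: lang_def)
  have "world (World (Suc l) S)"
    unfolding world_def world.sel
  proof (intro conjI ballI HOL.allI HOL.impI)
    show "\<^bold>\<bottom> \<notin> S"
    proof
      assume "\<^bold>\<bottom> \<in> S"
      then have "entails S \<^bold>\<bottom>"
        by (auto intro: entails_assm)
      then have "entails S \<chi>"
        by (rule entails_rule1) (use \<chi> in \<open>auto simp: lang_def intro: derives.flsE\<close>)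
      with nS show False ..
    qed
    show "\<phi> \<in> S \<or> \<psi> \<in> S" if "(\<phi> \<^bold>\<or> \<psi>) \<in> S" for \<phi> \<psi>
    proof (rule ccontr)
      assume *: "\<not> ?thesis"
      have l: "\<phi> \<in> lang (Suc l)" "\<psi> \<in> lang (Suc l)"
        using that sub by (auto simp: lang_def)
      have "entails S \<chi>"
        by (rule entails_orE[of S \<phi> \<psi>])
          (use that l dec[OF l(1)] dec[OF l(2)] * in \<open>auto simp: lang_def intro: entails_assm\<close>)
      with nS show False ..
    qed
    show "\<exists>t\<in>elems (World (Suc l) S) (snd x). subst x t \<psi> \<in> S" if "Ex x \<psi> \<in> S" for x \<psi>
    proof -
      have "insert (Ex x \<psi>) S = S"
        using that by auto
      then show ?thesis
        using that nS sub dec[of "Ex x \<psi>"] by auto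
    qed
  qed (use sub closed in auto)
  moreover have "T \<subseteq> S"
    using C(2) by (auto simp: S_def)
  moreover have "\<chi> \<notin> S"
    using nS \<chi> by (auto simp: lang_def intro: entails_assm)
  ultimately show thesis
    using that by blast
qed

end

text \<open>\<open>T\<close> may use every variable of its levels, so the new world lies one level
  higher, where all variables are still available as witnesses.\<close>

lemma lindenbaum:
  assumes "T \<subseteq> lang l" "\<chi> \<in> lang (Suc l)" "\<not> entails T \<chi>"
  obtains S where "T \<subseteq> S" "world (World (Suc l) S)" "\<chi> \<notin> S"
proof -
  interpret lindenbaum l \<chi>
    by standard fact
  have none: "{v \<in> (\<Union>\<psi>\<in>T. fv \<psi>). level v = Suc l} = {}"
    using assms(1) by (fastforce simp: lang_def)
  have "good T"
    unfolding good_def none using assms lang_mono[of l "Suc l"] by auto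
  then show thesis
    using extension that by blast
qed

section \<open>The canonical Kripke frame and its logical clauses\<close>

definition future :: "world \<Rightarrow> world \<Rightarrow> bool" (infix "\<sqsubseteq>" 50) where
  "w \<sqsubseteq> w' \<longleftrightarrow> world w' \<and> wlevel w \<le> wlevel w' \<and> facts w \<subseteq> facts w'"

lemma future_refl: "world w \<Longrightarrow> w \<sqsubseteq> w"
  by (simp add: future_def)

lemma future_trans [trans]: "\<lbrakk>w \<sqsubseteq> w'; w' \<sqsubseteq> w''\<rbrakk> \<Longrightarrow> w \<sqsubseteq> w''"
  by (auto simp: future_def)

lemma future_world: "w \<sqsubseteq> w' \<Longrightarrow> world w'"
  by (simp add: future_def)

lemma elems_mono: "\<lbrakk>t \<in> elems w \<sigma>; w \<sqsubseteq> w'\<rbrakk> \<Longrightarrow> t \<in> elems w' \<sigma>"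
  by (force simp: elems_def future_def)

context
  fixes w :: world
  assumes w: "world w"
begin

lemma world_lang: "\<phi> \<in> facts w \<Longrightarrow> \<phi> \<in> lang (wlevel w)"
  using w by (auto simp: world_def)

lemma world_closed: "\<lbrakk>\<phi> \<in> lang (wlevel w); entails (facts w) \<phi>\<rbrakk> \<Longrightarrow> \<phi> \<in> facts w"
  using w by (auto simp: world_def)

lemma world_entails: "\<phi> \<in> facts w \<Longrightarrow> entails (facts w) \<phi>"
  using world_lang[of \<phi>] by (auto simp: lang_def intro: entails_assm)

lemma world_axiom: "\<lbrakk>\<phi> \<in> axs; \<phi> \<in> lang (wlevel w)\<rbrakk> \<Longrightarrow> \<phi> \<in> facts w"
  by (intro world_closed entails_rule0 derives.axiom) (auto simp: lang_def)

lemma world_And: "(\<phi> \<^bold>\<and> \<psi>) \<in> facts w \<longleftrightarrow> \<phi> \<in> facts w \<and> \<psi> \<in> facts w"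
proof (intro iffI conjI)
  assume *: "(\<phi> \<^bold>\<and> \<psi>) \<in> facts w"
  have l: "\<phi> \<in> lang (wlevel w)" "\<psi> \<in> lang (wlevel w)"
    using world_lang[OF *] by (auto simp: lang_def)
  show "\<phi> \<in> facts w" "\<psi> \<in> facts w"
    by (rule world_closed[OF l(1)], rule entails_rule1[OF world_entails[OF *]], erule derives.andE1)
      (rule world_closed[OF l(2)], rule entails_rule1[OF world_entails[OF *]], erule derives.andE2)
next
  assume *: "\<phi> \<in> facts w \<and> \<psi> \<in> facts w"
  show "(\<phi> \<^bold>\<and> \<psi>) \<in> facts w"
  proof (rule world_closed)
    show "(\<phi> \<^bold>\<and> \<psi>) \<in> lang (wlevel w)"
      using * world_lang[of \<phi>] world_lang[of \<psi>] by (auto simp: lang_def)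
    show "entails (facts w) (\<phi> \<^bold>\<and> \<psi>)"
      using * by (auto intro: entails_rule2[OF world_entails world_entails derives.andI])
  qed
qed

lemma world_Or:
  assumes "(\<phi> \<^bold>\<or> \<psi>) \<in> lang (wlevel w)"
  shows "(\<phi> \<^bold>\<or> \<psi>) \<in> facts w \<longleftrightarrow> \<phi> \<in> facts w \<or> \<psi> \<in> facts w"
proof
  show "(\<phi> \<^bold>\<or> \<psi>) \<in> facts w \<Longrightarrow> \<phi> \<in> facts w \<or> \<psi> \<in> facts w"
    using w by (simp add: world_def)
next
  assume "\<phi> \<in> facts w \<or> \<psi> \<in> facts w"
  then show "(\<phi> \<^bold>\<or> \<psi>) \<in> facts w"
    using assms
    by (elim disjE; intro world_closed, simp, elim entails_rule1[OF world_entails])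
      (auto simp: lang_def intro: derives.orI1 derives.orI2)
qed

lemma world_mp: "\<lbrakk>(\<phi> \<^bold>\<longrightarrow> \<psi>) \<in> facts w; \<phi> \<in> facts w\<rbrakk> \<Longrightarrow> \<psi> \<in> facts w"
  using world_lang[of "\<phi> \<^bold>\<longrightarrow> \<psi>"] entails_impE[OF world_entails world_entails]
  by (intro world_closed) (auto simp: lang_def)

end

text \<open>If adding \<open>\<phi>\<close> does not entail \<open>\<psi>\<close>, the Lindenbaum
  extension is a later world that contains \<open>\<phi>\<close> and omits
  \<open>\<psi>\<close>.\<close>

lemma world_Imp:
  assumes w: "world w" and l: "(\<phi> \<^bold>\<longrightarrow> \<psi>) \<in> lang (wlevel w)"
  shows "(\<phi> \<^bold>\<longrightarrow> \<psi>) \<in> facts w \<longleftrightarrow> (\<forall>w'. w \<sqsubseteq> w' \<longrightarrow> \<phi> \<in> facts w' \<longrightarrow> \<psi> \<in> facts w')"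
proof (intro iffI HOL.allI HOL.impI)
  assume *: "\<forall>w'. w \<sqsubseteq> w' \<longrightarrow> \<phi> \<in> facts w' \<longrightarrow> \<psi> \<in> facts w'"
  have "entails (insert \<phi> (facts w)) \<psi>"
  proof (rule ccontr)
    assume n: "\<not> entails (insert \<phi> (facts w)) \<psi>"
    have "insert \<phi> (facts w) \<subseteq> lang (wlevel w)" "\<psi> \<in> lang (Suc (wlevel w))"
      using world_lang[OF w] l lang_mono[of "wlevel w" "Suc (wlevel w)"] by (auto simp: lang_def)
    then obtain S where "insert \<phi> (facts w) \<subseteq> S" "world (World (Suc (wlevel w)) S)" "\<psi> \<notin> S"
      using n by (rule lindenbaum)
    then show False
      using *[rule_format, of "(World (Suc (wlevel w)) S)"] by (auto simp: future_def)
  qed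
  then show "(\<phi> \<^bold>\<longrightarrow> \<psi>) \<in> facts w"
    using l by (intro world_closed[OF w] entails_impI) (auto simp: lang_def)
next
  fix w' assume "(\<phi> \<^bold>\<longrightarrow> \<psi>) \<in> facts w" "w \<sqsubseteq> w'" "\<phi> \<in> facts w'"
  then show "\<psi> \<in> facts w'"
    using world_mp[of w' \<phi> \<psi>] by (auto simp: future_def)
qed

text \<open>A variable of the next level is a generic element: if the instance at this variable is
  not entailed, some later world has the variable in its domain and omits the instance.\<close>

lemma world_All:
  assumes w: "world w" and l: "All x \<phi> \<in> lang (wlevel w)"
  shows "All x \<phi> \<in> facts w \<longleftrightarrow> (\<forall>w'. w \<sqsubseteq> w' \<longrightarrow> (\<forall>t\<in>elems w' (snd x). subst x t \<phi> \<in> facts w'))"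
proof (intro iffI HOL.allI HOL.impI ballI)
  fix w' t assume *: "All x \<phi> \<in> facts w" "w \<sqsubseteq> w'" "t \<in> elems w' (snd x)"
  have w': "world w'" and A: "All x \<phi> \<in> facts w'"
    using * by (auto simp: future_def)
  have t: "sort_of t = Some (snd x)" "\<And>v. v \<in> fvt t \<Longrightarrow> 0 < level v \<and> level v \<le> wlevel w'"
    using *(3) by (auto simp: elems_def)
  have l': "All x \<phi> \<in> lang (wlevel w')"
    using world_lang[OF w' A] .
  have ff: "free_for t x \<phi>"
    using l' t(2) by (intro free_for_bv) (fastforce simp: lang_def)
  show "subst x t \<phi> \<in> facts w'"
  proof (rule world_closed[OF w'])
    show "subst x t \<phi> \<in> lang (wlevel w')"
      using l' t by (auto simp: lang_def dest!: fv_substD)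
    show "entails (facts w') (subst x t \<phi>)"
      by (rule entails_rule1[OF world_entails[OF w' A]]) (rule derives.allE[OF _ t(1) ff])
  qed
next
  assume *: "\<forall>w'. w \<sqsubseteq> w' \<longrightarrow> (\<forall>t\<in>elems w' (snd x). subst x t \<phi> \<in> facts w')"
  obtain y where y: "level y = Suc (wlevel w)" "snd y = snd x" "y \<notin> {}"
    using fresh_var[of "{}"] by blast
  have fr: "y \<notin> fv \<psi>" if "\<psi> \<in> lang (wlevel w)" for \<psi>
    using that y(1) by (auto simp: lang_def)
  have y\<phi>: "y \<notin> fv \<phi>"
    using fr[OF l] l y(1) by (auto simp: lang_def)
  have "entails (facts w) (subst x (Var y) \<phi>)"
  proof (rule ccontr)
    assume n: "\<not> entails (facts w) (subst x (Var y) \<phi>)"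
    have "facts w \<subseteq> lang (wlevel w)"
      using world_lang[OF w] by blast
    moreover have "subst x (Var y) \<phi> \<in> lang (Suc (wlevel w))"
      using l y by (auto simp: lang_def le_SucI dest!: fv_substD)
    ultimately obtain S where S: "facts w \<subseteq> S" "world (World (Suc (wlevel w)) S)" "subst x (Var y) \<phi> \<notin> S"
      using n by (rule lindenbaum)
    then have "w \<sqsubseteq> (World (Suc (wlevel w)) S)" "Var y \<in> elems (World (Suc (wlevel w)) S) (snd x)"
      using y by (auto simp: future_def elems_def)
    with * S(3) show False
      by fastforce
  qed
  then have "entails (facts w) (All x \<phi>)"
  proof (rule entails_allI)
    show "\<forall>\<psi>\<in>facts w. y \<notin> fv \<psi> \<and> (\<forall>v\<in>bv \<psi>. level v = 0)"
      using world_lang[OF w] fr by (auto simp: lang_def)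
  qed (use y y\<phi> l in \<open>auto simp: lang_def\<close>)
  then show "All x \<phi> \<in> facts w"
    using l by (rule world_closed[OF w, rotated])
qed

lemma world_Ex:
  assumes w: "world w" and l: "Ex x \<phi> \<in> lang (wlevel w)"
  shows "Ex x \<phi> \<in> facts w \<longleftrightarrow> (\<exists>t\<in>elems w (snd x). subst x t \<phi> \<in> facts w)"
proof
  show "Ex x \<phi> \<in> facts w \<Longrightarrow> \<exists>t\<in>elems w (snd x). subst x t \<phi> \<in> facts w"
    using w by (simp add: world_def)
next
  assume "\<exists>t\<in>elems w (snd x). subst x t \<phi> \<in> facts w"
  then obtain t where t: "sort_of t = Some (snd x)" "\<And>v. v \<in> fvt t \<Longrightarrow> 0 < level v"
    and *: "subst x t \<phi> \<in> facts w"
    by (auto simp: elems_def)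
  have ff: "free_for t x \<phi>"
    using l t(2) by (intro free_for_bv) (fastforce simp: lang_def)
  show "Ex x \<phi> \<in> facts w"
  proof (rule world_closed[OF w l])
    show "entails (facts w) (Ex x \<phi>)"
      by (rule entails_rule1[OF world_entails[OF w *]]) (rule derives.exI[OF _ t(1) ff])
  qed
qed

section \<open>Forcing\<close>

primrec tsub :: "(var \<Rightarrow> trm) \<Rightarrow> trm \<Rightarrow> trm" where
  "tsub e (Var v) = e v"
| "tsub e (Con c) = Con c"
| "tsub e (t \<cdot> u) = tsub e t \<cdot> tsub e u"

primrec fsub :: "(var \<Rightarrow> trm) \<Rightarrow> fm \<Rightarrow> fm" where
  "fsub e \<^bold>\<bottom> = \<^bold>\<bottom>"
| "fsub e (t \<^bold>= u) = (tsub e t \<^bold>= tsub e u)"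
| "fsub e (t \<^bold>< u) = (tsub e t \<^bold>< tsub e u)"
| "fsub e (\<phi> \<^bold>\<and> \<psi>) = (fsub e \<phi> \<^bold>\<and> fsub e \<psi>)"
| "fsub e (\<phi> \<^bold>\<or> \<psi>) = (fsub e \<phi> \<^bold>\<or> fsub e \<psi>)"
| "fsub e (\<phi> \<^bold>\<longrightarrow> \<psi>) = (fsub e \<phi> \<^bold>\<longrightarrow> fsub e \<psi>)"
| "fsub e (All v \<phi>) = All v (fsub (e(v := Var v)) \<phi>)"
| "fsub e (Ex v \<phi>) = Ex v (fsub (e(v := Var v)) \<phi>)"

definition up :: "bool \<Rightarrow> world \<Rightarrow> (world \<Rightarrow> bool) \<Rightarrow> bool" where
  "up g w P = (if g then \<forall>w'. w \<sqsubseteq> w' \<longrightarrow> P w' else P w)"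

text \<open>\<open>frc True\<close> is Kripke forcing.  In \<open>frc False\<close> the outermost quantifiers and implications range
  over the present world only, so that a prefix of them costs a single quantification over worlds.\<close>

primrec frc :: "bool \<Rightarrow> world \<Rightarrow> (var \<Rightarrow> trm) \<Rightarrow> fm \<Rightarrow> bool" where
  "frc g w e \<^bold>\<bottom> = False"
| "frc g w e (t \<^bold>= u) = ((tsub e t \<^bold>= tsub e u) \<in> facts w)"
| "frc g w e (t \<^bold>< u) = ((tsub e t \<^bold>< tsub e u) \<in> facts w)"
| "frc g w e (\<phi> \<^bold>\<and> \<psi>) = (frc g w e \<phi> \<and> frc g w e \<psi>)"
| "frc g w e (\<phi> \<^bold>\<or> \<psi>) = (frc True w e \<phi> \<or> frc True w e \<psi>)"
| "frc g w e (\<phi> \<^bold>\<longrightarrow> \<psi>) = up g w (\<lambda>w'. frc True w' e \<phi> \<longrightarrow> frc False w' e \<psi>)"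
| "frc g w e (All x \<phi>) = up g w (\<lambda>w'. \<forall>t\<in>elems w' (snd x). frc False w' (e(x := t)) \<phi>)"
| "frc g w e (Ex x \<phi>) = (\<exists>t\<in>elems w (snd x). frc True w (e(x := t)) \<phi>)"

lemma frc_mono: "\<lbrakk>frc True w e \<phi>; w \<sqsubseteq> w'\<rbrakk> \<Longrightarrow> frc True w' e \<phi>"
proof (induction \<phi> arbitrary: e)
  case (Ex x \<phi>)
  then show ?case
    by (auto dest: elems_mono)
qed (auto simp: up_def future_def)

text \<open>This links the two modes. Atoms, disjunctions and existential formulas are persistent,
  and for a prefix of quantifiers and implications the passage to later worlds is already what
  \<open>up\<close> adds.\<close>

lemma frc_up: "world w \<Longrightarrow> frc True w e \<phi> \<longleftrightarrow> (\<forall>w'. w \<sqsubseteq> w' \<longrightarrow> frc False w' e \<phi>)"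
proof (induction \<phi> arbitrary: e)
  case (Or \<phi> \<psi>)
  have "frc g w e (\<phi> \<^bold>\<or> \<psi>) = frc True w e (\<phi> \<^bold>\<or> \<psi>)" for g w
    by simp
  then show ?case
    using Or.prems future_refl frc_mono by blast
next
  case (Ex x \<phi>)
  have "frc g w e (Ex x \<phi>) = frc True w e (Ex x \<phi>)" for g w
    by simp
  then show ?case
    using Ex.prems future_refl frc_mono by blast
next
  case Fls
  then show ?case
    using future_refl by auto
next
  case (Eq t u)
  then show ?case
    using future_refl by (auto simp: future_def)
next
  case (Less t u)
  then show ?case
    using future_refl by (auto simp: future_def)
qed (auto simp: up_def)

lemma frc_local: "\<lbrakk>frc True w e \<phi>; w \<sqsubseteq> w'\<rbrakk> \<Longrightarrow> frc False w' e \<phi>"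
  using frc_up[of w' e \<phi>] frc_mono[of w e \<phi> w'] future_refl[of w'] future_world[of w w'] by blast

text \<open>The definition forces the body only locally; since elements persist to later worlds, the
  usual Kripke clause is recovered.\<close>

lemma frc_True_All:
  "frc True w e (All x \<phi>) \<longleftrightarrow> (\<forall>w'. w \<sqsubseteq> w' \<longrightarrow> (\<forall>t\<in>elems w' (snd x). frc True w' (e(x := t)) \<phi>))"
  (is "?L = ?R")
proof
  assume L: ?L
  show ?R
  proof (intro HOL.allI HOL.impI ballI)
    fix w' t assume w': "w \<sqsubseteq> w'" "t \<in> elems w' (snd x)"
    have "frc False w'' (e(x := t)) \<phi>" if "w' \<sqsubseteq> w''" for w''
      using L future_trans[OF w'(1) that] elems_mono[OF w'(2) that] by (simp add: up_def)
    then show "frc True w' (e(x := t)) \<phi>"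
      using frc_up[OF future_world[OF w'(1)]] by blast
  qed
next
  assume ?R
  then show ?L
    using frc_local future_refl future_world by (fastforce simp: up_def)
qed

lemma frc_True_Imp:
  "frc True w e (\<phi> \<^bold>\<longrightarrow> \<psi>) \<longleftrightarrow> (\<forall>w'. w \<sqsubseteq> w' \<longrightarrow> frc True w' e \<phi> \<longrightarrow> frc True w' e \<psi>)"
  (is "?L = ?R")
proof
  assume L: ?L
  show ?R
  proof (intro HOL.allI HOL.impI)
    fix w' assume w': "w \<sqsubseteq> w'" "frc True w' e \<phi>"
    have "frc False w'' e \<psi>" if "w' \<sqsubseteq> w''" for w''
      using L future_trans[OF w'(1) that] frc_mono[OF w'(2) that] by (simp add: up_def)
    then show "frc True w' e \<psi>"
      using frc_up[OF future_world[OF w'(1)]] by blast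
  qed
next
  assume ?R
  then show ?L
    using frc_local future_refl future_world by (fastforce simp: up_def)
qed

lemma tsub_cong: "\<forall>v\<in>fvt t. e v = e' v \<Longrightarrow> tsub e t = tsub e' t"
  by (induction t) auto

lemma frc_cong: "\<forall>v\<in>fv \<phi>. e v = e' v \<Longrightarrow> frc g w e \<phi> = frc g w e' \<phi>"
proof (induction \<phi> arbitrary: g w e e')
  case (All x \<phi>)
  have "frc False w' (e(x := t)) \<phi> = frc False w' (e'(x := t)) \<phi>" for w' t
    using All.prems by (intro All.IH) auto
  then show ?case
    by simp
next
  case (Ex x \<phi>)
  have "frc True w (e(x := t)) \<phi> = frc True w (e'(x := t)) \<phi>" for w t
    using Ex.prems by (intro Ex.IH) auto
  then show ?case
    by simp
next
  case (And \<phi> \<psi>)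
  then show ?case
    by (metis UnCI fv.simps(4) frc.simps(4))
next
  case (Or \<phi> \<psi>)
  then show ?case
    by (metis UnCI fv.simps(5) frc.simps(5))
next
  case (Imp \<phi> \<psi>)
  then have "frc g w e \<phi> = frc g w e' \<phi>" "frc g w e \<psi> = frc g w e' \<psi>" for g w
    by simp_all
  then show ?case
    by simp
next
  case (Eq t u)
  then show ?case
    using tsub_cong[of t e e'] tsub_cong[of u e e'] by simp
next
  case (Less t u)
  then show ?case
    using tsub_cong[of t e e'] tsub_cong[of u e e'] by simp
qed simp

lemma tsub_substt: "tsub e (substt x t u) = tsub (e(x := tsub e t)) u"
  by (induction u) auto

lemma tsub_upd_fresh: "v \<notin> fvt t \<Longrightarrow> tsub (e(v := a)) t = tsub e t"
  by (induction t) auto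

text \<open>\<open>x\<close> itself may occur in \<open>t\<close> even if \<open>\<phi>\<close>
  binds it, because substitution stops at a binder of \<open>x\<close>. The induction axiom uses
  this for the successor of \<open>Var x\<close>.\<close>

lemma frc_subst:
  "fvt t \<inter> (bv \<phi> - {x}) = {} \<Longrightarrow> frc g w e (subst x t \<phi>) = frc g w (e(x := tsub e t)) \<phi>"
proof (induction \<phi> arbitrary: g w e)
  case (All v \<phi>)
  show ?case
  proof (cases "v = x")
    case False
    have *: "fvt t \<inter> (bv \<phi> - {x}) = {}" "v \<notin> fvt t"
      using All.prems False by auto
    have "frc g w (e(v := a)) (subst x t \<phi>) = frc g w (e(x := tsub e t, v := a)) \<phi>" for g w a
      unfolding All.IH[OF *(1)] tsub_upd_fresh[OF *(2)] fun_upd_twist[OF False] ..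
    with False show ?thesis
      by (simp del: fun_upd_apply)
  qed (simp del: fun_upd_apply)
next
  case (Ex v \<phi>)
  show ?case
  proof (cases "v = x")
    case False
    have *: "fvt t \<inter> (bv \<phi> - {x}) = {}" "v \<notin> fvt t"
      using Ex.prems False by auto
    have "frc g w (e(v := a)) (subst x t \<phi>) = frc g w (e(x := tsub e t, v := a)) \<phi>" for g w a
      unfolding Ex.IH[OF *(1)] tsub_upd_fresh[OF *(2)] fun_upd_twist[OF False] ..
    with False show ?thesis
      by (simp del: fun_upd_apply)
  qed (simp del: fun_upd_apply)
next
  case (And \<phi> \<psi>)
  then have "fvt t \<inter> (bv \<phi> - {x}) = {}" "fvt t \<inter> (bv \<psi> - {x}) = {}"
    by auto
  with And.IH show ?case
    by simp
next
  case (Or \<phi> \<psi>)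
  then have "fvt t \<inter> (bv \<phi> - {x}) = {}" "fvt t \<inter> (bv \<psi> - {x}) = {}"
    by auto
  with Or.IH show ?case
    by simp
next
  case (Imp \<phi> \<psi>)
  then have "fvt t \<inter> (bv \<phi> - {x}) = {}" "fvt t \<inter> (bv \<psi> - {x}) = {}"
    by auto
  with Imp.IH show ?case
    by simp
qed (simp_all add: tsub_substt)

section \<open>Agreement of forcing with membership in the theory\<close>

lemma sort_of_tsub: "\<forall>v\<in>fvt t. sort_of (e v) = Some (snd v) \<Longrightarrow> sort_of (tsub e t) = sort_of t"
  by (induction t) auto

lemma wff_fsub: "\<forall>v\<in>fv \<phi>. sort_of (e v) = Some (snd v) \<Longrightarrow> wff (fsub e \<phi>) = wff \<phi>"
proof (induction \<phi> arbitrary: e)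
  case (Eq t u)
  then show ?case
    by (simp add: sort_of_tsub)
next
  case (Less t u)
  then show ?case
    by (simp add: sort_of_tsub)
qed simp_all

lemma bv_fsub [simp]: "bv (fsub e \<phi>) = bv \<phi>"
  by (induction \<phi> arbitrary: e) auto

lemma fvt_tsub: "fvt (tsub e t) = (\<Union>v\<in>fvt t. fvt (e v))"
  by (induction t) auto

lemma fv_fsub_sub: "fv (fsub e \<phi>) \<subseteq> (\<Union>v\<in>fv \<phi>. fvt (e v))"
proof (induction \<phi> arbitrary: e)
  case (All x \<phi>)
  show ?case
    using All[of "e(x := Var x)"] by (fastforce split: if_splits)
next
  case (Ex x \<phi>)
  show ?case
    using Ex[of "e(x := Var x)"] by (fastforce split: if_splits)
next
  case (And \<phi> \<psi>)
  then show ?case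
    using And[of e] by simp blast
next
  case (Or \<phi> \<psi>)
  then show ?case
    using Or[of e] by simp blast
next
  case (Imp \<phi> \<psi>)
  then show ?case
    using Imp[of e] by simp blast
qed (auto simp: fvt_tsub)

lemma fsub_lang:
  assumes "wff \<phi>" "\<forall>v\<in>bv \<phi>. level v = 0" "\<forall>v\<in>fv \<phi>. e v \<in> elems w (snd v)"
  shows "fsub e \<phi> \<in> lang (wlevel w)"
  using assms wff_fsub[of \<phi> e] fv_fsub_sub[of e \<phi>] by (fastforce simp: lang_def elems_def)

lemma substt_tsub:
  "\<forall>v\<in>fvt u - {x}. x \<notin> fvt (e v) \<Longrightarrow> substt x t (tsub (e(x := Var x)) u) = tsub (e(x := t)) u"
  by (induction u) auto

lemma subst_fsub:
  "\<forall>v\<in>fv \<phi> - {x}. x \<notin> fvt (e v) \<Longrightarrow> subst x t (fsub (e(x := Var x)) \<phi>) = fsub (e(x := t)) \<phi>"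
proof (induction \<phi> arbitrary: e)
  case (All v \<phi>)
  show ?case
  proof (cases "v = x")
    case False
    have "subst x t (fsub ((e(v := Var v))(x := Var x)) \<phi>) = fsub ((e(v := Var v))(x := t)) \<phi>"
      using All.prems False by (intro All.IH) auto
    then have "subst x t (fsub (e(x := Var x, v := Var v)) \<phi>) = fsub (e(x := t, v := Var v)) \<phi>"
      unfolding fun_upd_twist[OF False] .
    with False show ?thesis
      by (simp del: fun_upd_apply)
  qed (simp del: fun_upd_apply)
next
  case (Ex v \<phi>)
  show ?case
  proof (cases "v = x")
    case False
    have "subst x t (fsub ((e(v := Var v))(x := Var x)) \<phi>) = fsub ((e(v := Var v))(x := t)) \<phi>"
      using Ex.prems False by (intro Ex.IH) auto
    then have "subst x t (fsub (e(x := Var x, v := Var v)) \<phi>) = fsub (e(x := t, v := Var v)) \<phi>"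
      unfolding fun_upd_twist[OF False] .
    with False show ?thesis
      by (simp del: fun_upd_apply)
  qed (simp del: fun_upd_apply)
qed (simp_all add: substt_tsub)

text \<open>Primeness and witnesses serve disjunction and existence, the Lindenbaum extension serves
  implication and universal quantification. The values of \<open>e\<close> contain no variables of
  level 0, so substituting under a binder commutes with updating \<open>e\<close>.\<close>

lemma truth:
  "\<lbrakk>world w; wff \<phi>; \<forall>v\<in>bv \<phi>. level v = 0; \<forall>v\<in>fv \<phi>. e v \<in> elems w (snd v)\<rbrakk>
   \<Longrightarrow> frc True w e \<phi> \<longleftrightarrow> fsub e \<phi> \<in> facts w"
proof (induction \<phi> arbitrary: w e)
  case Fls
  then show ?case
    by (simp add: world_def)
next
  case (And \<phi> \<psi>)
  then show ?case
    by (simp add: world_And)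
next
  case (Or \<phi> \<psi>)
  have "fsub e (\<phi> \<^bold>\<or> \<psi>) \<in> lang (wlevel w)"
    using Or.prems by (intro fsub_lang)
  with Or show ?case
    by (simp add: world_Or)
next
  case (Imp \<phi> \<psi>)
  have l: "fsub e (\<phi> \<^bold>\<longrightarrow> \<psi>) \<in> lang (wlevel w)"
    using Imp.prems by (intro fsub_lang)
  have "frc True w' e \<phi> \<longleftrightarrow> fsub e \<phi> \<in> facts w'" "frc True w' e \<psi> \<longleftrightarrow> fsub e \<psi> \<in> facts w'"
    if "w \<sqsubseteq> w'" for w'
    using Imp.prems elems_mono[OF _ that] future_world[OF that] by (simp_all add: Imp.IH)
  then show ?case
    using l Imp.prems(1) unfolding frc_True_Imp by (simp add: world_Imp)
next
  case (All x \<phi>)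
  have l: "fsub e (All x \<phi>) \<in> lang (wlevel w)"
    using All.prems by (intro fsub_lang)
  have "frc True w' (e(x := t)) \<phi> \<longleftrightarrow> subst x t (fsub (e(x := Var x)) \<phi>) \<in> facts w'"
    if *: "w \<sqsubseteq> w'" "t \<in> elems w' (snd x)" for w' t
  proof -
    have "x \<notin> fvt (e v)" if "v \<in> fv \<phi> - {x}" for v
      using All.prems that by (force simp: elems_def)
    then have "subst x t (fsub (e(x := Var x)) \<phi>) = fsub (e(x := t)) \<phi>"
      by (intro subst_fsub) blast
    moreover have "frc True w' (e(x := t)) \<phi> \<longleftrightarrow> fsub (e(x := t)) \<phi> \<in> facts w'"
      using All.prems * by (intro All.IH) (auto dest: elems_mono future_world)
    ultimately show ?thesis
      by simp
  qed
  then show ?case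
    using l All.prems(1) unfolding frc_True_All by (simp add: world_All)
next
  case (Ex x \<phi>)
  have l: "fsub e (Ex x \<phi>) \<in> lang (wlevel w)"
    using Ex.prems by (intro fsub_lang)
  have "frc True w (e(x := t)) \<phi> \<longleftrightarrow> subst x t (fsub (e(x := Var x)) \<phi>) \<in> facts w"
    if *: "t \<in> elems w (snd x)" for t
  proof -
    have "x \<notin> fvt (e v)" if "v \<in> fv \<phi> - {x}" for v
      using Ex.prems that by (force simp: elems_def)
    then have "subst x t (fsub (e(x := Var x)) \<phi>) = fsub (e(x := t)) \<phi>"
      by (intro subst_fsub) blast
    moreover have "frc True w (e(x := t)) \<phi> \<longleftrightarrow> fsub (e(x := t)) \<phi> \<in> facts w"
      using Ex.prems * by (intro Ex.IH) (auto dest: elems_mono future_world)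
    ultimately show ?thesis
      by simp
  qed
  then show ?case
    using l Ex.prems(1) by (simp add: world_Ex)
qed simp_all

lemma tsub_Var [simp]: "tsub Var t = t"
  by (induction t) auto

lemma fsub_Var [simp]: "fsub Var \<phi> = \<phi>"
  by (induction \<phi>) (auto simp: fun_upd_idem)

lemma truth_Var: "\<lbrakk>world w; \<phi> \<in> lang (wlevel w)\<rbrakk> \<Longrightarrow> frc True w Var \<phi> \<longleftrightarrow> \<phi> \<in> facts w"
  using truth[of w \<phi> Var] by (simp add: lang_def elems_def)

text \<open>A sentence that is not entailed is missed by some world of level 1 and hence not forced
  there. Entailment from no premises is then used at the empty context.\<close>

theorem kripke_completeness:
  assumes "\<phi> \<in> lang 0" "\<And>w. world w \<Longrightarrow> frc True w Var \<phi>"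
  shows "{} \<turnstile> \<phi>"
proof -
  have l: "\<phi> \<in> lang (Suc 0)"
    using assms(1) lang_mono[of 0 "Suc 0"] by auto
  have "entails {} \<phi>"
  proof (rule ccontr)
    assume "\<not> entails {} \<phi>"
    then obtain S where "world (World (Suc 0) S)" "\<phi> \<notin> S"
      using lindenbaum[of "{}" 0 \<phi>] l by blast
    then show False
      using assms(2) truth_Var l by fastforce
  qed
  then show ?thesis
    by (rule entailsE) (simp add: admissible_def)
qed

lemma axiom_forced: "\<lbrakk>world w; \<phi> \<in> axs; \<phi> \<in> lang (wlevel w)\<rbrakk> \<Longrightarrow> frc True w Var \<phi>"
  by (simp add: truth_Var world_axiom)

section \<open>Induction and countable choice in a world\<close>

text \<open>\<open>V\<close> lists the level-0 variables that serve as placeholders, to be filled by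
  the environment; every other free variable is a parameter of the world.\<close>

definition formula :: "world \<Rightarrow> var set \<Rightarrow> fm \<Rightarrow> bool" where
  "formula w V \<phi> \<longleftrightarrow> wff \<phi> \<and> (\<forall>v\<in>bv \<phi> \<union> V. level v = 0)
     \<and> (\<forall>v\<in>fv \<phi>. v \<in> V \<or> 0 < level v \<and> level v \<le> wlevel w)"

text \<open>The calculus has induction for formulas, so the inductive property must be the forcing
  of some \<open>\<phi>\<close>. For this reason later predicates on worlds have counterparts among
  the formulas.\<close>

lemma nat_induction:
  assumes w: "world w" and \<phi>: "formula w {(a, Nat)} \<phi>"
    and 0: "frc True w (Var((a, Nat) := \<^bold>0)) \<phi>"
    and S: "\<And>w' n. \<lbrakk>w \<sqsubseteq> w'; n \<in> elems w' Nat; frc True w' (Var((a, Nat) := n)) \<phi>\<rbrakk>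
       \<Longrightarrow> frc True w' (Var((a, Nat) := nsuc n)) \<phi>"
    and n: "w \<sqsubseteq> w'" "n \<in> elems w' Nat"
  shows "frc True w' (Var((a, Nat) := n)) \<phi>"
proof -
  let ?x = "(a, Nat)"
  let ?ax = "subst ?x \<^bold>0 \<phi> \<^bold>\<and> All ?x (\<phi> \<^bold>\<longrightarrow> subst ?x (nsuc (Var ?x)) \<phi>) \<^bold>\<longrightarrow> All ?x \<phi>"
  have "?ax \<in> lang (wlevel w)"
    using \<phi> by (auto simp: lang_def formula_def dest!: fv_substD)
  then have ax: "frc True w Var ?ax"
    by (intro axiom_forced[OF w] axs.nat_induct) simp_all
  have "frc True w Var (All ?x (\<phi> \<^bold>\<longrightarrow> subst ?x (nsuc (Var ?x)) \<phi>))"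
    unfolding frc_True_All frc_True_Imp
    using S elems_mono future_trans by (simp add: frc_subst)
  moreover have "frc True w Var (subst ?x \<^bold>0 \<phi>)"
    using 0 by (simp add: frc_subst)
  ultimately have "frc True w Var (All ?x \<phi>)"
    using ax future_refl[OF w] unfolding frc_True_Imp by simp
  then show ?thesis
    using n unfolding frc_True_All by simp
qed

text \<open>The axiom speaks about every \<open>y\<close> equal to the value of the choice function;
  reflexivity at the term \<open>f \<cdot> n\<close> turns this into the direct form.\<close>

lemma countable_choice:
  assumes w: "world w" and \<phi>: "formula w {(a, Nat), (b, \<tau>)} \<phi>" and ab: "(a, Nat) \<noteq> (b, \<tau>)"
    and ex: "\<And>w' n. \<lbrakk>w \<sqsubseteq> w'; n \<in> elems w' Nat\<rbrakk>
       \<Longrightarrow> \<exists>v\<in>elems w' \<tau>. frc True w' (Var((a, Nat) := n, (b, \<tau>) := v)) \<phi>"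
  obtains f where "f \<in> elems w (Nat \<rightarrow> \<tau>)"
    "\<And>w' n. \<lbrakk>w \<sqsubseteq> w'; n \<in> elems w' Nat\<rbrakk> \<Longrightarrow> frc True w' (Var((a, Nat) := n, (b, \<tau>) := f \<cdot> n)) \<phi>"
proof -
  let ?n = "(a, Nat)" and ?y = "(b, \<tau>)" and ?f = "(''f'', Nat \<rightarrow> \<tau>)"
  let ?c = "All ?n (Ex ?y \<phi>)"
  let ?g = "All ?n (All ?y (Var ?y \<^bold>= Var ?f \<cdot> Var ?n \<^bold>\<longrightarrow> \<phi>))"
  \<comment> \<open>The name \<open>b\<close> may also be \<open>f\<close>; then only the sorts keep
    the two variables apart.\<close>
  have \<tau>: "\<tau> \<noteq> (Nat \<rightarrow> \<tau>)"
    by (induction \<tau>) auto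
  have lf: "level ?f = 0"
    by (simp add: level_def)
  have f: "?f \<notin> fv \<phi>" "?f \<noteq> ?n" "?f \<noteq> ?y"
    using \<phi> lf \<tau> by (auto simp: formula_def)
  have "(?c \<^bold>\<longrightarrow> Ex ?f ?g) \<in> lang (wlevel w)"
    using \<phi> f lf by (auto simp: lang_def formula_def)
  then have "frc True w Var (?c \<^bold>\<longrightarrow> Ex ?f ?g)"
    using ab f by (intro axiom_forced[OF w] axs.countable_choice) simp_all
  moreover have "frc True w Var ?c"
    unfolding frc_True_All using ex by simp
  ultimately have "frc True w Var (Ex ?f ?g)"
    using future_refl[OF w] unfolding frc_True_Imp by blast
  then obtain F where F: "F \<in> elems w (Nat \<rightarrow> \<tau>)" "frc True w (Var(?f := F)) ?g"
    by auto
  show thesis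
  proof
    fix w' n assume *: "w \<sqsubseteq> w'" "n \<in> elems w' Nat"
    have w': "world w'"
      using *(1) by (rule future_world)
    have Fn: "F \<cdot> n \<in> elems w' \<tau>"
      using *(2) elems_mono[OF F(1) *(1)] by (auto simp: elems_def)
    have "(F \<cdot> n \<^bold>= F \<cdot> n) \<in> facts w'"
      using Fn by (intro world_closed[OF w'] entails_rule0 derives.eq_refl) (auto simp: lang_def elems_def)
    moreover have "frc True w' (Var(?f := F, ?n := n)) (All ?y (Var ?y \<^bold>= Var ?f \<cdot> Var ?n \<^bold>\<longrightarrow> \<phi>))"
      using frc_True_All[THEN iffD1, rule_format, OF F(2) *(1), of n] *(2) by simp
    from frc_True_All[THEN iffD1, rule_format, OF this future_refl[OF w'], of "F \<cdot> n"]
    have "frc True w' (Var(?f := F, ?n := n, ?y := F \<cdot> n)) (Var ?y \<^bold>= Var ?f \<cdot> Var ?n \<^bold>\<longrightarrow> \<phi>)"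
      using Fn by simp
    ultimately have "frc True w' (Var(?f := F, ?n := n, ?y := F \<cdot> n)) \<phi>"
      using future_refl[OF w'] f(2,3) ab unfolding frc_True_Imp by auto
    moreover have "frc True w' (Var(?f := F, ?n := n, ?y := F \<cdot> n)) \<phi>
        = frc True w' (Var(?n := n, ?y := F \<cdot> n)) \<phi>"
      using f(1) by (intro frc_cong) auto
    ultimately show "frc True w' (Var(?n := n, ?y := F \<cdot> n)) \<phi>"
      by simp
  qed (rule F(1))
qed

section \<open>Equality in a world\<close>

text \<open>\<open>\<phi> x\<close> is a template with a hole at \<open>x\<close>. A fresh
  \<open>x\<close> lets the substitution act on the hole alone, and without bound variables nothing
  can be captured.\<close>

lemma derives_eq_subst_fresh:
  assumes "\<Gamma> \<turnstile> t \<^bold>= u" "finite V"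
    "\<And>x. \<lbrakk>x \<notin> V; sort_of t = Some (snd x)\<rbrakk> \<Longrightarrow> bv (\<phi> x) = {} \<and> (\<Gamma> \<turnstile> subst x t (\<phi> x)) \<and> subst x u (\<phi> x) = \<psi>"
  shows "\<Gamma> \<turnstile> \<psi>"
proof -
  obtain \<sigma> where \<sigma>: "sort_of t = Some \<sigma>"
    using derives_wff[OF assms(1)] by (cases "sort_of t") auto
  obtain x where x: "snd x = \<sigma>" "x \<notin> V"
    using fresh_var[OF assms(2)] by metis
  then have "\<Gamma> \<turnstile> subst x u (\<phi> x)"
    using assms(3)[of x] \<sigma> by (intro derives.eq_subst[OF assms(1)] free_for_bv) auto
  then show ?thesis
    using assms(3)[of x] x \<sigma> by simp
qed

lemma derives_eq_sym: "\<Gamma> \<turnstile> t \<^bold>= u \<Longrightarrow> \<Gamma> \<turnstile> u \<^bold>= t"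
  by (rule derives_eq_subst_fresh[of _ _ _ "fvt t" "\<lambda>x. Var x \<^bold>= t"])
    (auto dest: derives_wff intro!: derives.eq_refl)

lemma derives_eq_trans: "\<lbrakk>\<Gamma> \<turnstile> s \<^bold>= t; \<Gamma> \<turnstile> t \<^bold>= u\<rbrakk> \<Longrightarrow> \<Gamma> \<turnstile> s \<^bold>= u"
  by (rule derives_eq_subst_fresh[of _ t u "fvt s" "\<lambda>x. s \<^bold>= Var x"]) auto

lemma derives_eq_app:
  assumes "\<Gamma> \<turnstile> s \<^bold>= s'" "\<Gamma> \<turnstile> t \<^bold>= t'" "sort_of (s \<cdot> t) \<noteq> None"
  shows "\<Gamma> \<turnstile> s \<cdot> t \<^bold>= s' \<cdot> t'"
proof -
  have "\<Gamma> \<turnstile> s \<cdot> t \<^bold>= s' \<cdot> t"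
    by (rule derives_eq_subst_fresh[OF assms(1), of "fvt s \<union> fvt t" "\<lambda>x. s \<cdot> t \<^bold>= Var x \<cdot> t"])
      (use assms(3) in \<open>auto intro!: derives.eq_refl\<close>)
  then show ?thesis
    by (intro derives_eq_subst_fresh[OF assms(2),
        of "fvt s \<union> fvt s' \<union> fvt t" "\<lambda>x. s \<cdot> t \<^bold>= s' \<cdot> Var x"]) auto
qed

lemma derives_less_cong:
  assumes "\<Gamma> \<turnstile> s \<^bold>< t" "\<Gamma> \<turnstile> s \<^bold>= s'" "\<Gamma> \<turnstile> t \<^bold>= t'"
  shows "\<Gamma> \<turnstile> s' \<^bold>< t'"
proof -
  have "\<Gamma> \<turnstile> s' \<^bold>< t"
    by (rule derives_eq_subst_fresh[OF assms(2), of "fvt t" "\<lambda>x. Var x \<^bold>< t"]) (use assms in auto)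
  then show ?thesis
    by (intro derives_eq_subst_fresh[OF assms(3), of "fvt s'" "\<lambda>x. s' \<^bold>< Var x"]) auto
qed

lemma app_sort_eq_Some [simp]:
  "app_sort \<alpha> \<beta> = Some \<tau> \<longleftrightarrow> (\<exists>\<sigma>. \<alpha> = Some (\<sigma> \<rightarrow> \<tau>) \<and> \<beta> = Some \<sigma>)"
  by (cases "(\<alpha>, \<beta>)" rule: app_sort.cases) auto

lemma Some_eq_app_sort [simp]:
  "Some \<tau> = app_sort \<alpha> \<beta> \<longleftrightarrow> (\<exists>\<sigma>. \<alpha> = Some (\<sigma> \<rightarrow> \<tau>) \<and> \<beta> = Some \<sigma>)"
  by (metis app_sort_eq_Some)

lemma elems_sort: "t \<in> elems w \<sigma> \<Longrightarrow> sort_of t = Some \<sigma>"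
  by (simp add: elems_def)

lemma elems_level: "t \<in> elems w \<sigma> \<Longrightarrow> v \<in> fvt t \<Longrightarrow> 0 < level v \<and> level v \<le> wlevel w"
  by (simp add: elems_def)

lemma elems_App: "\<lbrakk>s \<in> elems w (\<sigma> \<rightarrow> \<tau>); t \<in> elems w \<sigma>\<rbrakk> \<Longrightarrow> s \<cdot> t \<in> elems w \<tau>"
  by (auto simp: elems_def)

lemma elems_Con [simp]: "Con c \<in> elems w \<sigma> \<longleftrightarrow> \<sigma> = con_sort c"
  by (auto simp: elems_def)

lemma elems_ops [simp]:
  "m \<in> elems w Nat \<Longrightarrow> nsuc m \<in> elems w Nat"
  "m \<in> elems w Nat \<Longrightarrow> n \<in> elems w Nat \<Longrightarrow> nadd m n \<in> elems w Nat"
  "s \<in> elems w Real \<Longrightarrow> t \<in> elems w Real \<Longrightarrow> s \<^bold>+ t \<in> elems w Real"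
  "s \<in> elems w Real \<Longrightarrow> t \<in> elems w Real \<Longrightarrow> s \<^bold>* t \<in> elems w Real"
  "t \<in> elems w Real \<Longrightarrow> rneg t \<in> elems w Real"
  by (auto simp: elems_def)

lemma fact_Eq_dom:
  assumes "world w" "(s \<^bold>= t) \<in> facts w"
  shows "s \<in> elems w \<sigma> \<longleftrightarrow> t \<in> elems w \<sigma>"
  using world_lang[OF assms] by (auto simp: lang_def elems_def)

lemma fact_Less_dom:
  assumes "world w" "(s \<^bold>< t) \<in> facts w"
  shows "s \<in> elems w Real" "t \<in> elems w Real"
  using world_lang[OF assms] by (auto simp: lang_def elems_def)

lemma eq_refl: "\<lbrakk>world w; t \<in> elems w \<sigma>\<rbrakk> \<Longrightarrow> (t \<^bold>= t) \<in> facts w"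
  by (intro world_closed entails_rule0 derives.eq_refl) (auto simp: lang_def elems_def)

lemma eq_sym:
  assumes w: "world w" and st: "(s \<^bold>= t) \<in> facts w"
  shows "(t \<^bold>= s) \<in> facts w"
proof (rule world_closed[OF w])
  show "(t \<^bold>= s) \<in> lang (wlevel w)"
    using world_lang[OF w st] by (auto simp: lang_def)
  show "entails (facts w) (t \<^bold>= s)"
    by (rule entails_rule1[OF world_entails[OF w st] derives_eq_sym])
qed

lemma eq_trans:
  assumes w: "world w" and st: "(s \<^bold>= t) \<in> facts w" and tu: "(t \<^bold>= u) \<in> facts w"
  shows "(s \<^bold>= u) \<in> facts w"
proof (rule world_closed[OF w])
  show "(s \<^bold>= u) \<in> lang (wlevel w)"
    using world_lang[OF w st] world_lang[OF w tu] by (auto simp: lang_def)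
  show "entails (facts w) (s \<^bold>= u)"
    by (rule entails_rule2[OF world_entails[OF w st] world_entails[OF w tu] derives_eq_trans])
qed

lemma eq_App:
  assumes "world w" "(s \<^bold>= s') \<in> facts w" "(t \<^bold>= t') \<in> facts w" "s \<cdot> t \<in> elems w \<sigma>"
  shows "(s \<cdot> t \<^bold>= s' \<cdot> t') \<in> facts w"
proof (rule world_closed)
  show "(s \<cdot> t \<^bold>= s' \<cdot> t') \<in> lang (wlevel w)"
    using world_lang[OF assms(1,2)] world_lang[OF assms(1,3)] assms(4) by (auto simp: lang_def elems_def)
  show "entails (facts w) (s \<cdot> t \<^bold>= s' \<cdot> t')"
    using assms(4)
    by (intro entails_rule2[OF world_entails[OF assms(1,2)] world_entails[OF assms(1,3)]] derives_eq_app)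
      (auto simp: elems_def)
qed fact

lemma less_cong:
  assumes w: "world w" "(s \<^bold>< t) \<in> facts w" "(s \<^bold>= s') \<in> facts w" "(t \<^bold>= t') \<in> facts w"
  shows "(s' \<^bold>< t') \<in> facts w"
proof -
  have "entails (facts w) (s \<^bold>< t \<^bold>\<and> s \<^bold>= s')"
    using entails_rule2[OF world_entails[OF w(1,2)] world_entails[OF w(1,3)] derives.andI] .
  then have "entails (facts w) (s' \<^bold>< t')"
    by (rule entails_rule2[OF _ world_entails[OF w(1,4)]])
      (rule derives_less_cong, erule derives.andE1, erule derives.andE2)
  moreover have "(s' \<^bold>< t') \<in> lang (wlevel w)"
    using world_lang[OF w(1,2)] world_lang[OF w(1,3)] world_lang[OF w(1,4)] by (auto simp: lang_def)
  ultimately show ?thesis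
    using world_closed w(1) by blast
qed

lemma less_eq_trans: "\<lbrakk>world w; (s \<^bold>< t) \<in> facts w; (t \<^bold>= u) \<in> facts w\<rbrakk> \<Longrightarrow> (s \<^bold>< u) \<in> facts w"
  by (rule less_cong[OF _ _ eq_refl[OF _ fact_Less_dom(1)]])

lemma eq_less_trans: "\<lbrakk>world w; (s \<^bold>= t) \<in> facts w; (t \<^bold>< u) \<in> facts w\<rbrakk> \<Longrightarrow> (s \<^bold>< u) \<in> facts w"
  by (rule less_cong[OF _ _ eq_sym eq_refl[OF _ fact_Less_dom(2)]])

lemma fact_mono: "\<lbrakk>\<phi> \<in> facts w; w \<sqsubseteq> w'\<rbrakk> \<Longrightarrow> \<phi> \<in> facts w'"
  by (auto simp: future_def)

lemma no_fact_Fls: "world w \<Longrightarrow> \<^bold>\<bottom> \<notin> facts w"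
  by (simp add: world_def)

section \<open>The natural numbers in a world\<close>

lemma suc_neq_zero: "\<lbrakk>world w; (nsuc n \<^bold>= \<^bold>0) \<in> facts w\<rbrakk> \<Longrightarrow> False"
  using world_mp[of w, OF _ world_axiom[OF _ axs.nat_suc_neq_zero]] world_lang[of w "nsuc n \<^bold>= \<^bold>0"]
    no_fact_Fls by (auto simp: lang_def)

lemma suc_inj:
  assumes w: "world w" and mn: "(nsuc m \<^bold>= nsuc n) \<in> facts w"
  shows "(m \<^bold>= n) \<in> facts w"
proof (rule world_mp[OF w _ mn])
  show "(nsuc m \<^bold>= nsuc n \<^bold>\<longrightarrow> m \<^bold>= n) \<in> facts w"
    using world_lang[OF w mn] by (intro world_axiom[OF w] axs.nat_suc_inj) (auto simp: lang_def)
qed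

lemma add_zero: "\<lbrakk>world w; n \<in> elems w Nat\<rbrakk> \<Longrightarrow> (nadd n \<^bold>0 \<^bold>= n) \<in> facts w"
  by (rule world_axiom[OF _ axs.nat_add_zero]) (auto simp: lang_def elems_def)

lemma add_suc:
  "\<lbrakk>world w; m \<in> elems w Nat; n \<in> elems w Nat\<rbrakk> \<Longrightarrow> (nadd m (nsuc n) \<^bold>= nsuc (nadd m n)) \<in> facts w"
  by (rule world_axiom[OF _ axs.nat_add_suc]) (auto simp: lang_def elems_def)

lemma eq_suc: "\<lbrakk>world w; (m \<^bold>= n) \<in> facts w; m \<in> elems w Nat\<rbrakk> \<Longrightarrow> (nsuc m \<^bold>= nsuc n) \<in> facts w"
  using eq_App[of w "Con NSuc" "Con NSuc" m n Nat] eq_refl[of w "Con NSuc" "Nat \<rightarrow> Nat"] by simp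

lemma eq_nadd:
  assumes "world w" "(m \<^bold>= m') \<in> facts w" "(n \<^bold>= n') \<in> facts w" "m \<in> elems w Nat" "n \<in> elems w Nat"
  shows "(nadd m n \<^bold>= nadd m' n') \<in> facts w"
  using assms eq_refl[of w "Con NAdd" "Nat \<rightarrow> Nat \<rightarrow> Nat"]
    eq_App[of w "Con NAdd" "Con NAdd" m m' "Nat \<rightarrow> Nat"]
    eq_App[of w "Con NAdd \<cdot> m" "Con NAdd \<cdot> m'" n n' Nat]
  by (simp add: elems_sort elems_App[where \<sigma> = Nat])

definition closed_trm :: "trm \<Rightarrow> bool" where
  "closed_trm t \<longleftrightarrow> (\<forall>v\<in>fvt t. 0 < level v)"

lemma elems_closed: "t \<in> elems w \<sigma> \<Longrightarrow> closed_trm t"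
  by (simp add: elems_def closed_trm_def)

lemma tsub_closed [simp]: "\<lbrakk>closed_trm t; level x = 0\<rbrakk> \<Longrightarrow> tsub (e(x := a)) t = tsub e t"
  by (intro tsub_cong) (auto simp: closed_trm_def)

lemma fvt_closed [simp]: "\<lbrakk>closed_trm t; level x = 0\<rbrakk> \<Longrightarrow> x \<notin> fvt t"
  by (auto simp: closed_trm_def)

lemma zero_add:
  assumes "world w" "n \<in> elems w Nat"
  shows "(nadd \<^bold>0 n \<^bold>= n) \<in> facts w"
proof -
  let ?\<phi> = "nadd \<^bold>0 (Var (''n'', Nat)) \<^bold>= Var (''n'', Nat)"
  have "frc True w (Var((''n'', Nat) := n)) ?\<phi>"
  proof (rule nat_induction[OF assms(1) _ _ _ future_refl[OF assms(1)] assms(2)])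
    show "formula w {(''n'', Nat)} ?\<phi>"
      by (auto simp: formula_def level_def)
    show "frc True w (Var((''n'', Nat) := \<^bold>0)) ?\<phi>"
      using add_zero[OF assms(1)] by simp
    fix w' n assume *: "w \<sqsubseteq> w'" "n \<in> elems w' Nat" "frc True w' (Var((''n'', Nat) := n)) ?\<phi>"
    have w': "world w'"
      using *(1) by (rule future_world)
    have "(nsuc (nadd \<^bold>0 n) \<^bold>= nsuc n) \<in> facts w'"
      using * by (intro eq_suc[OF w']) auto
    then show "frc True w' (Var((''n'', Nat) := nsuc n)) ?\<phi>"
      using eq_trans[OF w' add_suc[OF w']] *(2) by simp
  qed
  then show ?thesis
    by simp
qed

lemma suc_add:
  assumes "world w" "m \<in> elems w Nat" "n \<in> elems w Nat"
  shows "(nadd (nsuc m) n \<^bold>= nsuc (nadd m n)) \<in> facts w"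
proof -
  let ?\<phi> = "nadd (nsuc m) (Var (''n'', Nat)) \<^bold>= nsuc (nadd m (Var (''n'', Nat)))"
  note [simp] = elems_closed[OF assms(2)]
  have l0: "level (''n'', Nat) = 0"
    by (simp add: level_def)
  have "frc True w (Var((''n'', Nat) := n)) ?\<phi>"
  proof (rule nat_induction[OF assms(1) _ _ _ future_refl[OF assms(1)] assms(3)])
    show "formula w {(''n'', Nat)} ?\<phi>"
      using assms(2) by (auto simp: formula_def l0 elems_def)
    have "(nsuc (nadd m \<^bold>0) \<^bold>= nsuc m) \<in> facts w"
      using assms by (intro eq_suc add_zero) auto
    then have "(nadd (nsuc m) \<^bold>0 \<^bold>= nsuc (nadd m \<^bold>0)) \<in> facts w"
      using assms by (intro eq_trans[OF _ add_zero eq_sym]) auto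
    then show "frc True w (Var((''n'', Nat) := \<^bold>0)) ?\<phi>"
      by (simp add: l0)
    fix w' n assume *: "w \<sqsubseteq> w'" "n \<in> elems w' Nat" "frc True w' (Var((''n'', Nat) := n)) ?\<phi>"
    have w': "world w'"
      using *(1) by (rule future_world)
    have m: "m \<in> elems w' Nat"
      using assms(2) *(1) by (rule elems_mono)
    have "(nsuc (nadd (nsuc m) n) \<^bold>= nsuc (nsuc (nadd m n))) \<in> facts w'"
      using * m by (intro eq_suc[OF w']) (auto simp: l0)
    then have "(nadd (nsuc m) (nsuc n) \<^bold>= nsuc (nsuc (nadd m n))) \<in> facts w'"
      using eq_trans[OF w' add_suc[OF w']] *(2) m by simp
    moreover have "(nsuc (nadd m (nsuc n)) \<^bold>= nsuc (nsuc (nadd m n))) \<in> facts w'"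
      using *(2) m by (intro eq_suc[OF w'] add_suc[OF w']) auto
    ultimately have "(nadd (nsuc m) (nsuc n) \<^bold>= nsuc (nadd m (nsuc n))) \<in> facts w'"
      by (rule eq_trans[OF w' _ eq_sym[OF w']])
    then show "frc True w' (Var((''n'', Nat) := nsuc n)) ?\<phi>"
      by (simp add: l0)
  qed
  then show ?thesis
    by (simp add: l0)
qed

lemma add_assoc:
  assumes "world w" "m \<in> elems w Nat" "k \<in> elems w Nat" "n \<in> elems w Nat"
  shows "(nadd (nadd m k) n \<^bold>= nadd m (nadd k n)) \<in> facts w"
proof -
  let ?\<phi> = "nadd (nadd m k) (Var (''n'', Nat)) \<^bold>= nadd m (nadd k (Var (''n'', Nat)))"
  note [simp] = elems_closed[OF assms(2)] elems_closed[OF assms(3)]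
  have l0: "level (''n'', Nat) = 0"
    by (simp add: level_def)
  have "frc True w (Var((''n'', Nat) := n)) ?\<phi>"
  proof (rule nat_induction[OF assms(1) _ _ _ future_refl[OF assms(1)] assms(4)])
    show "formula w {(''n'', Nat)} ?\<phi>"
      using assms(2,3) by (auto simp: formula_def l0 elems_def)
    have "(nadd m k \<^bold>= nadd m (nadd k \<^bold>0)) \<in> facts w"
      using assms by (intro eq_nadd eq_refl eq_sym[OF _ add_zero]) auto
    then have "(nadd (nadd m k) \<^bold>0 \<^bold>= nadd m (nadd k \<^bold>0)) \<in> facts w"
      using assms by (intro eq_trans[OF _ add_zero]) auto
    then show "frc True w (Var((''n'', Nat) := \<^bold>0)) ?\<phi>"
      by (simp add: l0)
    fix w' n assume *: "w \<sqsubseteq> w'" "n \<in> elems w' Nat" "frc True w' (Var((''n'', Nat) := n)) ?\<phi>"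
    have w': "world w'"
      using *(1) by (rule future_world)
    have mk: "m \<in> elems w' Nat" "k \<in> elems w' Nat"
      using assms(2,3) *(1) by (auto intro: elems_mono)
    have "(nsuc (nadd (nadd m k) n) \<^bold>= nsuc (nadd m (nadd k n))) \<in> facts w'"
      using * mk by (intro eq_suc[OF w']) (auto simp: l0)
    then have "(nadd (nadd m k) (nsuc n) \<^bold>= nsuc (nadd m (nadd k n))) \<in> facts w'"
      using eq_trans[OF w' add_suc[OF w']] *(2) mk by simp
    moreover have "(nadd m (nadd k (nsuc n)) \<^bold>= nadd m (nsuc (nadd k n))) \<in> facts w'"
      using *(2) mk w' by (intro eq_nadd eq_refl add_suc) auto
    then have "(nadd m (nadd k (nsuc n)) \<^bold>= nsuc (nadd m (nadd k n))) \<in> facts w'"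
      using eq_trans[OF w' _ add_suc[OF w']] *(2) mk by simp
    ultimately have "(nadd (nadd m k) (nsuc n) \<^bold>= nadd m (nadd k (nsuc n))) \<in> facts w'"
      by (rule eq_trans[OF w' _ eq_sym[OF w']])
    then show "frc True w' (Var((''n'', Nat) := nsuc n)) ?\<phi>"
      by (simp add: l0)
  qed
  then show ?thesis
    by (simp add: l0)
qed

text \<open>The induction proves a disjunction with an existential part; in a world both are
  witnessed, which makes this an ordinary case distinction.\<close>

lemma nat_cases:
  assumes "world w" "n \<in> elems w Nat"
  obtains "(n \<^bold>= \<^bold>0) \<in> facts w" | m where "m \<in> elems w Nat" "(n \<^bold>= nsuc m) \<in> facts w"
proof -
  let ?\<phi> = "Var (''n'', Nat) \<^bold>= \<^bold>0 \<^bold>\<or> EXISTS ''m'' Nat (\<lambda>m. Var (''n'', Nat) \<^bold>= nsuc m)"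
  have l0: "level (''n'', Nat) = 0" "level (''m'', Nat) = 0"
    by (simp_all add: level_def)
  have "frc True w (Var((''n'', Nat) := n)) ?\<phi>"
  proof (rule nat_induction[OF assms(1) _ _ _ future_refl[OF assms(1)] assms(2)])
    show "formula w {(''n'', Nat)} ?\<phi>"
      by (auto simp: formula_def l0)
    show "frc True w (Var((''n'', Nat) := \<^bold>0)) ?\<phi>"
      using eq_refl[OF assms(1), of "\<^bold>0" Nat] by simp
    fix w' n assume *: "w \<sqsubseteq> w'" "n \<in> elems w' Nat"
    show "frc True w' (Var((''n'', Nat) := nsuc n)) ?\<phi>"
      using *(2) eq_refl[OF future_world[OF *(1)], of "nsuc n" Nat] by auto
  qed
  then show ?thesis
    using that by auto
qed

section \<open>The order on the natural numbers\<close>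

definition le :: "world \<Rightarrow> trm \<Rightarrow> trm \<Rightarrow> bool" where
  "le w m n \<longleftrightarrow> (\<exists>d\<in>elems w Nat. (nadd m d \<^bold>= n) \<in> facts w)"

lemma level_name [simp]: "c \<noteq> CHR ''_'' \<Longrightarrow> level (c # s, \<sigma>) = 0"
  by (simp add: level_def)

lemma frc_nle:
  "\<lbrakk>(''le.d'', Nat) \<notin> fvt m; (''le.d'', Nat) \<notin> fvt n\<rbrakk>
   \<Longrightarrow> frc g w e (m \<^bold>\<preceq> n) \<longleftrightarrow> le w (tsub e m) (tsub e n)"
  by (simp add: nle_def le_def tsub_upd_fresh)

lemma wff_nle [simp]: "wff (m \<^bold>\<preceq> n) \<longleftrightarrow> sort_of m = Some Nat \<and> sort_of n = Some Nat"
  by (auto simp: nle_def)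

lemma bv_nle [simp]: "bv (m \<^bold>\<preceq> n) = {(''le.d'', Nat)}"
  by (simp add: nle_def)

lemma fv_nle: "fv (m \<^bold>\<preceq> n) = fvt m \<union> fvt n - {(''le.d'', Nat)}"
  by (auto simp: nle_def)

lemma le_mono: "\<lbrakk>le w m n; w \<sqsubseteq> w'\<rbrakk> \<Longrightarrow> le w' m n"
  unfolding le_def using elems_mono fact_mono by blast

lemma le_cong:
  assumes w: "world w" and "le w m n" "(m \<^bold>= m') \<in> facts w" "(n \<^bold>= n') \<in> facts w" "m \<in> elems w Nat"
  shows "le w m' n'"
proof -
  obtain d where d: "d \<in> elems w Nat" "(nadd m d \<^bold>= n) \<in> facts w"
    using assms(2) by (auto simp: le_def)
  have "(nadd m' d \<^bold>= nadd m d) \<in> facts w"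
    using assms d by (intro eq_sym[OF w eq_nadd[OF w]] eq_refl[OF w]) auto
  then have "(nadd m' d \<^bold>= n') \<in> facts w"
    using d assms(4) eq_trans[OF w] by blast
  then show ?thesis
    using d(1) by (auto simp: le_def)
qed

lemma le_refl: "\<lbrakk>world w; n \<in> elems w Nat\<rbrakk> \<Longrightarrow> le w n n"
  unfolding le_def using add_zero[of w n] by (intro bexI[of _ "\<^bold>0"]) auto

lemma le_add: "\<lbrakk>world w; m \<in> elems w Nat; d \<in> elems w Nat\<rbrakk> \<Longrightarrow> le w m (nadd m d)"
  unfolding le_def using eq_refl[of w "nadd m d" Nat] by (intro bexI[of _ d]) auto

lemma le_suc:
  assumes w: "world w" and n: "n \<in> elems w Nat"
  shows "le w n (nsuc n)"
proof -
  have "(nadd n (nsuc \<^bold>0) \<^bold>= nsuc n) \<in> facts w"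
    using n by (intro eq_trans[OF w add_suc[OF w] eq_suc[OF w add_zero[OF w]]]) auto
  then show ?thesis
    unfolding le_def by (intro bexI[of _ "nsuc \<^bold>0"]) auto
qed

lemma le_trans:
  assumes w: "world w" and "le w m n" "le w n k" "m \<in> elems w Nat"
  shows "le w m k"
proof -
  obtain d d' where d: "d \<in> elems w Nat" "(nadd m d \<^bold>= n) \<in> facts w"
    "d' \<in> elems w Nat" "(nadd n d' \<^bold>= k) \<in> facts w"
    using assms(2,3) by (auto simp: le_def)
  have "(nadd m (nadd d d') \<^bold>= nadd (nadd m d) d') \<in> facts w"
    using d assms(4) by (intro eq_sym[OF w add_assoc[OF w]])
  moreover have "(nadd (nadd m d) d' \<^bold>= nadd n d') \<in> facts w"
    using d assms(4) by (intro eq_nadd[OF w _ eq_refl[OF w]]) auto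
  ultimately have "(nadd m (nadd d d') \<^bold>= k) \<in> facts w"
    using d eq_trans[OF w] by blast
  then show ?thesis
    using d unfolding le_def by (intro bexI[of _ "nadd d d'"]) auto
qed

lemma zero_le: "\<lbrakk>world w; n \<in> elems w Nat\<rbrakk> \<Longrightarrow> le w \<^bold>0 n"
  unfolding le_def using zero_add[of w n] by (intro bexI[of _ n]) auto

text \<open>\<open>le\<close> adds the difference on the right, whereas here it stands on the left;
  so the proof is an induction on \<open>m\<close> through \<open>suc_add\<close>.\<close>

lemma add_le:
  assumes w: "world w" and m: "m \<in> elems w Nat" and n: "n \<in> elems w Nat"
  shows "le w n (nadd m n)"
proof -
  let ?\<phi> = "n \<^bold>\<preceq> nadd (Var (''m'', Nat)) n"
  note [simp] = elems_closed[OF n] elems_sort[OF n]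
  have l0 [simp]: "level (''m'', Nat) = 0"
    by (simp add: level_def)
  have "frc True w (Var((''m'', Nat) := m)) ?\<phi>"
  proof (rule nat_induction[OF w _ _ _ future_refl[OF w] m])
    show "formula w {(''m'', Nat)} ?\<phi>"
      using elems_level[OF n] by (auto simp: formula_def fv_nle)
    show "frc True w (Var((''m'', Nat) := \<^bold>0)) ?\<phi>"
      using le_cong[OF w le_refl[OF w n] eq_refl[OF w n] eq_sym[OF w zero_add[OF w n]] n]
      by (simp add: frc_nle)
    fix w' m assume *: "w \<sqsubseteq> w'" "m \<in> elems w' Nat" "frc True w' (Var((''m'', Nat) := m)) ?\<phi>"
    have w': "world w'" and n': "n \<in> elems w' Nat"
      using *(1) n by (auto dest: future_world elems_mono)
    have "le w' n (nsuc (nadd m n))"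
      using * n' by (intro le_trans[OF w' _ le_suc[OF w']]) (auto simp: frc_nle)
    then show "frc True w' (Var((''m'', Nat) := nsuc m)) ?\<phi>"
      using le_cong[OF w' _ eq_refl[OF w' n'] eq_sym[OF w' suc_add[OF w' *(2) n']] n']
      by (simp add: frc_nle)
  qed
  then show ?thesis
    by (simp add: frc_nle)
qed

lemma le_zero:
  assumes w: "world w" and "le w m \<^bold>0" "m \<in> elems w Nat"
  shows "(m \<^bold>= \<^bold>0) \<in> facts w"
proof -
  obtain d where d: "d \<in> elems w Nat" "(nadd m d \<^bold>= \<^bold>0) \<in> facts w"
    using assms(2) by (auto simp: le_def)
  show ?thesis
  proof (cases rule: nat_cases[OF w d(1)])
    case 1
    have "(nadd m d \<^bold>= nadd m \<^bold>0) \<in> facts w"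
      using 1 d assms by (intro eq_nadd eq_refl) auto
    then have "(nadd m d \<^bold>= m) \<in> facts w"
      using add_zero[OF w assms(3)] eq_trans[OF w] by blast
    then show ?thesis
      using d(2) eq_trans[OF w] eq_sym[OF w] by blast
  next
    case (2 k)
    have "(nadd m d \<^bold>= nadd m (nsuc k)) \<in> facts w"
      using 2 d assms by (intro eq_nadd eq_refl) auto
    then have "(nadd m d \<^bold>= nsuc (nadd m k)) \<in> facts w"
      using add_suc[OF w assms(3) 2(1)] eq_trans[OF w] by blast
    then have "(nsuc (nadd m k) \<^bold>= \<^bold>0) \<in> facts w"
      using d(2) eq_trans[OF w] eq_sym[OF w] by blast
    then show ?thesis
      using suc_neq_zero[OF w] by blast
  qed
qed

lemma le_suc_cases:
  assumes w: "world w" and "le w m (nsuc n)" "m \<in> elems w Nat" "n \<in> elems w Nat"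
  shows "le w m n \<or> (m \<^bold>= nsuc n) \<in> facts w"
proof -
  obtain d where d: "d \<in> elems w Nat" "(nadd m d \<^bold>= nsuc n) \<in> facts w"
    using assms(2) by (auto simp: le_def)
  show ?thesis
  proof (cases rule: nat_cases[OF w d(1)])
    case 1
    have "(nadd m d \<^bold>= nadd m \<^bold>0) \<in> facts w"
      using 1 d assms by (intro eq_nadd eq_refl) auto
    then have "(nadd m d \<^bold>= m) \<in> facts w"
      using add_zero[OF w assms(3)] eq_trans[OF w] by blast
    then show ?thesis
      using d(2) eq_trans[OF w] eq_sym[OF w] by blast
  next
    case (2 k)
    have "(nadd m d \<^bold>= nadd m (nsuc k)) \<in> facts w"
      using 2 d assms by (intro eq_nadd eq_refl) auto
    then have "(nadd m d \<^bold>= nsuc (nadd m k)) \<in> facts w"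
      using add_suc[OF w assms(3) 2(1)] eq_trans[OF w] by blast
    then have "(nsuc (nadd m k) \<^bold>= nsuc n) \<in> facts w"
      using d(2) eq_trans[OF w] eq_sym[OF w] by blast
    then have "(nadd m k \<^bold>= n) \<in> facts w"
      by (rule suc_inj[OF w])
    then show ?thesis
      using 2(1) by (auto simp: le_def)
  qed
qed

lemma le_total:
  assumes w: "world w" and m: "m \<in> elems w Nat" and n: "n \<in> elems w Nat"
  shows "le w m n \<or> le w n m"
proof -
  let ?\<phi> = "Var (''m'', Nat) \<^bold>\<preceq> n \<^bold>\<or> n \<^bold>\<preceq> Var (''m'', Nat)"
  note [simp] = elems_closed[OF n] elems_sort[OF n]
  have l0 [simp]: "level (''m'', Nat) = 0"
    by (simp add: level_def)
  have "frc True w (Var((''m'', Nat) := m)) ?\<phi>"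
  proof (rule nat_induction[OF w _ _ _ future_refl[OF w] m])
    show "formula w {(''m'', Nat)} ?\<phi>"
      using elems_level[OF n] by (auto simp: formula_def fv_nle)
    show "frc True w (Var((''m'', Nat) := \<^bold>0)) ?\<phi>"
      using zero_le[OF w n] by (simp add: frc_nle)
    fix w' m assume *: "w \<sqsubseteq> w'" "m \<in> elems w' Nat" "frc True w' (Var((''m'', Nat) := m)) ?\<phi>"
    have w': "world w'" and n': "n \<in> elems w' Nat"
      using *(1) n by (auto dest: future_world elems_mono)
    have "le w' (nsuc m) n \<or> le w' n (nsuc m)"
      using *(3)
    proof (simp add: frc_nle, elim disjE)
      assume "le w' n m"
      then show ?thesis
        using le_trans[OF w' _ le_suc[OF w' *(2)] n'] by blast
    next
      assume "le w' m n"
      then obtain d where d: "d \<in> elems w' Nat" "(nadd m d \<^bold>= n) \<in> facts w'"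
        by (auto simp: le_def)
      \<comment> \<open>If the difference is 0, then \<open>m\<close> equals \<open>n\<close>;
        otherwise its predecessor is the difference for \<open>nsuc m\<close>.\<close>
      show ?thesis
      proof (cases rule: nat_cases[OF w' d(1)])
        case 1
        have "(nadd m d \<^bold>= nadd m \<^bold>0) \<in> facts w'"
          using 1 d * by (intro eq_nadd[OF w'] eq_refl[OF w']) auto
        then have "(nadd m d \<^bold>= m) \<in> facts w'"
          using add_zero[OF w' *(2)] eq_trans[OF w'] by blast
        then have "(m \<^bold>= n) \<in> facts w'"
          using d(2) eq_trans[OF w'] eq_sym[OF w'] by blast
        then have "le w' n (nsuc m)"
          using *(2) by (intro le_cong[OF w' le_suc[OF w' *(2)] _ eq_refl[OF w', of _ Nat] *(2)]) auto
        then show ?thesis ..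
      next
        case (2 k)
        have "(nadd m d \<^bold>= nadd m (nsuc k)) \<in> facts w'"
          using 2 d * by (intro eq_nadd[OF w'] eq_refl[OF w']) auto
        then have "(nadd m d \<^bold>= nsuc (nadd m k)) \<in> facts w'"
          using add_suc[OF w' *(2) 2(1)] eq_trans[OF w'] by blast
        then have "(nsuc (nadd m k) \<^bold>= n) \<in> facts w'"
          using d(2) eq_trans[OF w'] eq_sym[OF w'] by blast
        then have "(nadd (nsuc m) k \<^bold>= n) \<in> facts w'"
          using suc_add[OF w' *(2) 2(1)] eq_trans[OF w'] by blast
        then show ?thesis
          using 2(1) by (auto simp: le_def)
      qed
    qed
    then show "frc True w' (Var((''m'', Nat) := nsuc m)) ?\<phi>"
      by (simp add: frc_nle)
  qed
  then show ?thesis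
    by (simp add: frc_nle)
qed

lemma zero_neq_one: "\<lbrakk>world w; (t \<^bold>= \<^bold>0) \<in> facts w; (t \<^bold>= nsuc \<^bold>0) \<in> facts w\<rbrakk> \<Longrightarrow> False"
  by (meson eq_sym eq_trans suc_neq_zero)

section \<open>The real numbers in a world\<close>

lemma less_asym: "\<lbrakk>world w; (s \<^bold>< t) \<in> facts w; (t \<^bold>< s) \<in> facts w\<rbrakk> \<Longrightarrow> False"
  using world_mp[of w "s \<^bold>< t \<^bold>\<and> t \<^bold>< s" "\<^bold>\<bottom>"] world_axiom[of w, OF _ axs.real_less_asym[of s t]]
    no_fact_Fls[of w] world_lang[of w "s \<^bold>< t"]
  by (auto simp: lang_def world_And)

lemma less_cotrans:
  assumes "world w" "(s \<^bold>< t) \<in> facts w" "r \<in> elems w Real"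
  shows "(s \<^bold>< r) \<in> facts w \<or> (r \<^bold>< t) \<in> facts w"
proof -
  have "(s \<^bold>< t \<^bold>\<longrightarrow> s \<^bold>< r \<^bold>\<or> r \<^bold>< t) \<in> facts w"
    using fact_Less_dom[OF assms(1,2)] assms(3)
    by (intro world_axiom[OF assms(1)] axs.real_less_cotrans) (auto simp: lang_def elems_def)
  then have "(s \<^bold>< r \<^bold>\<or> r \<^bold>< t) \<in> facts w"
    using assms by (auto intro: world_mp)
  then show ?thesis
    using assms(1) by (simp add: world_def)
qed

lemma less_trans: "\<lbrakk>world w; (s \<^bold>< t) \<in> facts w; (t \<^bold>< u) \<in> facts w\<rbrakk> \<Longrightarrow> (s \<^bold>< u) \<in> facts w"
  using less_cotrans[of w s t u] less_asym[of w t u] fact_Less_dom by blast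

text \<open>The premises of the tightness axiom are negations, and a negation is a fact only if no
  later world violates it.\<close>

lemma less_tight:
  assumes w: "world w" and st: "s \<in> elems w Real" "t \<in> elems w Real"
    and "\<And>w'. w \<sqsubseteq> w' \<Longrightarrow> (s \<^bold>< t) \<notin> facts w'" "\<And>w'. w \<sqsubseteq> w' \<Longrightarrow> (t \<^bold>< s) \<notin> facts w'"
  shows "(s \<^bold>= t) \<in> facts w"
proof (rule world_mp[OF w])
  show "((\<^bold>\<not> (s \<^bold>< t)) \<^bold>\<and> (\<^bold>\<not> (t \<^bold>< s)) \<^bold>\<longrightarrow> s \<^bold>= t) \<in> facts w"
    using st by (intro world_axiom[OF w] axs.real_less_tight) (auto simp: lang_def elems_def)
  have "(\<^bold>\<not> (s \<^bold>< t)) \<in> lang (wlevel w)" "(\<^bold>\<not> (t \<^bold>< s)) \<in> lang (wlevel w)"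
    using st by (auto simp: lang_def elems_def)
  then show "((\<^bold>\<not> (s \<^bold>< t)) \<^bold>\<and> (\<^bold>\<not> (t \<^bold>< s))) \<in> facts w"
    using assms(4,5) by (simp add: world_And[OF w] world_Imp[OF w])
qed

lemma real_add_commute:
  "\<lbrakk>world w; s \<in> elems w Real; t \<in> elems w Real\<rbrakk> \<Longrightarrow> (s \<^bold>+ t \<^bold>= t \<^bold>+ s) \<in> facts w"
  by (rule world_axiom[OF _ axs.real_add_commute]) (auto simp: lang_def elems_def)

lemma real_mul_commute:
  "\<lbrakk>world w; s \<in> elems w Real; t \<in> elems w Real\<rbrakk> \<Longrightarrow> (s \<^bold>* t \<^bold>= t \<^bold>* s) \<in> facts w"
  by (rule world_axiom[OF _ axs.real_mul_commute]) (auto simp: lang_def elems_def)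

lemma eq_radd:
  assumes "world w" "(s \<^bold>= s') \<in> facts w" "(t \<^bold>= t') \<in> facts w" "s \<in> elems w Real" "t \<in> elems w Real"
  shows "(s \<^bold>+ t \<^bold>= s' \<^bold>+ t') \<in> facts w"
  using assms eq_refl[of w "Con RAdd" "Real \<rightarrow> Real \<rightarrow> Real"]
    eq_App[of w "Con RAdd" "Con RAdd" s s' "Real \<rightarrow> Real"]
    eq_App[of w "Con RAdd \<cdot> s" "Con RAdd \<cdot> s'" t t' Real]
  by (simp add: elems_sort elems_App[where \<sigma> = Real])

lemma eq_rmul:
  assumes "world w" "(s \<^bold>= s') \<in> facts w" "(t \<^bold>= t') \<in> facts w" "s \<in> elems w Real" "t \<in> elems w Real"
  shows "(s \<^bold>* t \<^bold>= s' \<^bold>* t') \<in> facts w"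
  using assms eq_refl[of w "Con RMul" "Real \<rightarrow> Real \<rightarrow> Real"]
    eq_App[of w "Con RMul" "Con RMul" s s' "Real \<rightarrow> Real"]
    eq_App[of w "Con RMul \<cdot> s" "Con RMul \<cdot> s'" t t' Real]
  by (simp add: elems_sort elems_App[where \<sigma> = Real])

lemma less_add_right:
  assumes "world w" "(s \<^bold>< t) \<in> facts w" "r \<in> elems w Real"
  shows "(s \<^bold>+ r \<^bold>< t \<^bold>+ r) \<in> facts w"
proof (rule world_mp[OF assms(1) _ assms(2)])
  show "(s \<^bold>< t \<^bold>\<longrightarrow> s \<^bold>+ r \<^bold>< t \<^bold>+ r) \<in> facts w"
    using fact_Less_dom[OF assms(1,2)] assms(3)
    by (intro world_axiom[OF assms(1)] axs.real_less_add) (auto simp: lang_def elems_def)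
qed

lemma add_strict_mono:
  assumes w: "world w" and st: "(s \<^bold>< t) \<in> facts w" and uv: "(u \<^bold>< v) \<in> facts w"
  shows "(s \<^bold>+ u \<^bold>< t \<^bold>+ v) \<in> facts w"
proof -
  note d = fact_Less_dom[OF w st] fact_Less_dom[OF w uv]
  have "(u \<^bold>+ t \<^bold>< v \<^bold>+ t) \<in> facts w"
    by (rule less_add_right[OF w uv d(2)])
  then have "(t \<^bold>+ u \<^bold>< t \<^bold>+ v) \<in> facts w"
    using less_cong[OF w] real_add_commute[OF w] d by blast
  then show ?thesis
    using less_trans[OF w less_add_right[OF w st d(3)]] by blast
qed

lemma rat_mul_pos:
  assumes w: "world w" and p: "0 < p" and e: "(rat 0 \<^bold>< e) \<in> facts w"
  shows "(rat 0 \<^bold>< rat p \<^bold>* e) \<in> facts w"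
proof (rule world_mp[OF w])
  show "(rat 0 \<^bold>< rat p \<^bold>\<and> rat 0 \<^bold>< e \<^bold>\<longrightarrow> rat 0 \<^bold>< rat p \<^bold>* e) \<in> facts w"
    using fact_Less_dom[OF w e]
    by (intro world_axiom[OF w] axs.real_less_mul) (auto simp: lang_def elems_def)
  have "(rat 0 \<^bold>< rat p) \<in> facts w"
    using p by (intro world_axiom[OF w] axs.real_rat_less) (auto simp: lang_def)
  then show "(rat 0 \<^bold>< rat p \<^bold>\<and> rat 0 \<^bold>< e) \<in> facts w"
    using e by (simp add: world_And[OF w])
qed

lemma rat_mul_add:
  assumes w: "world w" and e: "e \<in> elems w Real"
  shows "(rat p \<^bold>* e \<^bold>+ rat q \<^bold>* e \<^bold>= rat (p + q) \<^bold>* e) \<in> facts w"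
proof -
  have c: "(rat p \<^bold>* e \<^bold>= e \<^bold>* rat p) \<in> facts w" for p
    using e by (intro real_mul_commute[OF w]) auto
  have "(e \<^bold>* (rat p \<^bold>+ rat q) \<^bold>= e \<^bold>* rat p \<^bold>+ e \<^bold>* rat q) \<in> facts w"
    using e by (intro world_axiom[OF w] axs.real_distrib) (auto simp: lang_def elems_def)
  moreover have "(rat p \<^bold>* e \<^bold>+ rat q \<^bold>* e \<^bold>= e \<^bold>* rat p \<^bold>+ e \<^bold>* rat q) \<in> facts w"
    using e c by (intro eq_radd[OF w]) auto
  moreover have "(rat p \<^bold>+ rat q \<^bold>= rat (p + q)) \<in> facts w"
    by (intro world_axiom[OF w] axs.real_rat_add) (auto simp: lang_def)
  then have "(e \<^bold>* (rat p \<^bold>+ rat q) \<^bold>= e \<^bold>* rat (p + q)) \<in> facts w"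
    using e by (intro eq_rmul[OF w] eq_refl[OF w]) auto
  ultimately show ?thesis
    using c eq_trans[OF w] eq_sym[OF w] by meson
qed

lemma rat_one_mul: "\<lbrakk>world w; e \<in> elems w Real\<rbrakk> \<Longrightarrow> (rat 1 \<^bold>* e \<^bold>= e) \<in> facts w"
  by (rule eq_trans[OF _ real_mul_commute world_axiom[OF _ axs.real_mul_one]])
    (auto simp: lang_def elems_def)

lemma real_zero_add: "\<lbrakk>world w; e \<in> elems w Real\<rbrakk> \<Longrightarrow> (rat 0 \<^bold>+ e \<^bold>= e) \<in> facts w"
  by (rule eq_trans[OF _ real_add_commute world_axiom[OF _ axs.real_add_zero]])
    (auto simp: lang_def elems_def)

lemma rat_mul_less:
  assumes w: "world w" and pq: "p < q" and e: "(rat 0 \<^bold>< e) \<in> facts w"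
  shows "(rat p \<^bold>* e \<^bold>< rat q \<^bold>* e) \<in> facts w"
proof -
  have d: "e \<in> elems w Real" "rat p \<^bold>* e \<in> elems w Real"
    using fact_Less_dom[OF w e] by auto
  have "(rat 0 \<^bold>+ rat p \<^bold>* e \<^bold>< rat (q - p) \<^bold>* e \<^bold>+ rat p \<^bold>* e) \<in> facts w"
    using pq d by (intro less_add_right[OF w] rat_mul_pos[OF w _ e]) auto
  then show ?thesis
    using less_cong[OF w _ real_zero_add[OF w d(2)] rat_mul_add[OF w d(1), of "q - p" p]] by simp
qed

lemma rat_mul_less_self:
  "\<lbrakk>world w; p < 1; (rat 0 \<^bold>< e) \<in> facts w\<rbrakk> \<Longrightarrow> (rat p \<^bold>* e \<^bold>< e) \<in> facts w"
  using less_eq_trans[of w, OF _ rat_mul_less rat_one_mul] fact_Less_dom(2)[of w] by blast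

lemma half_add_half:
  assumes w: "world w" and e: "e \<in> elems w Real"
  shows "(rat (1/2) \<^bold>* e \<^bold>+ rat (1/2) \<^bold>* e \<^bold>= e) \<in> facts w"
  using rat_mul_add[OF w e, of "1/2" "1/2"] rat_one_mul[OF w e] eq_trans[OF w] by simp

section \<open>Well-formedness of formulas over a world\<close>

definition tm :: "world \<Rightarrow> var set \<Rightarrow> trm \<Rightarrow> bool" where
  "tm w V t \<longleftrightarrow> (\<forall>v\<in>fvt t. v \<in> V \<or> 0 < level v \<and> level v \<le> wlevel w)"

definition bound_names :: "var set \<Rightarrow> bool" where
  "bound_names V \<longleftrightarrow> (\<forall>v\<in>V. level v = 0)"

lemma bound_names_simps [simp]:
  "bound_names {}" "bound_names (insert v V) \<longleftrightarrow> level v = 0 \<and> bound_names V"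
  by (auto simp: bound_names_def)

lemma tm_simps [simp]:
  "tm w V (s \<cdot> t) \<longleftrightarrow> tm w V s \<and> tm w V t"
  "tm w V (Con c)"
  "v \<in> V \<Longrightarrow> tm w V (Var v)"
  by (auto simp: tm_def)

lemma elems_tm: "t \<in> elems w \<sigma> \<Longrightarrow> tm w V t"
  by (simp add: elems_def tm_def)

lemmas elems_facts = elems_sort elems_closed elems_tm

lemma formula_simps [simp]:
  "\<lbrakk>bound_names V; sort_of t = Some \<sigma>; sort_of u = Some \<sigma>; tm w V t; tm w V u\<rbrakk> \<Longrightarrow> formula w V (t \<^bold>= u)"
  "\<lbrakk>bound_names V; sort_of t = Some Real; sort_of u = Some Real; tm w V t; tm w V u\<rbrakk> \<Longrightarrow> formula w V (t \<^bold>< u)"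
  "\<lbrakk>bound_names V; sort_of t = Some Nat; sort_of u = Some Nat; tm w V t; tm w V u\<rbrakk> \<Longrightarrow> formula w V (t \<^bold>\<preceq> u)"
  "bound_names V \<Longrightarrow> formula w V \<^bold>\<bottom>"
  "\<lbrakk>formula w V \<phi>; formula w V \<psi>\<rbrakk> \<Longrightarrow> formula w V (\<phi> \<^bold>\<and> \<psi>)"
  "\<lbrakk>formula w V \<phi>; formula w V \<psi>\<rbrakk> \<Longrightarrow> formula w V (\<phi> \<^bold>\<or> \<psi>)"
  "\<lbrakk>formula w V \<phi>; formula w V \<psi>\<rbrakk> \<Longrightarrow> formula w V (\<phi> \<^bold>\<longrightarrow> \<psi>)"
  "\<lbrakk>level v = 0; formula w (insert v V) \<phi>\<rbrakk> \<Longrightarrow> formula w V (All v \<phi>)"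
  "\<lbrakk>level v = 0; formula w (insert v V) \<phi>\<rbrakk> \<Longrightarrow> formula w V (Ex v \<phi>)"
  by (auto simp: formula_def tm_def bound_names_def fv_nle)

lemma frc_rle [simp]:
  "frc g w e (t \<^bold>\<le> u) \<longleftrightarrow> up g w (\<lambda>w'. (tsub e u \<^bold>< tsub e t) \<notin> facts w')"
  by (simp add: rle_def)

lemma up_False [simp]: "up False w P = P w"
  by (simp add: up_def)

lemma up_True: "up True w P \<longleftrightarrow> (\<forall>w'. w \<sqsubseteq> w' \<longrightarrow> P w')"
  by (simp add: up_def)

lemma app_cong:
  "\<lbrakk>world w; a \<in> elems w (\<sigma> \<rightarrow> \<tau>); m \<in> elems w \<sigma>; (m \<^bold>= n) \<in> facts w\<rbrakk> \<Longrightarrow> (a \<cdot> m \<^bold>= a \<cdot> n) \<in> facts w"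
  by (rule eq_App[OF _ eq_refl _ elems_App])

lemma less_irrefl: "\<lbrakk>world w; (s \<^bold>< t) \<in> facts w; (s \<^bold>= t) \<in> facts w\<rbrakk> \<Longrightarrow> False"
  using less_asym eq_less_trans eq_sym less_cong by blast

lemma suc_neq_self:
  assumes w: "world w" and n: "n \<in> elems w Nat" and eq: "(n \<^bold>= nsuc n) \<in> facts w"
  shows False
proof -
  let ?\<phi> = "\<^bold>\<not> (Var (''n'', Nat) \<^bold>= nsuc (Var (''n'', Nat)))"
  have "frc True w (Var((''n'', Nat) := n)) ?\<phi>"
  proof (rule nat_induction[OF w _ _ _ future_refl[OF w] n])
    show "formula w {(''n'', Nat)} ?\<phi>"
      by simp
    show "frc True w (Var((''n'', Nat) := \<^bold>0)) ?\<phi>"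
      by (auto simp: up_True intro: suc_neq_zero[OF future_world] eq_sym[OF future_world])
    fix w' n assume *: "w \<sqsubseteq> w'" "n \<in> elems w' Nat" "frc True w' (Var((''n'', Nat) := n)) ?\<phi>"
    then show "frc True w' (Var((''n'', Nat) := nsuc n)) ?\<phi>"
      by (auto simp: up_True dest: suc_inj[OF future_world])
  qed
  then show False
    using eq future_refl[OF w] by (simp add: up_True)
qed

lemma max_nat:
  assumes "world w" "m \<in> elems w Nat" "n \<in> elems w Nat"
  obtains k where "k \<in> elems w Nat" "le w m k" "le w n k"
  using le_total[OF assms] le_refl[OF assms(1)] assms by blast

section \<open>Metric spaces and convergence in a world\<close>

definition conv :: "world \<Rightarrow> trm \<Rightarrow> (trm \<Rightarrow> trm) \<Rightarrow> trm \<Rightarrow> bool" where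
  "conv w d s l \<longleftrightarrow> (\<forall>w'. w \<sqsubseteq> w' \<longrightarrow> (\<forall>e\<in>elems w' Real. (rat 0 \<^bold>< e) \<in> facts w' \<longrightarrow>
     (\<exists>N\<in>elems w' Nat. \<forall>w''. w' \<sqsubseteq> w'' \<longrightarrow> (\<forall>n\<in>elems w'' Nat. le w'' N n \<longrightarrow> (d \<cdot> s n \<cdot> l \<^bold>< e) \<in> facts w''))))"

lemma conv_mono: "\<lbrakk>conv w d s l; w \<sqsubseteq> w'\<rbrakk> \<Longrightarrow> conv w' d s l"
  unfolding conv_def using future_trans by blast

lemma convE:
  assumes "conv w d s l" "w \<sqsubseteq> w'" "(rat 0 \<^bold>< e) \<in> facts w'"
  obtains N where "N \<in> elems w' Nat"
    "\<And>w'' n. \<lbrakk>w' \<sqsubseteq> w''; n \<in> elems w'' Nat; le w'' N n\<rbrakk> \<Longrightarrow> (d \<cdot> s n \<cdot> l \<^bold>< e) \<in> facts w''"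
  using assms fact_Less_dom(2)[OF future_world[OF assms(2)] assms(3)] unfolding conv_def by meson

definition fresh_con :: "trm \<Rightarrow> bool" where
  "fresh_con t \<longleftrightarrow> (''con.e'', Real) \<notin> fvt t \<and> (''con.N'', Nat) \<notin> fvt t \<and> (''con.n'', Nat) \<notin> fvt t"

text \<open>The general term in \<open>converges\<close> is a function on terms, into which
  evaluation cannot be pushed in general. The two shapes that occur get a lemma each.\<close>

lemma frc_converges_seq:
  "\<lbrakk>fresh_con d; fresh_con z; fresh_con l\<rbrakk>
   \<Longrightarrow> frc True w e (converges d (\<lambda>n. z \<cdot> n) l) \<longleftrightarrow> conv w (tsub e d) (\<lambda>n. tsub e z \<cdot> n) (tsub e l)"
  by (simp add: converges_def conv_def up_True frc_nle tsub_upd_fresh fresh_con_def)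

lemma frc_converges_fun_seq:
  "\<lbrakk>fresh_con d; fresh_con F; fresh_con z; fresh_con l\<rbrakk>
   \<Longrightarrow> frc True w e (converges d (\<lambda>n. F \<cdot> n \<cdot> z) l)
     \<longleftrightarrow> conv w (tsub e d) (\<lambda>n. tsub e F \<cdot> n \<cdot> tsub e z) (tsub e l)"
  by (simp add: converges_def conv_def up_True frc_nle tsub_upd_fresh fresh_con_def)

definition mspace :: "world \<Rightarrow> sort \<Rightarrow> trm \<Rightarrow> bool" where
  "mspace w \<sigma> d \<longleftrightarrow> world w \<and> d \<in> elems w (\<sigma> \<rightarrow> \<sigma> \<rightarrow> Real) \<and> frc True w Var (metric \<sigma> d)"

lemma mspace_mono: "\<lbrakk>mspace w \<sigma> d; w \<sqsubseteq> w'\<rbrakk> \<Longrightarrow> mspace w' \<sigma> d"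
  unfolding mspace_def using future_world elems_mono frc_mono by blast

lemma mspace_facts:
  assumes "mspace w \<sigma> d" "x \<in> elems w \<sigma>" "y \<in> elems w \<sigma>" "z \<in> elems w \<sigma>"
  shows "(d \<cdot> x \<cdot> y \<^bold>< rat 0) \<notin> facts w" "(d \<cdot> x \<cdot> y \<^bold>= rat 0) \<in> facts w \<longleftrightarrow> (x \<^bold>= y) \<in> facts w"
    "(d \<cdot> x \<cdot> y \<^bold>= d \<cdot> y \<cdot> x) \<in> facts w" "(d \<cdot> x \<cdot> y \<^bold>+ d \<cdot> y \<cdot> z \<^bold>< d \<cdot> x \<cdot> z) \<notin> facts w"
proof -
  have d: "d \<in> elems w (\<sigma> \<rightarrow> \<sigma> \<rightarrow> Real)" and w: "world w"
    using assms(1) by (auto simp: mspace_def)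
  \<comment> \<open>The local mode unfolds the quantifiers of \<open>metric\<close> at
    \<open>w\<close> alone, so its negations become statements about \<open>w\<close> only.\<close>
  have "frc False w Var (metric \<sigma> d)"
    using assms(1) by (auto simp: mspace_def intro: frc_local future_refl)
  moreover have "frc False w Var (metric \<sigma> d) \<longleftrightarrow> (\<forall>x\<in>elems w \<sigma>. \<forall>y\<in>elems w \<sigma>. \<forall>z\<in>elems w \<sigma>.
      (d \<cdot> x \<cdot> y \<^bold>< rat 0) \<notin> facts w
      \<and> (((d \<cdot> x \<cdot> y \<^bold>= rat 0) \<in> facts w \<longrightarrow> (x \<^bold>= y) \<in> facts w)
        \<and> ((x \<^bold>= y) \<in> facts w \<longrightarrow> (d \<cdot> x \<cdot> y \<^bold>= rat 0) \<in> facts w))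
      \<and> (d \<cdot> x \<cdot> y \<^bold>= d \<cdot> y \<cdot> x) \<in> facts w \<and> (d \<cdot> x \<cdot> y \<^bold>+ d \<cdot> y \<cdot> z \<^bold>< d \<cdot> x \<cdot> z) \<notin> facts w)"
    using elems_closed[OF d] by (simp add: metric_def)
  ultimately have "\<forall>x\<in>elems w \<sigma>. \<forall>y\<in>elems w \<sigma>. \<forall>z\<in>elems w \<sigma>.
      (d \<cdot> x \<cdot> y \<^bold>< rat 0) \<notin> facts w
      \<and> (((d \<cdot> x \<cdot> y \<^bold>= rat 0) \<in> facts w \<longrightarrow> (x \<^bold>= y) \<in> facts w)
        \<and> ((x \<^bold>= y) \<in> facts w \<longrightarrow> (d \<cdot> x \<cdot> y \<^bold>= rat 0) \<in> facts w))
      \<and> (d \<cdot> x \<cdot> y \<^bold>= d \<cdot> y \<cdot> x) \<in> facts w \<and> (d \<cdot> x \<cdot> y \<^bold>+ d \<cdot> y \<cdot> z \<^bold>< d \<cdot> x \<cdot> z) \<notin> facts w"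
    by (simp only:)
  from this[rule_format, OF assms(2-4)]
  show "(d \<cdot> x \<cdot> y \<^bold>< rat 0) \<notin> facts w" "(d \<cdot> x \<cdot> y \<^bold>= rat 0) \<in> facts w \<longleftrightarrow> (x \<^bold>= y) \<in> facts w"
    "(d \<cdot> x \<cdot> y \<^bold>= d \<cdot> y \<cdot> x) \<in> facts w" "(d \<cdot> x \<cdot> y \<^bold>+ d \<cdot> y \<cdot> z \<^bold>< d \<cdot> x \<cdot> z) \<notin> facts w"
    by blast+
qed

context
  fixes w \<sigma> d
  assumes d: "mspace w \<sigma> d"
begin

lemma mspace_world: "world w"
  using d by (simp add: mspace_def)

lemma dist_dom: "\<lbrakk>x \<in> elems w \<sigma>; y \<in> elems w \<sigma>\<rbrakk> \<Longrightarrow> d \<cdot> x \<cdot> y \<in> elems w Real"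
  using d by (auto simp: mspace_def intro: elems_App)

lemma dist_cong:
  assumes "x \<in> elems w \<sigma>" "y \<in> elems w \<sigma>" "(x \<^bold>= x') \<in> facts w" "(y \<^bold>= y') \<in> facts w"
  shows "(d \<cdot> x \<cdot> y \<^bold>= d \<cdot> x' \<cdot> y') \<in> facts w"
  using d assms(1) mspace_world
  by (intro eq_App[OF mspace_world app_cong[OF mspace_world] assms(4) dist_dom[OF assms(1,2)]])
    (auto simp: mspace_def assms)

lemma dist_less_cong:
  assumes "(d \<cdot> x \<cdot> y \<^bold>< e) \<in> facts w" "x \<in> elems w \<sigma>" "y \<in> elems w \<sigma>" "(x \<^bold>= x') \<in> facts w" "(y \<^bold>= y') \<in> facts w"
  shows "(d \<cdot> x' \<cdot> y' \<^bold>< e) \<in> facts w"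
  using eq_less_trans[OF mspace_world eq_sym[OF mspace_world dist_cong] assms(1)] assms(2-5) by blast

lemma dist_less_sym:
  assumes "(d \<cdot> x \<cdot> y \<^bold>< e) \<in> facts w" "x \<in> elems w \<sigma>" "y \<in> elems w \<sigma>"
  shows "(d \<cdot> y \<cdot> x \<^bold>< e) \<in> facts w"
  using eq_less_trans[OF mspace_world mspace_facts(3)[OF d assms(3,2,2)] assms(1)] .

lemma dist_eq_less:
  assumes "(x \<^bold>= y) \<in> facts w" "x \<in> elems w \<sigma>" "(rat 0 \<^bold>< e) \<in> facts w"
  shows "(d \<cdot> x \<cdot> y \<^bold>< e) \<in> facts w"
proof -
  have y: "y \<in> elems w \<sigma>"
    using fact_Eq_dom[OF mspace_world assms(1)] assms(2) by blast
  then show ?thesis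
    using eq_less_trans[OF mspace_world _ assms(3)] mspace_facts(2)[OF d assms(2) y y] assms(1) by blast
qed

text \<open>The triangle inequality is a negated strict inequality. Cotransitivity, applied to the
  sums with the distance of \<open>x\<close> and \<open>z\<close> in between, turns it into a strict
  bound.\<close>

lemma dist_triangle_less:
  assumes "(d \<cdot> x \<cdot> y \<^bold>< a) \<in> facts w" "(d \<cdot> y \<cdot> z \<^bold>< b) \<in> facts w"
    "x \<in> elems w \<sigma>" "y \<in> elems w \<sigma>" "z \<in> elems w \<sigma>"
  shows "(d \<cdot> x \<cdot> z \<^bold>< a \<^bold>+ b) \<in> facts w"
  using less_cotrans[OF mspace_world add_strict_mono[OF mspace_world assms(1,2)] dist_dom[OF assms(3,5)]]
    mspace_facts(4)[OF d assms(3-5)] by blast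

end

lemma dist_eqI:
  assumes d: "mspace w \<sigma> d" and xy: "x \<in> elems w \<sigma>" "y \<in> elems w \<sigma>"
    and n: "\<And>w'. w \<sqsubseteq> w' \<Longrightarrow> (rat 0 \<^bold>< d \<cdot> x \<cdot> y) \<notin> facts w'"
  shows "(x \<^bold>= y) \<in> facts w"
proof -
  have "(d \<cdot> x \<cdot> y \<^bold>= rat 0) \<in> facts w"
  proof (rule less_tight[OF mspace_world[OF d] dist_dom[OF d xy]])
    show "(d \<cdot> x \<cdot> y \<^bold>< rat 0) \<notin> facts w'" if "w \<sqsubseteq> w'" for w'
      using mspace_facts(1)[OF mspace_mono[OF d that]] xy elems_mono[OF _ that] by blast
  qed (use n in auto)
  then show ?thesis
    using mspace_facts(2)[OF d xy xy(1)] by blast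
qed

lemma limit_eventually_const:
  assumes d: "mspace w \<sigma> d" and conv: "conv w d s l" and l: "l \<in> elems w \<sigma>" and c: "c \<in> elems w \<sigma>"
    and s: "\<And>w' n. \<lbrakk>w \<sqsubseteq> w'; n \<in> elems w' Nat\<rbrakk> \<Longrightarrow> s n \<in> elems w' \<sigma>"
    and M: "M \<in> elems w Nat" "\<And>w' n. \<lbrakk>w \<sqsubseteq> w'; n \<in> elems w' Nat; le w' M n\<rbrakk> \<Longrightarrow> (s n \<^bold>= c) \<in> facts w'"
  shows "(l \<^bold>= c) \<in> facts w"
proof (rule dist_eqI[OF d l c])
  fix w' assume w': "w \<sqsubseteq> w'"
  note d' = mspace_mono[OF d w'] and lc = elems_mono[OF l w'] elems_mono[OF c w']
  note ww = mspace_world[OF d']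
  show "(rat 0 \<^bold>< d \<cdot> l \<cdot> c) \<notin> facts w'"
  proof
    \<comment> \<open>The supposedly positive distance serves itself as the tolerance for the
      convergence of \<open>s\<close>.\<close>
    assume "(rat 0 \<^bold>< d \<cdot> l \<cdot> c) \<in> facts w'"
    then obtain N where N: "N \<in> elems w' Nat"
      "\<And>w'' n. \<lbrakk>w' \<sqsubseteq> w''; n \<in> elems w'' Nat; le w'' N n\<rbrakk> \<Longrightarrow> (d \<cdot> s n \<cdot> l \<^bold>< d \<cdot> l \<cdot> c) \<in> facts w''"
      using convE[OF conv w'] by metis
    obtain k where k: "k \<in> elems w' Nat" "le w' M k" "le w' N k"
      using max_nat[OF ww elems_mono[OF M(1) w'] N(1)] by blast
    have "(d \<cdot> s k \<cdot> l \<^bold>< d \<cdot> l \<cdot> c) \<in> facts w'"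
      by (rule N(2)[OF future_refl[OF ww] k(1,3)])
    then have "(d \<cdot> c \<cdot> l \<^bold>< d \<cdot> l \<cdot> c) \<in> facts w'"
      by (rule dist_less_cong[OF d' _ s[OF w' k(1)] lc(1) M(2)[OF w' k(1,2)] eq_refl[OF ww lc(1)]])
    then show False
      using less_irrefl[OF ww] mspace_facts(3)[OF d' lc(2,1,1)] by blast
  qed
qed

section \<open>Binary sequences\<close>

definition binary :: "world \<Rightarrow> trm \<Rightarrow> bool" where
  "binary w a \<longleftrightarrow> (\<forall>w'. w \<sqsubseteq> w' \<longrightarrow>
     (\<forall>n\<in>elems w' Nat. (a \<cdot> n \<^bold>= \<^bold>0) \<in> facts w' \<or> (a \<cdot> n \<^bold>= nsuc \<^bold>0) \<in> facts w'))"

definition zero_upto :: "world \<Rightarrow> trm \<Rightarrow> trm \<Rightarrow> bool" where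
  "zero_upto w a n \<longleftrightarrow> (\<forall>w'. w \<sqsubseteq> w' \<longrightarrow> (\<forall>j\<in>elems w' Nat. le w' j n \<longrightarrow> (a \<cdot> j \<^bold>= \<^bold>0) \<in> facts w'))"

text \<open>The alternative \<open>j = n\<close> in \<open>first\<close> stands in for a strict order.\<close>

definition first :: "world \<Rightarrow> trm \<Rightarrow> trm \<Rightarrow> bool" where
  "first w a n \<longleftrightarrow> (a \<cdot> n \<^bold>= nsuc \<^bold>0) \<in> facts w \<and> (\<forall>w'. w \<sqsubseteq> w' \<longrightarrow>
     (\<forall>j\<in>elems w' Nat. le w' j n \<longrightarrow> (a \<cdot> j \<^bold>= \<^bold>0) \<in> facts w' \<or> (j \<^bold>= n) \<in> facts w'))"

definition zero_upto_fm :: "trm \<Rightarrow> trm \<Rightarrow> fm" where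
  "zero_upto_fm a n = FORALL ''j'' Nat (\<lambda>j. j \<^bold>\<preceq> n \<^bold>\<longrightarrow> a \<cdot> j \<^bold>= \<^bold>0)"

definition first_fm :: "trm \<Rightarrow> trm \<Rightarrow> fm" where
  "first_fm a n = (a \<cdot> n \<^bold>= nsuc \<^bold>0 \<^bold>\<and> FORALL ''j'' Nat (\<lambda>j. j \<^bold>\<preceq> n \<^bold>\<longrightarrow> a \<cdot> j \<^bold>= \<^bold>0 \<^bold>\<or> j \<^bold>= n))"

lemma frc_zero_upto:
  "\<lbrakk>closed_trm a; (''j'', Nat) \<notin> fvt n; (''le.d'', Nat) \<notin> fvt n\<rbrakk>
   \<Longrightarrow> frc True w e (zero_upto_fm a n) \<longleftrightarrow> zero_upto w (tsub e a) (tsub e n)"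
  by (simp add: zero_upto_fm_def zero_upto_def up_True frc_nle tsub_upd_fresh)

lemma frc_first:
  "\<lbrakk>closed_trm a; (''j'', Nat) \<notin> fvt n; (''le.d'', Nat) \<notin> fvt n\<rbrakk>
   \<Longrightarrow> frc True w e (first_fm a n) \<longleftrightarrow> first w (tsub e a) (tsub e n)"
  by (simp add: first_fm_def first_def up_True frc_nle tsub_upd_fresh)

lemma zero_upto_mono: "\<lbrakk>zero_upto w a n; w \<sqsubseteq> w'\<rbrakk> \<Longrightarrow> zero_upto w' a n"
  unfolding zero_upto_def using future_trans by blast

lemma first_mono: "\<lbrakk>first w a n; w \<sqsubseteq> w'\<rbrakk> \<Longrightarrow> first w' a n"
  unfolding first_def using future_trans fact_mono by blast

lemma binary_mono: "\<lbrakk>binary w a; w \<sqsubseteq> w'\<rbrakk> \<Longrightarrow> binary w' a"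
  unfolding binary_def using future_trans by blast

lemma zero_uptoD:
  "\<lbrakk>zero_upto w a n; world w; j \<in> elems w Nat; le w j n; (a \<cdot> j \<^bold>= nsuc \<^bold>0) \<in> facts w\<rbrakk> \<Longrightarrow> False"
  unfolding zero_upto_def using zero_neq_one future_refl by blast

lemma first_le:
  "\<lbrakk>first w a n; world w; j \<in> elems w Nat; le w j n; (a \<cdot> j \<^bold>= nsuc \<^bold>0) \<in> facts w\<rbrakk> \<Longrightarrow> (j \<^bold>= n) \<in> facts w"
  unfolding first_def using zero_neq_one future_refl by blast

lemma first_unique:
  assumes "world w" "first w a m" "first w a n" "m \<in> elems w Nat" "n \<in> elems w Nat"
  shows "(m \<^bold>= n) \<in> facts w"
  using le_total[OF assms(1,4,5)]
proof
  assume "le w m n"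
  then show ?thesis
    using assms by (intro first_le[of w a n m]) (auto simp: first_def)
next
  assume "le w n m"
  then have "(n \<^bold>= m) \<in> facts w"
    using assms by (intro first_le[of w a m n]) (auto simp: first_def)
  then show ?thesis
    using eq_sym assms(1) by blast
qed

text \<open>Each single value of \<open>a\<close> is decided in a world, so an initial segment can
  be searched by induction, although the whole sequence cannot.\<close>

lemma bounded_search:
  assumes w: "world w" and a: "a \<in> elems w (Nat \<rightarrow> Nat)" and bin: "binary w a" and n: "n \<in> elems w Nat"
  obtains "zero_upto w a n" | m where "m \<in> elems w Nat" "le w m n" "first w a m"
proof -
  note [simp] = elems_facts[OF a]
  let ?\<phi> = "zero_upto_fm a (Var (''n'', Nat))
    \<^bold>\<or> EXISTS ''m'' Nat (\<lambda>m. m \<^bold>\<preceq> Var (''n'', Nat) \<^bold>\<and> first_fm a m)"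
  have iff: "frc True w (Var((''n'', Nat) := n)) ?\<phi>
      \<longleftrightarrow> zero_upto w a n \<or> (\<exists>m\<in>elems w Nat. le w m n \<and> first w a m)" for w n
    by (simp add: frc_zero_upto frc_first frc_nle)
  have "frc True w (Var((''n'', Nat) := n)) ?\<phi>"
  proof (rule nat_induction[OF w _ _ _ future_refl[OF w] n])
    show "formula w {(''n'', Nat)} ?\<phi>"
      by (simp add: zero_upto_fm_def first_fm_def)
    have z0: "\<^bold>0 \<in> elems w Nat"
      by simp
    have "(a \<cdot> \<^bold>0 \<^bold>= \<^bold>0) \<in> facts w \<or> (a \<cdot> \<^bold>0 \<^bold>= nsuc \<^bold>0) \<in> facts w"
      using bin future_refl[OF w] z0 unfolding binary_def by blast
    then show "frc True w (Var((''n'', Nat) := \<^bold>0)) ?\<phi>"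
      unfolding iff
    proof
      assume a0: "(a \<cdot> \<^bold>0 \<^bold>= \<^bold>0) \<in> facts w"
      have "(a \<cdot> j \<^bold>= \<^bold>0) \<in> facts w'" if "w \<sqsubseteq> w'" "j \<in> elems w' Nat" "le w' j \<^bold>0" for w' j
        using eq_trans[OF future_world[OF that(1)] app_cong[OF future_world[OF that(1)] elems_mono[OF a that(1)] that(2)
            le_zero[OF future_world[OF that(1)] that(3,2)]] fact_mono[OF a0 that(1)]] .
      then show "zero_upto w a \<^bold>0 \<or> (\<exists>m\<in>elems w Nat. le w m \<^bold>0 \<and> first w a m)"
        by (simp add: zero_upto_def)
    next
      assume "(a \<cdot> \<^bold>0 \<^bold>= nsuc \<^bold>0) \<in> facts w"
      then have "first w a \<^bold>0"
        unfolding first_def using le_zero[OF future_world] by blast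
      then show "zero_upto w a \<^bold>0 \<or> (\<exists>m\<in>elems w Nat. le w m \<^bold>0 \<and> first w a m)"
        using le_refl[OF w z0] z0 by blast
    qed
    fix w' n assume w': "w \<sqsubseteq> w'" and n: "n \<in> elems w' Nat" and IH: "frc True w' (Var((''n'', Nat) := n)) ?\<phi>"
    note W = future_world[OF w'] and a' = elems_mono[OF a w']
    have n': "nsuc n \<in> elems w' Nat"
      using n by simp
    show "frc True w' (Var((''n'', Nat) := nsuc n)) ?\<phi>"
      unfolding iff using IH[unfolded iff]
    proof (elim disjE bexE conjE)
      fix m assume "m \<in> elems w' Nat" "le w' m n" "first w' a m"
      then show "zero_upto w' a (nsuc n) \<or> (\<exists>m\<in>elems w' Nat. le w' m (nsuc n) \<and> first w' a m)"
        using le_trans[OF W _ le_suc[OF W n]] by blast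
    next
      assume z: "zero_upto w' a n"
      have cases: "(a \<cdot> j \<^bold>= \<^bold>0) \<in> facts w'' \<or> (j \<^bold>= nsuc n) \<in> facts w''"
        if "w' \<sqsubseteq> w''" "j \<in> elems w'' Nat" "le w'' j (nsuc n)" for w'' j
        using le_suc_cases[OF future_world[OF that(1)] that(3,2) elems_mono[OF n that(1)]] z that
        unfolding zero_upto_def by blast
      have "(a \<cdot> nsuc n \<^bold>= \<^bold>0) \<in> facts w' \<or> (a \<cdot> nsuc n \<^bold>= nsuc \<^bold>0) \<in> facts w'"
        using bin w' n' unfolding binary_def by blast
      then show "zero_upto w' a (nsuc n) \<or> (\<exists>m\<in>elems w' Nat. le w' m (nsuc n) \<and> first w' a m)"
      proof
        assume a0: "(a \<cdot> nsuc n \<^bold>= \<^bold>0) \<in> facts w'"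
        have "(a \<cdot> j \<^bold>= \<^bold>0) \<in> facts w''" if "w' \<sqsubseteq> w''" "j \<in> elems w'' Nat" "le w'' j (nsuc n)" for w'' j
          using cases[OF that]
        proof
          assume "(j \<^bold>= nsuc n) \<in> facts w''"
          then have "(a \<cdot> j \<^bold>= a \<cdot> nsuc n) \<in> facts w''"
            by (rule app_cong[OF future_world[OF that(1)] elems_mono[OF a' that(1)] that(2)])
          then show ?thesis
            by (rule eq_trans[OF future_world[OF that(1)] _ fact_mono[OF a0 that(1)]])
        qed
        then show ?thesis
          by (simp add: zero_upto_def)
      next
        assume "(a \<cdot> nsuc n \<^bold>= nsuc \<^bold>0) \<in> facts w'"
        then have "first w' a (nsuc n)"
          unfolding first_def using cases by blast
        then show ?thesis
          using le_refl[OF W n'] n' by blast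
      qed
    qed
  qed
  then show thesis
    unfolding iff using that by blast
qed

lemma first_exists:
  assumes w: "world w" and a: "a \<in> elems w (Nat \<rightarrow> Nat)" and bin: "binary w a" and n: "n \<in> elems w Nat"
    and an: "(a \<cdot> n \<^bold>= nsuc \<^bold>0) \<in> facts w"
  obtains m where "m \<in> elems w Nat" "le w m n" "first w a m"
  using zero_uptoD[OF _ w n le_refl[OF w n] an] that by (blast intro: bounded_search[OF w a bin n])

lemma tsub_dom:
  "\<lbrakk>sort_of t = Some \<tau>; \<forall>v\<in>fvt t. e v \<in> elems w (snd v)\<rbrakk> \<Longrightarrow> tsub e t \<in> elems w \<tau>"
  by (auto simp: elems_def sort_of_tsub fvt_tsub)

text \<open>Terms have no lambda abstraction; countable choice applied to the graph of
  \<open>t\<close> supplies the function.\<close>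

lemma abstraction:
  assumes w: "world w" and t: "sort_of t = Some \<tau>" "tm w {(''n'', Nat)} t"
  obtains f where "f \<in> elems w (Nat \<rightarrow> \<tau>)"
    "\<And>w' n. \<lbrakk>w \<sqsubseteq> w'; n \<in> elems w' Nat\<rbrakk> \<Longrightarrow> (f \<cdot> n \<^bold>= tsub (Var((''n'', Nat) := n)) t) \<in> facts w'"
proof -
  let ?e = "\<lambda>n. Var((''n'', Nat) := n)"
  let ?\<phi> = "Var (''v'', \<tau>) \<^bold>= t"
  have tm: "tm w {(''n'', Nat), (''v'', \<tau>)} t"
    using t(2) by (auto simp: tm_def)
  have v: "(''v'', \<tau>) \<notin> fvt t"
    using t(2) by (auto simp: tm_def)
  obtain f where f: "f \<in> elems w (Nat \<rightarrow> \<tau>)"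
    "\<And>w' n. \<lbrakk>w \<sqsubseteq> w'; n \<in> elems w' Nat\<rbrakk> \<Longrightarrow> frc True w' (Var((''n'', Nat) := n, (''v'', \<tau>) := f \<cdot> n)) ?\<phi>"
  proof (rule countable_choice[OF w, of "''n''" "''v''" \<tau> ?\<phi>])
    show "formula w {(''n'', Nat), (''v'', \<tau>)} ?\<phi>"
      using t tm by simp
    fix w' n assume *: "w \<sqsubseteq> w'" "n \<in> elems w' Nat"
    have "?e n v \<in> elems w' (snd v)" if "v \<in> fvt t" for v
      using t(2) that * by (cases "v = (''n'', Nat)") (force simp: tm_def elems_def future_def)+
    then have "tsub (?e n) t \<in> elems w' \<tau>"
      using t(1) by (intro tsub_dom) auto
    then show "\<exists>v\<in>elems w' \<tau>. frc True w' (Var((''n'', Nat) := n, (''v'', \<tau>) := v)) ?\<phi>"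
      using eq_refl[OF future_world[OF *(1)]] v by (intro bexI) (simp_all add: tsub_upd_fresh)
  qed auto
  show thesis
    by (rule that[OF f(1)]) (use f(2) v in \<open>simp add: tsub_upd_fresh\<close>)
qed

section \<open>The main argument in a world\<close>

definition cauchy_seq :: "world \<Rightarrow> trm \<Rightarrow> trm \<Rightarrow> bool" where
  "cauchy_seq w d s \<longleftrightarrow> (\<forall>w'. w \<sqsubseteq> w' \<longrightarrow> (\<forall>e\<in>elems w' Real. (rat 0 \<^bold>< e) \<in> facts w' \<longrightarrow>
     (\<exists>N\<in>elems w' Nat. \<forall>w''. w' \<sqsubseteq> w'' \<longrightarrow> (\<forall>m\<in>elems w'' Nat. \<forall>n\<in>elems w'' Nat.
        le w'' N m \<and> le w'' N n \<longrightarrow> (d \<cdot> (s \<cdot> m) \<cdot> (s \<cdot> n) \<^bold>< e) \<in> facts w''))))"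

text \<open>Completeness and pointwise convergence are assumed at every later world, because the
  sequences and points to which they are applied are built there.\<close>

locale situation =
  fixes X Y :: sort and \<rho>X \<rho>Y F f xs x \<epsilon> :: trm and w0 :: world
  assumes mX0: "mspace w0 X \<rho>X" and mY0: "mspace w0 Y \<rho>Y"
    and F0: "F \<in> elems w0 (Nat \<rightarrow> X \<rightarrow> Y)" and f0: "f \<in> elems w0 (X \<rightarrow> Y)"
    and xs0: "xs \<in> elems w0 (Nat \<rightarrow> X)" and x0: "x \<in> elems w0 X"
    and complete: "\<And>w s. \<lbrakk>w0 \<sqsubseteq> w; s \<in> elems w (Nat \<rightarrow> X); cauchy_seq w \<rho>X s\<rbrakk>
       \<Longrightarrow> \<exists>l\<in>elems w X. conv w \<rho>X (\<lambda>n. s \<cdot> n) l"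
    and pointwise: "\<And>w z. \<lbrakk>w0 \<sqsubseteq> w; z \<in> elems w X\<rbrakk> \<Longrightarrow> conv w \<rho>Y (\<lambda>i. F \<cdot> i \<cdot> z) (f \<cdot> z)"
    and xs_conv0: "conv w0 \<rho>X (\<lambda>n. xs \<cdot> n) x"
    and eps0: "(rat 0 \<^bold>< \<epsilon>) \<in> facts w0"
begin

abbreviation g :: "trm \<Rightarrow> trm \<Rightarrow> trm" where
  "g i z \<equiv> \<rho>Y \<cdot> (F \<cdot> i \<cdot> z) \<cdot> (f \<cdot> z)"

lemma rhoX_dom0: "\<rho>X \<in> elems w0 (X \<rightarrow> X \<rightarrow> Real)" and rhoY_dom0: "\<rho>Y \<in> elems w0 (Y \<rightarrow> Y \<rightarrow> Real)"
  using mX0 mY0 by (simp_all add: mspace_def)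

context
  fixes w
  assumes w: "w0 \<sqsubseteq> w"
begin

lemmas W = future_world[OF w]

lemmas mX = mspace_mono[OF mX0 w] and mY = mspace_mono[OF mY0 w]
  and F_dom = elems_mono[OF F0 w] and f_dom = elems_mono[OF f0 w]
  and xs_dom = elems_mono[OF xs0 w] and x_dom = elems_mono[OF x0 w]
  and rhoX_dom = elems_mono[OF rhoX_dom0 w] and rhoY_dom = elems_mono[OF rhoY_dom0 w]
  and xs_conv = conv_mono[OF xs_conv0 w] and eps = fact_mono[OF eps0 w]

lemma Fz_dom: "\<lbrakk>i \<in> elems w Nat; z \<in> elems w X\<rbrakk> \<Longrightarrow> F \<cdot> i \<cdot> z \<in> elems w Y"
  by (rule elems_App[OF elems_App[OF F_dom]])

lemma fz_dom: "z \<in> elems w X \<Longrightarrow> f \<cdot> z \<in> elems w Y"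
  by (rule elems_App[OF f_dom])

lemma xsn_dom: "n \<in> elems w Nat \<Longrightarrow> xs \<cdot> n \<in> elems w X"
  by (rule elems_App[OF xs_dom])

lemma g_dom: "\<lbrakk>i \<in> elems w Nat; z \<in> elems w X\<rbrakk> \<Longrightarrow> g i z \<in> elems w Real"
  by (rule dist_dom[OF mY Fz_dom fz_dom])

lemma g_cong:
  assumes "i \<in> elems w Nat" "z \<in> elems w X" "(i \<^bold>= i') \<in> facts w" "(z \<^bold>= z') \<in> facts w"
  shows "(g i z \<^bold>= g i' z') \<in> facts w"
proof (rule dist_cong[OF mY Fz_dom[OF assms(1,2)] fz_dom[OF assms(2)]])
  show "(F \<cdot> i \<cdot> z \<^bold>= F \<cdot> i' \<cdot> z') \<in> facts w"
    by (rule eq_App[OF W app_cong[OF W F_dom assms(1,3)] assms(4) Fz_dom[OF assms(1,2)]])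
  show "(f \<cdot> z \<^bold>= f \<cdot> z') \<in> facts w"
    by (rule app_cong[OF W f_dom assms(2,4)])
qed

lemma g_cong_point: "\<lbrakk>i \<in> elems w Nat; z \<in> elems w X; (z \<^bold>= z') \<in> facts w\<rbrakk> \<Longrightarrow> (g i z \<^bold>= g i z') \<in> facts w"
  using g_cong[OF _ _ eq_refl[OF W]] by blast

end

lemma g_conv:
  assumes "w0 \<sqsubseteq> w" "z \<in> elems w X" "w \<sqsubseteq> w'" "(rat 0 \<^bold>< e) \<in> facts w'"
  obtains N where "N \<in> elems w' Nat"
    "\<And>w'' i. \<lbrakk>w' \<sqsubseteq> w''; i \<in> elems w'' Nat; le w'' N i\<rbrakk> \<Longrightarrow> (g i z \<^bold>< e) \<in> facts w''"
  using convE[OF pointwise[OF assms(1,2)] assms(3,4)] by metis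

text \<open>The point \<open>y\<close> is a limit, so it exists although it is not known whether \<open>a\<close> takes the value 1.\<close>

lemma switch_point:
  assumes w: "w0 \<sqsubseteq> w" and a: "a \<in> elems w (Nat \<rightarrow> Nat)" and bin: "binary w a"
    and z: "z \<in> elems w (Nat \<rightarrow> X)" and z_conv: "conv w \<rho>X (\<lambda>n. z \<cdot> n) x"
  obtains y where "y \<in> elems w X"
    "\<And>w'. \<lbrakk>w \<sqsubseteq> w'; \<And>w'' n. \<lbrakk>w' \<sqsubseteq> w''; n \<in> elems w'' Nat\<rbrakk> \<Longrightarrow> (a \<cdot> n \<^bold>= \<^bold>0) \<in> facts w''\<rbrakk>
       \<Longrightarrow> (y \<^bold>= x) \<in> facts w'"
    "\<And>w' n. \<lbrakk>w \<sqsubseteq> w'; n \<in> elems w' Nat; first w' a n\<rbrakk> \<Longrightarrow> (y \<^bold>= z \<cdot> n) \<in> facts w'"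
proof -
  note xw = x_dom[OF w]
  note [simp] = elems_facts[OF a] elems_facts[OF z] elems_facts[OF xw]
  \<comment> \<open>The graph of the approximating sequence: \<open>x\<close> as long as no 1 has
    been seen, and constantly \<open>z \<cdot> m\<close> once the first 1 has occurred at
    \<open>m\<close>.\<close>
  let ?\<phi> = "zero_upto_fm a (Var (''n'', Nat)) \<^bold>\<and> Var (''v'', X) \<^bold>= x
    \<^bold>\<or> EXISTS ''m'' Nat (\<lambda>m. m \<^bold>\<preceq> Var (''n'', Nat) \<^bold>\<and> first_fm a m \<^bold>\<and> Var (''v'', X) \<^bold>= z \<cdot> m)"
  define S where "S w n v \<longleftrightarrow> zero_upto w a n \<and> (v \<^bold>= x) \<in> facts w
    \<or> (\<exists>m\<in>elems w Nat. le w m n \<and> first w a m \<and> (v \<^bold>= z \<cdot> m) \<in> facts w)" for w n v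
  have S: "frc True w (Var((''n'', Nat) := n, (''v'', X) := v)) ?\<phi> \<longleftrightarrow> S w n v" for w n v
    by (simp add: S_def frc_zero_upto frc_first frc_nle)
  have zd: "z \<cdot> n \<in> elems w' X" if "w \<sqsubseteq> w'" "n \<in> elems w' Nat" for w' n
    using elems_App[OF elems_mono[OF z that(1)] that(2)] .
  have ex: "\<exists>v\<in>elems w' X. S w' n v" if w': "w \<sqsubseteq> w'" and n: "n \<in> elems w' Nat" for w' n
  proof (cases rule: bounded_search[OF future_world[OF w'] elems_mono[OF a w'] binary_mono[OF bin w'] n])
    case 1
    then show ?thesis
      using elems_mono[OF xw w'] eq_refl[OF future_world[OF w']] unfolding S_def by blast
  next
    case (2 m)
    then show ?thesis
      using zd[OF w' 2(1)] eq_refl[OF future_world[OF w']] unfolding S_def by blast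
  qed
  obtain s where s: "s \<in> elems w (Nat \<rightarrow> X)"
    and sS: "\<And>w' n. \<lbrakk>w \<sqsubseteq> w'; n \<in> elems w' Nat\<rbrakk> \<Longrightarrow> S w' n (s \<cdot> n)"
  proof (rule countable_choice[OF W[OF w], of "''n''" "''v''" X ?\<phi>])
    show "formula w {(''n'', Nat), (''v'', X)} ?\<phi>"
      by (simp add: zero_upto_fm_def first_fm_def)
  qed (use ex S in auto)
  have sd: "s \<cdot> n \<in> elems w' X" if "w \<sqsubseteq> w'" "n \<in> elems w' Nat" for w' n
    using elems_App[OF elems_mono[OF s that(1)] that(2)] .
  have s_first: "(s \<cdot> n \<^bold>= z \<cdot> m) \<in> facts w'"
    if w': "w \<sqsubseteq> w'" and m: "m \<in> elems w' Nat" "first w' a m" and n: "n \<in> elems w' Nat" "le w' m n" for w' m n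
    using sS[OF w' n(1)] unfolding S_def
  proof (elim disjE conjE bexE)
    assume "zero_upto w' a n"
    then have False
      using m n future_world[OF w'] by (intro zero_uptoD[of w' a n m]) (auto simp: first_def)
    then show ?thesis ..
  next
    fix m' assume m': "m' \<in> elems w' Nat" "first w' a m'" "(s \<cdot> n \<^bold>= z \<cdot> m') \<in> facts w'"
    note W' = future_world[OF w']
    show ?thesis
      by (rule eq_trans[OF W' m'(3) app_cong[OF W' elems_mono[OF z w'] m'(1) first_unique[OF W' m'(2) m(2) m'(1) m(1)]]])
  qed
  \<comment> \<open>If \<open>a\<close> vanishes up to \<open>N\<close>, any switch happens at some
    \<open>m\<close> beyond \<open>N\<close>, where \<open>z \<cdot> m\<close> is already close to
    \<open>x\<close>.\<close>
  have s_near: "(\<rho>X \<cdot> (s \<cdot> n) \<cdot> x \<^bold>< e) \<in> facts w'"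
    if w': "w \<sqsubseteq> w'" and n: "n \<in> elems w' Nat" and e: "(rat 0 \<^bold>< e) \<in> facts w'" and N: "N \<in> elems w' Nat"
      and near: "\<And>m. \<lbrakk>m \<in> elems w' Nat; le w' N m\<rbrakk> \<Longrightarrow> (\<rho>X \<cdot> (z \<cdot> m) \<cdot> x \<^bold>< e) \<in> facts w'"
      and zero: "zero_upto w' a N" for w' n e N
    using sS[OF w' n] unfolding S_def
  proof (elim disjE conjE bexE)
    note M = mX[OF future_trans[OF w w']]
    show ?thesis if "(s \<cdot> n \<^bold>= x) \<in> facts w'"
      using dist_eq_less[OF M that sd[OF w' n] e] .
    fix m assume m: "m \<in> elems w' Nat" "first w' a m" "(s \<cdot> n \<^bold>= z \<cdot> m) \<in> facts w'"
    note W' = future_world[OF w']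
    have "\<not> le w' m N"
      using zero_uptoD[OF zero W' m(1)] m(2) by (auto simp: first_def)
    then have "le w' N m"
      using le_total[OF W' m(1) N] by blast
    from near[OF m(1) this] show ?thesis
      by (rule dist_less_cong[OF M _ zd[OF w' m(1)] elems_mono[OF xw w'] eq_sym[OF W' m(3)] eq_refl[OF W' elems_mono[OF xw w']]])
  qed
  have "cauchy_seq w \<rho>X s"
    unfolding cauchy_seq_def
  proof (intro HOL.allI HOL.impI ballI)
    fix w' e assume w': "w \<sqsubseteq> w'" and ed: "e \<in> elems w' Real" and e: "(rat 0 \<^bold>< e) \<in> facts w'"
    note W' = future_world[OF w']
    let ?h = "rat (1/2) \<^bold>* e"
    have h: "(rat 0 \<^bold>< ?h) \<in> facts w'"
      by (rule rat_mul_pos[OF W' _ e]) simp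
    obtain N where N: "N \<in> elems w' Nat"
      "\<And>w'' n. \<lbrakk>w' \<sqsubseteq> w''; n \<in> elems w'' Nat; le w'' N n\<rbrakk> \<Longrightarrow> (\<rho>X \<cdot> (z \<cdot> n) \<cdot> x \<^bold>< ?h) \<in> facts w''"
      using convE[OF z_conv w' h] by metis
    \<comment> \<open>A search up to the modulus \<open>N\<close> separates two cases: without a 1,
      both terms are within e/2 of \<open>x\<close>; after a 1, both equal the same value of
      \<open>z\<close>.\<close>
    have "(\<rho>X \<cdot> (s \<cdot> m) \<cdot> (s \<cdot> n) \<^bold>< e) \<in> facts w''"
      if w'': "w' \<sqsubseteq> w''" and m: "m \<in> elems w'' Nat" "le w'' N m" and n: "n \<in> elems w'' Nat" "le w'' N n" for w'' m n
    proof (cases rule: bounded_search[OF W' elems_mono[OF a w'] binary_mono[OF bin w'] N(1)])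
      note ww = future_trans[OF w' w''] and W'' = future_world[OF w'']
      note M = mX[OF future_trans[OF w ww]] and xw'' = elems_mono[OF xw ww]
      case 1
      have near: "(\<rho>X \<cdot> (s \<cdot> k) \<cdot> x \<^bold>< ?h) \<in> facts w''" if "k \<in> elems w'' Nat" for k
        using s_near[OF ww that fact_mono[OF h w''] elems_mono[OF N(1) w''] N(2)[OF w''] zero_upto_mono[OF 1 w'']] .
      have "(\<rho>X \<cdot> (s \<cdot> m) \<cdot> (s \<cdot> n) \<^bold>< ?h \<^bold>+ ?h) \<in> facts w''"
        by (rule dist_triangle_less[OF M near[OF m(1)] dist_less_sym[OF M near[OF n(1)] sd[OF ww n(1)] xw'']
            sd[OF ww m(1)] xw'' sd[OF ww n(1)]])
      then show ?thesis
        by (rule less_eq_trans[OF W'' _ half_add_half[OF W'' elems_mono[OF ed w'']]])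
    next
      note ww = future_trans[OF w' w''] and W'' = future_world[OF w'']
      case (2 k)
      note k = elems_mono[OF 2(1) w''] le_mono[OF 2(2) w''] first_mono[OF 2(3) w'']
      have "(s \<cdot> m \<^bold>= z \<cdot> k) \<in> facts w''" "(s \<cdot> n \<^bold>= z \<cdot> k) \<in> facts w''"
        using s_first[OF ww k(1,3)] le_trans[OF W'' k(2) _ k(1)] m n by blast+
      then have "(s \<cdot> m \<^bold>= s \<cdot> n) \<in> facts w''"
        by (rule eq_trans[OF W'' _ eq_sym[OF W'']])
      then show ?thesis
        by (rule dist_eq_less[OF mX[OF future_trans[OF w ww]] _ sd[OF ww m(1)] fact_mono[OF e w'']])
    qed
    then show "\<exists>N\<in>elems w' Nat. \<forall>w''. w' \<sqsubseteq> w'' \<longrightarrow> (\<forall>m\<in>elems w'' Nat. \<forall>n\<in>elems w'' Nat.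
        le w'' N m \<and> le w'' N n \<longrightarrow> (\<rho>X \<cdot> (s \<cdot> m) \<cdot> (s \<cdot> n) \<^bold>< e) \<in> facts w'')"
      using N(1) by blast
  qed
  then obtain y where y: "y \<in> elems w X" and y_lim: "conv w \<rho>X (\<lambda>n. s \<cdot> n) y"
    using complete[OF w s] by blast
  show thesis
  proof
    show "y \<in> elems w X"
      by (rule y)
    show "(y \<^bold>= x) \<in> facts w'"
      if w': "w \<sqsubseteq> w'" and zero: "\<And>w'' n. \<lbrakk>w' \<sqsubseteq> w''; n \<in> elems w'' Nat\<rbrakk> \<Longrightarrow> (a \<cdot> n \<^bold>= \<^bold>0) \<in> facts w''" for w'
    proof (rule limit_eventually_const[OF mX[OF future_trans[OF w w']] conv_mono[OF y_lim w']
          elems_mono[OF y w'] elems_mono[OF xw w'] sd, of "\<^bold>0"])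
      fix w'' n assume w'': "w' \<sqsubseteq> w''" and n: "n \<in> elems w'' Nat"
      note ww = future_trans[OF w' w'']
      have "\<not> first w'' a m" if "m \<in> elems w'' Nat" for m
        using zero[OF w'' that] zero_neq_one[OF future_world[OF w'']] unfolding first_def by blast
      then show "(s \<cdot> n \<^bold>= x) \<in> facts w''"
        using sS[OF ww n] unfolding S_def by blast
    qed (use w' future_trans in auto)
    show "(y \<^bold>= z \<cdot> n) \<in> facts w'" if w': "w \<sqsubseteq> w'" and n: "n \<in> elems w' Nat" "first w' a n" for w' n
    proof (rule limit_eventually_const[OF mX[OF future_trans[OF w w']] conv_mono[OF y_lim w']
          elems_mono[OF y w'] zd[OF w' n(1)] sd n(1)])
      fix w'' k assume w'': "w' \<sqsubseteq> w''" and k: "k \<in> elems w'' Nat" "le w'' n k"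
      show "(s \<cdot> k \<^bold>= z \<cdot> n) \<in> facts w''"
        by (rule s_first[OF future_trans[OF w' w''] elems_mono[OF n(1) w''] first_mono[OF n(2) w''] k])
    qed (use w' future_trans in auto)
  qed
qed

text \<open>Pointwise convergence at \<open>z\<close> bounds \<open>g i z\<close> by
  \<open>\<beta>\<close> for all \<open>i\<close> from some \<open>N\<close> on. The indices
  \<open>k + p\<close> with \<open>p\<close> up to \<open>N\<close> remain, and for these
  cotransitivity is applied one by one in an induction.\<close>

lemma decide_row:
  assumes w: "w0 \<sqsubseteq> w" and z: "z \<in> elems w X" and k: "k \<in> elems w Nat"
    and \<alpha>\<beta>: "(\<alpha> \<^bold>< \<beta>) \<in> facts w" and \<beta>: "(rat 0 \<^bold>< \<beta>) \<in> facts w"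
  obtains i where "i \<in> elems w Nat" "le w k i" "(\<alpha> \<^bold>< g i z) \<in> facts w"
  | "\<And>w' i. \<lbrakk>w \<sqsubseteq> w'; i \<in> elems w' Nat; le w' k i\<rbrakk> \<Longrightarrow> (g i z \<^bold>< \<beta>) \<in> facts w'"
proof -
  note W = W[OF w]
  note d = fact_Less_dom[OF W \<alpha>\<beta>]
  note [simp] = elems_facts[OF z] elems_facts[OF k] elems_facts[OF d(1)] elems_facts[OF d(2)]
    elems_facts[OF F_dom[OF w]] elems_facts[OF f_dom[OF w]] elems_facts[OF rhoY_dom[OF w]]
  let ?\<phi> = "EXISTS ''i'' Nat (\<lambda>i. k \<^bold>\<preceq> i \<^bold>\<and> \<alpha> \<^bold>< g i z)
    \<^bold>\<or> FORALL ''p'' Nat (\<lambda>p. p \<^bold>\<preceq> Var (''n'', Nat) \<^bold>\<longrightarrow> g (nadd k p) z \<^bold>< \<beta>)"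
  define far where "far w \<longleftrightarrow> (\<exists>i\<in>elems w Nat. le w k i \<and> (\<alpha> \<^bold>< g i z) \<in> facts w)" for w
  define near where "near w n \<longleftrightarrow> (\<forall>w'. w \<sqsubseteq> w' \<longrightarrow> (\<forall>p\<in>elems w' Nat.
    le w' p n \<longrightarrow> (g (nadd k p) z \<^bold>< \<beta>) \<in> facts w'))" for w n
  have iff: "frc True w (Var((''n'', Nat) := n)) ?\<phi> \<longleftrightarrow> far w \<or> near w n" for w n
    by (simp add: far_def near_def frc_nle up_True)
  obtain N where N: "N \<in> elems w Nat"
    "\<And>w' i. \<lbrakk>w \<sqsubseteq> w'; i \<in> elems w' Nat; le w' N i\<rbrakk> \<Longrightarrow> (g i z \<^bold>< \<beta>) \<in> facts w'"
    using g_conv[OF w z future_refl[OF W] \<beta>] by metis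
  have split: "far w' \<or> (g (nadd k n) z \<^bold>< \<beta>) \<in> facts w'" if w': "w \<sqsubseteq> w'" and n: "n \<in> elems w' Nat" for w' n
  proof -
    note W' = future_world[OF w'] and k' = elems_mono[OF k w']
    have kn: "nadd k n \<in> elems w' Nat"
      using k' n by simp
    show ?thesis
      using less_cotrans[OF W' fact_mono[OF \<alpha>\<beta> w'] g_dom[OF future_trans[OF w w'] kn elems_mono[OF z w']]]
        le_add[OF W' k' n] kn unfolding far_def by blast
  qed
  have near_cong: "(g (nadd k p) z \<^bold>< \<beta>) \<in> facts w'"
    if w': "w \<sqsubseteq> w'" and p: "p \<in> elems w' Nat" and pn: "(p \<^bold>= n) \<in> facts w'" and n: "(g (nadd k n) z \<^bold>< \<beta>) \<in> facts w'" for w' p n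
  proof -
    note W' = future_world[OF w'] and k' = elems_mono[OF k w'] and ww = future_trans[OF w w']
    have kp: "nadd k p \<in> elems w' Nat"
      using k' p by simp
    show ?thesis
      by (rule eq_less_trans[OF W' g_cong[OF ww kp elems_mono[OF z w'] eq_nadd[OF W' eq_refl[OF W' k'] pn k' p]
            eq_refl[OF W' elems_mono[OF z w']]] n])
  qed
  have "frc True w (Var((''n'', Nat) := N)) ?\<phi>"
  proof (rule nat_induction[OF W _ _ _ future_refl[OF W] N(1)])
    show "formula w {(''n'', Nat)} ?\<phi>"
      by simp
    have z0: "\<^bold>0 \<in> elems w Nat"
      by simp
    have "near w \<^bold>0" if "(g (nadd k \<^bold>0) z \<^bold>< \<beta>) \<in> facts w"
      unfolding near_def using near_cong le_zero[OF future_world] fact_mono[OF that] by blast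
    then show "frc True w (Var((''n'', Nat) := \<^bold>0)) ?\<phi>"
      unfolding iff using split[OF future_refl[OF W] z0] by blast
    fix w' n assume w': "w \<sqsubseteq> w'" and n: "n \<in> elems w' Nat" and IH: "frc True w' (Var((''n'', Nat) := n)) ?\<phi>"
    have n': "nsuc n \<in> elems w' Nat"
      using n by simp
    have "near w' (nsuc n)" if nn: "near w' n" and g: "(g (nadd k (nsuc n)) z \<^bold>< \<beta>) \<in> facts w'"
      unfolding near_def
    proof (intro HOL.allI HOL.impI ballI)
      fix w'' p assume w'': "w' \<sqsubseteq> w''" and p: "p \<in> elems w'' Nat" "le w'' p (nsuc n)"
      show "(g (nadd k p) z \<^bold>< \<beta>) \<in> facts w''"
        using le_suc_cases[OF future_world[OF w''] p(2,1) elems_mono[OF n w'']]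
      proof
        show ?thesis if "le w'' p n"
          using nn w'' p(1) that unfolding near_def by blast
        show ?thesis if "(p \<^bold>= nsuc n) \<in> facts w''"
          by (rule near_cong[OF future_trans[OF w' w''] p(1) that fact_mono[OF g w'']])
      qed
    qed
    then show "frc True w' (Var((''n'', Nat) := nsuc n)) ?\<phi>"
      using IH split[OF w' n'] unfolding iff by blast
  qed
  then show thesis
    unfolding iff
  proof
    assume "far w"
    then show thesis
      using that(1) unfolding far_def by blast
  next
    assume nr: "near w N"
    have "(g i z \<^bold>< \<beta>) \<in> facts w'" if w': "w \<sqsubseteq> w'" and i: "i \<in> elems w' Nat" "le w' k i" for w' i
    proof -
      note W' = future_world[OF w'] and k' = elems_mono[OF k w'] and N' = elems_mono[OF N(1) w']
      obtain p where p: "p \<in> elems w' Nat" "(nadd k p \<^bold>= i) \<in> facts w'"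
        using i(2) unfolding le_def by blast
      show ?thesis
        using le_total[OF W' p(1) N']
      proof
        assume "le w' p N"
        then have "(g (nadd k p) z \<^bold>< \<beta>) \<in> facts w'"
          using nr w' p(1) unfolding near_def by blast
        then show ?thesis
          using eq_less_trans[OF W' g_cong[OF future_trans[OF w w'] i(1) elems_mono[OF z w'] eq_sym[OF W' p(2)]
                eq_refl[OF W' elems_mono[OF z w']]]] by blast
      next
        assume "le w' N p"
        then have "le w' N (nadd k p)"
          by (rule le_trans[OF W' _ add_le[OF W' k' p(1)] N'])
        then have "le w' N i"
          by (rule le_cong[OF W' _ eq_refl[OF W' N'] p(2) N'])
        then show ?thesis
          by (rule N(2)[OF w' i(1)])
      qed
    qed
    then show thesis
      by (rule that(2))
  qed
qed

abbreviation quarter :: trm where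
  "quarter \<equiv> rat (1/4) \<^bold>* \<epsilon>"

text \<open>If the first \<open>1\<close> of \<open>a\<close> were at an \<open>n\<close> beyond the modulus of pointwise convergence at the switch
  point \<open>y = z\<^sub>n\<close>, then \<open>k\<^sub>n \<ge> n\<close> would contradict that convergence.\<close>

lemma decide_binary:
  assumes w: "w0 \<sqsubseteq> w" and a: "a \<in> elems w (Nat \<rightarrow> Nat)" and bin: "binary w a"
    and z: "z \<in> elems w (Nat \<rightarrow> X)" and z_conv: "conv w \<rho>X (\<lambda>n. z \<cdot> n) x" and k: "k \<in> elems w (Nat \<rightarrow> Nat)"
    and apart: "\<And>w' n. \<lbrakk>w \<sqsubseteq> w'; n \<in> elems w' Nat; first w' a n\<rbrakk>
      \<Longrightarrow> le w' n (k \<cdot> n) \<and> (quarter \<^bold>< g (k \<cdot> n) (z \<cdot> n)) \<in> facts w'"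
  obtains n where "n \<in> elems w Nat" "(a \<cdot> n \<^bold>= nsuc \<^bold>0) \<in> facts w"
  | "\<And>w' n. \<lbrakk>w \<sqsubseteq> w'; n \<in> elems w' Nat\<rbrakk> \<Longrightarrow> (a \<cdot> n \<^bold>= \<^bold>0) \<in> facts w'"
proof -
  obtain y where y: "y \<in> elems w X"
    "\<And>w' n. \<lbrakk>w \<sqsubseteq> w'; n \<in> elems w' Nat; first w' a n\<rbrakk> \<Longrightarrow> (y \<^bold>= z \<cdot> n) \<in> facts w'"
    using switch_point[OF w a bin z z_conv] by metis
  have q: "(rat 0 \<^bold>< quarter) \<in> facts w"
    by (rule rat_mul_pos[OF W[OF w] _ eps[OF w]]) simp
  obtain N where N: "N \<in> elems w Nat"
    "\<And>w' i. \<lbrakk>w \<sqsubseteq> w'; i \<in> elems w' Nat; le w' N i\<rbrakk> \<Longrightarrow> (g i y \<^bold>< quarter) \<in> facts w'"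
    using g_conv[OF w y(1) future_refl[OF W[OF w]] q] by metis
  show thesis
  proof (cases rule: bounded_search[OF W[OF w] a bin N(1)])
    case 1
    have "(a \<cdot> n \<^bold>= \<^bold>0) \<in> facts w'" if w': "w \<sqsubseteq> w'" and n: "n \<in> elems w' Nat" for w' n
    proof (rule ccontr)
      note W' = future_world[OF w'] and a' = elems_mono[OF a w'] and N' = elems_mono[OF N(1) w']
      assume "(a \<cdot> n \<^bold>= \<^bold>0) \<notin> facts w'"
      then have "(a \<cdot> n \<^bold>= nsuc \<^bold>0) \<in> facts w'"
        using bin w' n unfolding binary_def by blast
      then obtain m where m: "m \<in> elems w' Nat" "first w' a m"
        using first_exists[OF W' a' binary_mono[OF bin w'] n] by metis
      have "\<not> le w' m N"
        using zero_uptoD[OF zero_upto_mono[OF 1 w'] W' m(1)] m(2) by (auto simp: first_def)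
      then have "le w' N m"
        using le_total[OF W' m(1) N'] by blast
      then have "le w' N (k \<cdot> m)"
        using apart[OF w' m] le_trans[OF W' _ _ N'] by blast
      moreover have km: "k \<cdot> m \<in> elems w' Nat"
        by (rule elems_App[OF elems_mono[OF k w'] m(1)])
      ultimately have "(g (k \<cdot> m) y \<^bold>< quarter) \<in> facts w'"
        using N(2)[OF w'] by blast
      moreover have "(g (k \<cdot> m) y \<^bold>= g (k \<cdot> m) (z \<cdot> m)) \<in> facts w'"
        by (rule g_cong_point[OF future_trans[OF w w'] km elems_mono[OF y(1) w'] y(2)[OF w' m]])
      ultimately show False
        using apart[OF w' m] less_asym[OF W'] eq_less_trans[OF W' eq_sym[OF W']] by blast
    qed
    then show thesis
      by (rule that(2))
  next
    case (2 m)
    then show thesis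
      using that(1) unfolding first_def by blast
  qed
qed

end

text \<open>The formulas of the main argument contain the parameters of the situation as terms. Such
  an environment changes placeholders only, so these terms evaluate to themselves.\<close>

definition standard :: "(var \<Rightarrow> trm) \<Rightarrow> bool" where
  "standard e \<longleftrightarrow> (\<forall>v. 0 < level v \<longrightarrow> e v = Var v)"

lemma standard_simps [simp]: "standard Var" "\<lbrakk>standard e; level x = 0\<rbrakk> \<Longrightarrow> standard (e(x := a))"
  by (auto simp: standard_def)

lemma tsub_standard:
  assumes "standard e" "closed_trm t"
  shows "tsub e t = t"
proof -
  have "tsub e t = tsub Var t"
    using assms unfolding standard_def closed_trm_def by (intro tsub_cong) blast
  then show ?thesis
    by simp
qed

lemma tm_insert: "tm w V t \<Longrightarrow> tm w (insert v V) t"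
  by (auto simp: tm_def)

section \<open>The decision at a single stage and the dichotomy\<close>

context situation
begin

definition close :: "world \<Rightarrow> trm \<Rightarrow> bool" where
  "close w k \<longleftrightarrow> (\<forall>w'. w \<sqsubseteq> w' \<longrightarrow> (\<forall>m\<in>elems w' Nat. \<forall>i\<in>elems w' Nat. le w' k m \<and> le w' k i
     \<longrightarrow> (\<rho>Y \<cdot> (f \<cdot> (xs \<cdot> m)) \<cdot> (F \<cdot> i \<cdot> (xs \<cdot> m)) \<^bold>< \<epsilon>) \<in> facts w'))"

text \<open>This makes the points chosen at the stages converge to \<open>x\<close>: a bound for the
  tail of \<open>xs\<close> from \<open>k\<close> on carries over to \<open>z\<close>. Being
  negative, it can be proved without deciding whether the switch point is \<open>x\<close>.\<close>

definition near :: "world \<Rightarrow> trm \<Rightarrow> trm \<Rightarrow> bool" where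
  "near w k z \<longleftrightarrow> (\<forall>w'. w \<sqsubseteq> w' \<longrightarrow> (\<forall>e\<in>elems w' Real. (rat 0 \<^bold>< e) \<in> facts w' \<longrightarrow>
     (\<forall>w''. w' \<sqsubseteq> w'' \<longrightarrow> (\<forall>n\<in>elems w'' Nat. le w'' k n \<longrightarrow> (\<rho>X \<cdot> (xs \<cdot> n) \<cdot> x \<^bold>< e) \<in> facts w''))
     \<longrightarrow> (e \<^bold>< \<rho>X \<cdot> z \<cdot> x) \<notin> facts w'))"

definition close_fm :: "trm \<Rightarrow> fm" where
  "close_fm k = FORALL ''b.m'' Nat (\<lambda>m. FORALL ''b.i'' Nat (\<lambda>i. k \<^bold>\<preceq> m \<^bold>\<and> k \<^bold>\<preceq> i
     \<^bold>\<longrightarrow> \<rho>Y \<cdot> (f \<cdot> (xs \<cdot> m)) \<cdot> (F \<cdot> i \<cdot> (xs \<cdot> m)) \<^bold>< \<epsilon>))"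

definition near_fm :: "trm \<Rightarrow> trm \<Rightarrow> fm" where
  "near_fm k z = FORALL ''b.e'' Real (\<lambda>e. rat 0 \<^bold>< e \<^bold>\<longrightarrow>
     FORALL ''b.n'' Nat (\<lambda>n. k \<^bold>\<preceq> n \<^bold>\<longrightarrow> \<rho>X \<cdot> (xs \<cdot> n) \<cdot> x \<^bold>< e) \<^bold>\<longrightarrow> \<^bold>\<not> (e \<^bold>< \<rho>X \<cdot> z \<cdot> x))"

text \<open>\<open>b\<close> records which alternative was established, so that choosing it at every
  stage yields a binary sequence. In the first alternative \<open>z\<close> gets the default
  \<open>x\<close>, which keeps the chosen points convergent.\<close>

definition staged :: "world \<Rightarrow> trm \<Rightarrow> trm \<Rightarrow> trm \<Rightarrow> trm \<Rightarrow> bool" where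
  "staged w n z k b \<longleftrightarrow> (b \<^bold>= nsuc \<^bold>0) \<in> facts w \<and> close w n \<and> (z \<^bold>= x) \<in> facts w
     \<or> (b \<^bold>= \<^bold>0) \<in> facts w \<and> le w n k \<and> (quarter \<^bold>< g k z) \<in> facts w \<and> near w n z"

definition staged_fm :: "trm \<Rightarrow> trm \<Rightarrow> trm \<Rightarrow> trm \<Rightarrow> fm" where
  "staged_fm n z k b = (b \<^bold>= nsuc \<^bold>0 \<^bold>\<and> close_fm n \<^bold>\<and> z \<^bold>= x
     \<^bold>\<or> b \<^bold>= \<^bold>0 \<^bold>\<and> n \<^bold>\<preceq> k \<^bold>\<and> quarter \<^bold>< g k z \<^bold>\<and> near_fm n z)"

lemma eps_dom0: "\<epsilon> \<in> elems w0 Real"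
  using fact_Less_dom(2)[OF mspace_world[OF mX0] eps0] .

lemmas param_simps [simp] =
  rhoX_dom0[THEN elems_sort] rhoX_dom0[THEN elems_closed] rhoY_dom0[THEN elems_sort] rhoY_dom0[THEN elems_closed]
  F0[THEN elems_sort] F0[THEN elems_closed] f0[THEN elems_sort] f0[THEN elems_closed]
  xs0[THEN elems_sort] xs0[THEN elems_closed] x0[THEN elems_sort] x0[THEN elems_closed]
  eps_dom0[THEN elems_sort] eps_dom0[THEN elems_closed]

lemma param_tm [simp]:
  assumes "w0 \<sqsubseteq> w"
  shows "tm w V \<rho>X" "tm w V \<rho>Y" "tm w V F" "tm w V f" "tm w V xs" "tm w V x" "tm w V \<epsilon>"
  using elems_mono[OF _ assms] rhoX_dom0 rhoY_dom0 F0 f0 xs0 x0 eps_dom0 by (blast intro: elems_tm)+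

lemma frc_staged:
  assumes "standard e"
    "\<forall>v\<in>{(''b.m'', Nat), (''b.i'', Nat), (''b.e'', Real), (''b.n'', Nat), (''le.d'', Nat)}.
      v \<notin> fvt n \<union> fvt z \<union> fvt k"
  shows "frc True w e (staged_fm n z k b) \<longleftrightarrow> staged w (tsub e n) (tsub e z) (tsub e k) (tsub e b)"
  using assms
  by (simp add: staged_fm_def staged_def close_fm_def close_def near_fm_def near_def up_True frc_nle
      tsub_upd_fresh tsub_standard)

lemma formula_staged:
  "\<lbrakk>w0 \<sqsubseteq> w; bound_names V; sort_of n = Some Nat; sort_of z = Some X; sort_of k = Some Nat; sort_of b = Some Nat;
    tm w V n; tm w V z; tm w V k; tm w V b\<rbrakk> \<Longrightarrow> formula w V (staged_fm n z k b)"
  by (simp add: staged_fm_def close_fm_def near_fm_def tm_insert)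

lemma half_eps:
  assumes "w0 \<sqsubseteq> w"
  shows "(quarter \<^bold>< rat (1/2) \<^bold>* \<epsilon>) \<in> facts w" "(rat (1/2) \<^bold>* \<epsilon> \<^bold>< \<epsilon>) \<in> facts w"
    "(rat 0 \<^bold>< rat (1/2) \<^bold>* \<epsilon>) \<in> facts w"
  by (rule rat_mul_less[OF W[OF assms] _ eps[OF assms]] rat_mul_less_self[OF W[OF assms] _ eps[OF assms]]
      rat_mul_pos[OF W[OF assms] _ eps[OF assms]]; simp)+

text \<open>The switch point represents all points of \<open>xs\<close> from index \<open>k\<close>
  on: one decision about it replaces infinitely many decisions about them.\<close>

lemma stage:
  assumes w: "w0 \<sqsubseteq> w" and k: "k \<in> elems w Nat"
  obtains "close w k"
  | z i where "z \<in> elems w X" "i \<in> elems w Nat" "le w k i" "(quarter \<^bold>< g i z) \<in> facts w" "near w k z"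
proof -
  note W = W[OF w]
  note [simp] = elems_facts[OF k] param_tm[OF w]
  let ?h = "rat (1/2) \<^bold>* \<epsilon>"
  \<comment> \<open>The two cases overlap when the values lie between \<epsilon>/2 and \<epsilon>,
    so the binary sequence has to be chosen.\<close>
  let ?\<phi> = "Var (''v'', Nat) \<^bold>= nsuc \<^bold>0
      \<^bold>\<and> EXISTS ''i'' Nat (\<lambda>i. k \<^bold>\<preceq> i \<^bold>\<and> ?h \<^bold>< g i (xs \<cdot> nadd k (Var (''n'', Nat))))
    \<^bold>\<or> Var (''v'', Nat) \<^bold>= \<^bold>0
      \<^bold>\<and> FORALL ''i'' Nat (\<lambda>i. k \<^bold>\<preceq> i \<^bold>\<longrightarrow> g i (xs \<cdot> nadd k (Var (''n'', Nat))) \<^bold>< \<epsilon>)"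
  define far where "far w n \<longleftrightarrow> (\<exists>i\<in>elems w Nat. le w k i \<and> (?h \<^bold>< g i (xs \<cdot> nadd k n)) \<in> facts w)" for w n
  define small where "small w n \<longleftrightarrow> (\<forall>w'. w \<sqsubseteq> w' \<longrightarrow> (\<forall>i\<in>elems w' Nat. le w' k i
      \<longrightarrow> (g i (xs \<cdot> nadd k n) \<^bold>< \<epsilon>) \<in> facts w'))" for w n
  have iff: "frc True w (Var((''n'', Nat) := n, (''v'', Nat) := v)) ?\<phi>
      \<longleftrightarrow> (v \<^bold>= nsuc \<^bold>0) \<in> facts w \<and> far w n \<or> (v \<^bold>= \<^bold>0) \<in> facts w \<and> small w n" for w n v
    by (simp add: far_def small_def frc_nle up_True)
  have kn: "nadd k n \<in> elems w' Nat" if "w \<sqsubseteq> w'" "n \<in> elems w' Nat" for w' n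
    using elems_mono[OF k that(1)] that(2) by simp
  have xkn: "xs \<cdot> nadd k n \<in> elems w' X" if "w \<sqsubseteq> w'" "n \<in> elems w' Nat" for w' n
    by (rule xsn_dom[OF future_trans[OF w that(1)] kn[OF that]])
  have ex: "\<exists>v\<in>elems w' Nat. (v \<^bold>= nsuc \<^bold>0) \<in> facts w' \<and> far w' n \<or> (v \<^bold>= \<^bold>0) \<in> facts w' \<and> small w' n"
    if w': "w \<sqsubseteq> w'" and n: "n \<in> elems w' Nat" for w' n
  proof -
    note W' = future_world[OF w'] and ww = future_trans[OF w w']
    have 01: "nsuc \<^bold>0 \<in> elems w' Nat" "\<^bold>0 \<in> elems w' Nat"
      by simp_all
    show ?thesis
    proof (cases rule: decide_row[OF ww xkn[OF w' n] elems_mono[OF k w'] half_eps(2)[OF ww] eps[OF ww]])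
      case (1 i)
      then have "far w' n"
        unfolding far_def by blast
      then show ?thesis
        using 01(1) eq_refl[OF W' 01(1)] by blast
    next
      case 2
      then have "small w' n"
        unfolding small_def by blast
      then show ?thesis
        using 01(2) eq_refl[OF W' 01(2)] by blast
    qed
  qed
  obtain a where a: "a \<in> elems w (Nat \<rightarrow> Nat)"
    and aP: "\<And>w' n. \<lbrakk>w \<sqsubseteq> w'; n \<in> elems w' Nat\<rbrakk>
      \<Longrightarrow> (a \<cdot> n \<^bold>= nsuc \<^bold>0) \<in> facts w' \<and> far w' n \<or> (a \<cdot> n \<^bold>= \<^bold>0) \<in> facts w' \<and> small w' n"
  proof (rule countable_choice[OF W, of "''n''" "''v''" Nat ?\<phi>])
    show "formula w {(''n'', Nat), (''v'', Nat)} ?\<phi>"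
      by simp
  qed (use ex iff in auto)
  have bin: "binary w a"
    using aP unfolding binary_def by blast
  \<comment> \<open>\<open>switch_point\<close> takes its sequence as a single term, so the tail of
    \<open>xs\<close> from \<open>k\<close> on is abstracted to one.\<close>
  obtain z where z: "z \<in> elems w (Nat \<rightarrow> X)"
    and zxs: "\<And>w' n. \<lbrakk>w \<sqsubseteq> w'; n \<in> elems w' Nat\<rbrakk> \<Longrightarrow> (z \<cdot> n \<^bold>= xs \<cdot> nadd k n) \<in> facts w'"
  proof (rule abstraction[OF W, of "xs \<cdot> nadd k (Var (''n'', Nat))" X])
  qed auto
  have zd: "z \<cdot> n \<in> elems w' X" if "w \<sqsubseteq> w'" "n \<in> elems w' Nat" for w' n
    using elems_App[OF elems_mono[OF z that(1)] that(2)] .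
  have "conv w \<rho>X (\<lambda>n. z \<cdot> n) x"
    unfolding conv_def
  proof (intro HOL.allI HOL.impI ballI)
    fix w' e assume w': "w \<sqsubseteq> w'" and e: "(rat 0 \<^bold>< e) \<in> facts w'"
    obtain N where N: "N \<in> elems w' Nat"
      "\<And>w'' n. \<lbrakk>w' \<sqsubseteq> w''; n \<in> elems w'' Nat; le w'' N n\<rbrakk> \<Longrightarrow> (\<rho>X \<cdot> (xs \<cdot> n) \<cdot> x \<^bold>< e) \<in> facts w''"
      using convE[OF xs_conv[OF w] w' e] by metis
    have "(\<rho>X \<cdot> (z \<cdot> n) \<cdot> x \<^bold>< e) \<in> facts w''" if w'': "w' \<sqsubseteq> w''" and n: "n \<in> elems w'' Nat" "le w'' N n" for w'' n
    proof -
      note ww = future_trans[OF w' w''] and W'' = future_world[OF w'']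
      have "le w'' N (nadd k n)"
        by (rule le_trans[OF W'' n(2) add_le[OF W'' elems_mono[OF k ww] n(1)] elems_mono[OF N(1) w'']])
      then have "(\<rho>X \<cdot> (xs \<cdot> nadd k n) \<cdot> x \<^bold>< e) \<in> facts w''"
        by (rule N(2)[OF w'' kn[OF ww n(1)]])
      then show ?thesis
        using dist_less_cong[OF mX _ xkn[OF ww n(1)] x_dom eq_sym[OF W'' zxs[OF ww n(1)]] eq_refl[OF W'' x_dom]]
          future_trans[OF w ww] by blast
    qed
    then show "\<exists>N\<in>elems w' Nat. \<forall>w''. w' \<sqsubseteq> w'' \<longrightarrow> (\<forall>n\<in>elems w'' Nat. le w'' N n
        \<longrightarrow> (\<rho>X \<cdot> (z \<cdot> n) \<cdot> x \<^bold>< e) \<in> facts w'')"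
      using N(1) by blast
  qed
  then obtain y where y: "y \<in> elems w X"
    and y_zero: "\<And>w'. \<lbrakk>w \<sqsubseteq> w'; \<And>w'' n. \<lbrakk>w' \<sqsubseteq> w''; n \<in> elems w'' Nat\<rbrakk> \<Longrightarrow> (a \<cdot> n \<^bold>= \<^bold>0) \<in> facts w''\<rbrakk>
       \<Longrightarrow> (y \<^bold>= x) \<in> facts w'"
    and y_first: "\<And>w' n. \<lbrakk>w \<sqsubseteq> w'; n \<in> elems w' Nat; first w' a n\<rbrakk> \<Longrightarrow> (y \<^bold>= z \<cdot> n) \<in> facts w'"
    using switch_point[OF w a bin z] by metis
  have y_xs: "\<exists>m\<in>elems w' Nat. first w' a m \<and> (y \<^bold>= xs \<cdot> nadd k m) \<in> facts w'"
    if w': "w \<sqsubseteq> w'" and n: "n \<in> elems w' Nat" "(a \<cdot> n \<^bold>= \<^bold>0) \<notin> facts w'" for w' n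
  proof -
    have "(a \<cdot> n \<^bold>= nsuc \<^bold>0) \<in> facts w'"
      using bin w' n unfolding binary_def by blast
    then obtain m where "m \<in> elems w' Nat" "first w' a m"
      using first_exists[OF future_world[OF w'] elems_mono[OF a w'] binary_mono[OF bin w'] n(1)] by metis
    then show ?thesis
      using eq_trans[OF future_world[OF w'] y_first[OF w'] zxs[OF w']] by blast
  qed
  show thesis
  proof (cases rule: decide_row[OF w y k half_eps(1)[OF w] half_eps(3)[OF w]])
    case (1 i)
    \<comment> \<open>A 1 in \<open>a\<close> would make \<open>y\<close> a point of the tail and so
      closer to \<open>x\<close> than \<open>e\<close>. Hence \<open>a\<close> vanishes and
      \<open>y\<close> equals \<open>x\<close>, which is again closer than \<open>e\<close>. As a
      negation is to be shown, it need not be decided whether \<open>a\<close> vanishes.\<close>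
    have "near w k y"
      unfolding near_def
    proof (intro HOL.allI HOL.impI ballI notI)
      fix w' e assume w': "w \<sqsubseteq> w'" and e: "(rat 0 \<^bold>< e) \<in> facts w'"
        and tail: "\<forall>w''. w' \<sqsubseteq> w'' \<longrightarrow> (\<forall>n\<in>elems w'' Nat. le w'' k n \<longrightarrow> (\<rho>X \<cdot> (xs \<cdot> n) \<cdot> x \<^bold>< e) \<in> facts w'')"
        and far: "(e \<^bold>< \<rho>X \<cdot> y \<cdot> x) \<in> facts w'"
      have "(a \<cdot> n \<^bold>= \<^bold>0) \<in> facts w''" if w'': "w' \<sqsubseteq> w''" and n: "n \<in> elems w'' Nat" for w'' n
      proof (rule ccontr)
        note ww = future_trans[OF w' w''] and W'' = future_world[OF w'']
        assume "(a \<cdot> n \<^bold>= \<^bold>0) \<notin> facts w''"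
        then obtain m where m: "m \<in> elems w'' Nat" "(y \<^bold>= xs \<cdot> nadd k m) \<in> facts w''"
          using y_xs[OF ww n] by blast
        note M = mX[OF future_trans[OF w ww]] and xw = x_dom[OF future_trans[OF w ww]]
        have "(\<rho>X \<cdot> (xs \<cdot> nadd k m) \<cdot> x \<^bold>< e) \<in> facts w''"
          using tail w'' kn[OF ww m(1)] le_add[OF W'' elems_mono[OF k ww] m(1)] by blast
        then have "(\<rho>X \<cdot> y \<cdot> x \<^bold>< e) \<in> facts w''"
          by (rule dist_less_cong[OF M _ xkn[OF ww m(1)] xw eq_sym[OF W'' m(2)] eq_refl[OF W'' xw]])
        then show False
          using less_asym[OF W''] fact_mono[OF far w''] by blast
      qed
      then have "(y \<^bold>= x) \<in> facts w'"
        by (rule y_zero[OF w'])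
      then have "(\<rho>X \<cdot> y \<cdot> x \<^bold>< e) \<in> facts w'"
        by (rule dist_eq_less[OF mX[OF future_trans[OF w w']] _ elems_mono[OF y w'] e])
      then show False
        using less_asym[OF future_world[OF w']] far by blast
    qed
    then show thesis
      by (rule that(2)[OF y 1])
  next
    case 2
    have "close w k"
      unfolding close_def
    proof (intro HOL.allI HOL.impI ballI, elim conjE)
      fix w' m i assume w': "w \<sqsubseteq> w'" and m: "m \<in> elems w' Nat" "le w' k m" and i: "i \<in> elems w' Nat" "le w' k i"
      note W' = future_world[OF w'] and ww = future_trans[OF w w']
      obtain p where p: "p \<in> elems w' Nat" "(nadd k p \<^bold>= m) \<in> facts w'"
        using m(2) unfolding le_def by blast
      \<comment> \<open>Otherwise \<open>y\<close> would be a point of \<open>xs\<close> at which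
        some \<open>g j\<close> exceeds \<epsilon>/2, against the bound \<epsilon>/2 that holds at
        \<open>y\<close> in this case.\<close>
      have ap: "(a \<cdot> p \<^bold>= \<^bold>0) \<in> facts w'"
      proof (rule ccontr)
        assume "(a \<cdot> p \<^bold>= \<^bold>0) \<notin> facts w'"
        then obtain q where q: "q \<in> elems w' Nat" "first w' a q" "(y \<^bold>= xs \<cdot> nadd k q) \<in> facts w'"
          using y_xs[OF w' p(1)] by blast
        then have "far w' q"
          using aP[OF w' q(1)] zero_neq_one[OF W'] unfolding first_def by blast
        then obtain j where j: "j \<in> elems w' Nat" "le w' k j" "(?h \<^bold>< g j (xs \<cdot> nadd k q)) \<in> facts w'"
          unfolding far_def by blast
        have "(g j (xs \<cdot> nadd k q) \<^bold>< ?h) \<in> facts w'"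
          by (rule eq_less_trans[OF W' eq_sym[OF W' g_cong_point[OF ww j(1) elems_mono[OF y w'] q(3)]]
                2[OF w' j(1,2)]])
        then show False
          using less_asym[OF W'] j(3) by blast
      qed
      have "small w' p"
        using aP[OF w' p(1)] ap zero_neq_one[OF W'] by blast
      then have "(g i (xs \<cdot> nadd k p) \<^bold>< \<epsilon>) \<in> facts w'"
        using future_refl[OF W'] i unfolding small_def by blast
      moreover have "(xs \<cdot> m \<^bold>= xs \<cdot> nadd k p) \<in> facts w'"
        by (rule app_cong[OF W' xs_dom[OF ww] m(1) eq_sym[OF W' p(2)]])
      ultimately have "(g i (xs \<cdot> m) \<^bold>< \<epsilon>) \<in> facts w'"
        using eq_less_trans[OF W' g_cong_point[OF ww i(1) xsn_dom[OF ww m(1)]]] by blast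
      then show "(\<rho>Y \<cdot> (f \<cdot> (xs \<cdot> m)) \<cdot> (F \<cdot> i \<cdot> (xs \<cdot> m)) \<^bold>< \<epsilon>) \<in> facts w'"
        by (rule dist_less_sym[OF mY[OF ww] _ Fz_dom[OF ww i(1) xsn_dom[OF ww m(1)]] fz_dom[OF ww xsn_dom[OF ww m(1)]]])
    qed
    then show thesis
      by (rule that(1))
  qed
qed

definition apart :: "world \<Rightarrow> bool" where
  "apart w \<longleftrightarrow> (\<exists>z\<in>elems w (Nat \<rightarrow> X). \<exists>k\<in>elems w (Nat \<rightarrow> Nat). conv w \<rho>X (\<lambda>n. z \<cdot> n) x \<and>
     (\<forall>w'. w \<sqsubseteq> w' \<longrightarrow> (\<forall>n\<in>elems w' Nat. le w' n (k \<cdot> n) \<and> (quarter \<^bold>< g (k \<cdot> n) (z \<cdot> n)) \<in> facts w')))"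

lemma apart_LPO:
  assumes "apart w0" "a \<in> elems w0 (Nat \<rightarrow> Nat)" "binary w0 a"
  shows "(\<forall>w. w0 \<sqsubseteq> w \<longrightarrow> (\<forall>n\<in>elems w Nat. (a \<cdot> n \<^bold>= \<^bold>0) \<in> facts w))
    \<or> (\<exists>n\<in>elems w0 Nat. (a \<cdot> n \<^bold>= nsuc \<^bold>0) \<in> facts w0)"
proof -
  obtain z k where z: "z \<in> elems w0 (Nat \<rightarrow> X)" "k \<in> elems w0 (Nat \<rightarrow> Nat)" "conv w0 \<rho>X (\<lambda>n. z \<cdot> n) x"
    "\<And>w n. \<lbrakk>w0 \<sqsubseteq> w; n \<in> elems w Nat\<rbrakk> \<Longrightarrow> le w n (k \<cdot> n) \<and> (quarter \<^bold>< g (k \<cdot> n) (z \<cdot> n)) \<in> facts w"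
    using assms(1) unfolding apart_def by blast
  show ?thesis
    by (rule decide_binary[OF future_refl[OF mspace_world[OF mX0]] assms(2,3) z(1,3,2) z(4)]) auto
qed

lemma dichotomy: "(\<exists>N\<in>elems w0 Nat. close w0 N) \<or> apart w0"
proof -
  have w: "w0 \<sqsubseteq> w0"
    by (rule future_refl[OF mspace_world[OF mX0]])
  note W = W[OF w]
  note [simp] = param_tm[OF w]
  have 01: "nsuc \<^bold>0 \<in> elems w' Nat" "\<^bold>0 \<in> elems w' Nat" for w'
    by simp_all
  have ex: "\<exists>z\<in>elems w' X. \<exists>k\<in>elems w' Nat. \<exists>b\<in>elems w' Nat. staged w' n z k b"
    if w': "w0 \<sqsubseteq> w'" and n: "n \<in> elems w' Nat" for w' n
  proof (cases rule: stage[OF w' n])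
    case 1
    then show ?thesis
      using eq_refl[OF future_world[OF w']] x_dom[OF w'] n 01(1) unfolding staged_def by blast
  next
    case (2 z i)
    then show ?thesis
      using eq_refl[OF future_world[OF w'] 01(2)] 01(2) unfolding staged_def by blast
  qed
  let ?n = "Var (''n'', Nat)"
  \<comment> \<open>There are no product sorts, so point, index and recorded bit are chosen one
    after the other; what is not yet chosen stays existentially quantified.\<close>
  obtain z where z: "z \<in> elems w0 (Nat \<rightarrow> X)"
    and z_stage: "\<And>w n. \<lbrakk>w0 \<sqsubseteq> w; n \<in> elems w Nat\<rbrakk> \<Longrightarrow> \<exists>k\<in>elems w Nat. \<exists>b\<in>elems w Nat. staged w n (z \<cdot> n) k b"
  proof (rule countable_choice[OF W, of "''n''" "''v''" X
        "EXISTS ''k'' Nat (\<lambda>k. EXISTS ''b'' Nat (\<lambda>b. staged_fm ?n (Var (''v'', X)) k b))"])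
  qed (use ex in \<open>simp_all add: frc_staged formula_staged[OF w]\<close>)
  note [simp] = elems_facts[OF z]
  obtain k where k: "k \<in> elems w0 (Nat \<rightarrow> Nat)"
    and k_stage: "\<And>w n. \<lbrakk>w0 \<sqsubseteq> w; n \<in> elems w Nat\<rbrakk> \<Longrightarrow> \<exists>b\<in>elems w Nat. staged w n (z \<cdot> n) (k \<cdot> n) b"
  proof (rule countable_choice[OF W, of "''n''" "''v''" Nat
        "EXISTS ''b'' Nat (\<lambda>b. staged_fm ?n (z \<cdot> ?n) (Var (''v'', Nat)) b)"])
  qed (use z_stage in \<open>simp_all add: frc_staged formula_staged[OF w]\<close>)
  note [simp] = elems_facts[OF k]
  obtain b where b: "b \<in> elems w0 (Nat \<rightarrow> Nat)"
    and b_stage: "\<And>w n. \<lbrakk>w0 \<sqsubseteq> w; n \<in> elems w Nat\<rbrakk> \<Longrightarrow> staged w n (z \<cdot> n) (k \<cdot> n) (b \<cdot> n)"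
  proof (rule countable_choice[OF W, of "''n''" "''v''" Nat
        "staged_fm ?n (z \<cdot> ?n) (k \<cdot> ?n) (Var (''v'', Nat))"])
  qed (use k_stage in \<open>simp_all add: frc_staged formula_staged[OF w]\<close>)
  note [simp] = elems_facts[OF b]
  \<comment> \<open>The shift by one: if \<open>b\<close> is 0 at index 0, a first 1 of
    \<open>a\<close> at \<open>n\<close> means that \<open>b\<close> is still 0 at \<open>n\<close>.
    So the stage data at \<open>n\<close> satisfy what \<open>decide_binary\<close> demands at the
    first 1.\<close>
  obtain a where a: "a \<in> elems w0 (Nat \<rightarrow> Nat)"
    and ab: "\<And>w n. \<lbrakk>w0 \<sqsubseteq> w; n \<in> elems w Nat\<rbrakk> \<Longrightarrow> (a \<cdot> n \<^bold>= b \<cdot> nsuc n) \<in> facts w"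
  proof (rule abstraction[OF W, of "b \<cdot> nsuc ?n" Nat])
  qed auto
  have b_one: "close w n" if "w0 \<sqsubseteq> w" "n \<in> elems w Nat" "(b \<cdot> n \<^bold>= nsuc \<^bold>0) \<in> facts w" for w n
    using b_stage[OF that(1,2)] that(3) zero_neq_one[OF future_world[OF that(1)]] unfolding staged_def by blast
  have b_zero: "le w n (k \<cdot> n) \<and> (quarter \<^bold>< g (k \<cdot> n) (z \<cdot> n)) \<in> facts w"
    if "w0 \<sqsubseteq> w" "n \<in> elems w Nat" "(b \<cdot> n \<^bold>= \<^bold>0) \<in> facts w" for w n
    using b_stage[OF that(1,2)] that(3) zero_neq_one[OF future_world[OF that(1)]] unfolding staged_def by blast
  have b_bin: "(b \<cdot> n \<^bold>= \<^bold>0) \<in> facts w \<or> (b \<cdot> n \<^bold>= nsuc \<^bold>0) \<in> facts w" if "w0 \<sqsubseteq> w" "n \<in> elems w Nat" for w n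
    using b_stage[OF that] unfolding staged_def by blast
  have bin: "binary w0 a"
    unfolding binary_def
  proof (intro HOL.allI HOL.impI ballI)
    fix w n assume "w0 \<sqsubseteq> w" "n \<in> elems w Nat"
    then show "(a \<cdot> n \<^bold>= \<^bold>0) \<in> facts w \<or> (a \<cdot> n \<^bold>= nsuc \<^bold>0) \<in> facts w"
      using b_bin[of w "nsuc n"] ab[of w n] eq_trans[OF future_world] by (meson elems_ops(1))
  qed
  have zd: "z \<cdot> n \<in> elems w X" if "w0 \<sqsubseteq> w" "n \<in> elems w Nat" for w n
    using elems_App[OF elems_mono[OF z that(1)] that(2)] .
  have z_conv: "conv w0 \<rho>X (\<lambda>n. z \<cdot> n) x"
    unfolding conv_def
  proof (intro HOL.allI HOL.impI ballI)
    fix w e assume w: "w0 \<sqsubseteq> w" and e: "(rat 0 \<^bold>< e) \<in> facts w"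
    let ?h = "rat (1/2) \<^bold>* e"
    have h: "(rat 0 \<^bold>< ?h) \<in> facts w" "(?h \<^bold>< e) \<in> facts w"
      by (rule rat_mul_pos[OF future_world[OF w] _ e] rat_mul_less_self[OF future_world[OF w] _ e]; simp)+
    obtain N where N: "N \<in> elems w Nat"
      "\<And>w' n. \<lbrakk>w \<sqsubseteq> w'; n \<in> elems w' Nat; le w' N n\<rbrakk> \<Longrightarrow> (\<rho>X \<cdot> (xs \<cdot> n) \<cdot> x \<^bold>< ?h) \<in> facts w'"
      using convE[OF xs_conv0 w h(1)] by metis
    have "(\<rho>X \<cdot> (z \<cdot> n) \<cdot> x \<^bold>< e) \<in> facts w'" if w': "w \<sqsubseteq> w'" and n: "n \<in> elems w' Nat" "le w' N n" for w' n
    proof -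
      note ww = future_trans[OF w w'] and W' = future_world[OF w']
      note M = mX[OF ww] and xw = x_dom[OF ww]
      show ?thesis
        using b_stage[OF ww n(1)] unfolding staged_def
      proof (elim disjE conjE)
        show ?thesis if "(z \<cdot> n \<^bold>= x) \<in> facts w'"
          by (rule dist_eq_less[OF M that zd[OF ww n(1)] fact_mono[OF e w']])
        assume nr: "near w' n (z \<cdot> n)"
        \<comment> \<open>From \<open>n\<close> on e/2 bounds the tail of \<open>xs\<close>, so
          \<open>near\<close> gives e/2 as a non-strict bound for \<open>z \<cdot> n\<close>;
          cotransitivity with e/2 < e makes it a strict bound by \<open>e\<close>.\<close>
        have "(\<rho>X \<cdot> (xs \<cdot> m) \<cdot> x \<^bold>< ?h) \<in> facts w''" if w'': "w' \<sqsubseteq> w''" and m: "m \<in> elems w'' Nat" "le w'' n m" for w'' m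
          by (rule N(2)[OF future_trans[OF w' w''] m(1)
                le_trans[OF future_world[OF w''] le_mono[OF n(2) w''] m(2) elems_mono[OF elems_mono[OF N(1) w'] w'']]])
        then have "(?h \<^bold>< \<rho>X \<cdot> (z \<cdot> n) \<cdot> x) \<notin> facts w'"
          using nr future_refl[OF W'] fact_mono[OF h(1) w'] fact_Less_dom(2)[OF W'] unfolding near_def by blast
        then show ?thesis
          using less_cotrans[OF W' fact_mono[OF h(2) w'] dist_dom[OF M zd[OF ww n(1)] xw]] by blast
      qed
    qed
    then show "\<exists>N\<in>elems w Nat. \<forall>w'. w \<sqsubseteq> w' \<longrightarrow> (\<forall>n\<in>elems w' Nat. le w' N n
        \<longrightarrow> (\<rho>X \<cdot> (z \<cdot> n) \<cdot> x \<^bold>< e) \<in> facts w')"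
      using N(1) by blast
  qed
  \<comment> \<open>The shifted sequence \<open>a\<close> does not see the value of \<open>b\<close>
    at 0, so this value is inspected separately.\<close>
  show ?thesis
    using b_bin[OF w 01(2)]
  proof
    assume "(b \<cdot> \<^bold>0 \<^bold>= nsuc \<^bold>0) \<in> facts w0"
    then show ?thesis
      using b_one[OF w 01(2)] 01(2) by blast
  next
    assume b0: "(b \<cdot> \<^bold>0 \<^bold>= \<^bold>0) \<in> facts w0"
    have b_suc: "(b \<cdot> n \<^bold>= \<^bold>0) \<in> facts w"
      if w: "w0 \<sqsubseteq> w" and n: "n \<in> elems w Nat"
        and prev: "\<And>j. \<lbrakk>j \<in> elems w Nat; (n \<^bold>= nsuc j) \<in> facts w\<rbrakk> \<Longrightarrow> (a \<cdot> j \<^bold>= \<^bold>0) \<in> facts w" for w n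
    proof (cases rule: nat_cases[OF future_world[OF w] n])
      case 1
      then show ?thesis
        using eq_trans[OF future_world[OF w] app_cong[OF future_world[OF w] elems_mono[OF b w] n] fact_mono[OF b0 w]] by blast
    next
      case (2 j)
      note W' = future_world[OF w]
      show ?thesis
        by (rule eq_trans[OF W' app_cong[OF W' elems_mono[OF b w] n 2(2)]
              eq_trans[OF W' eq_sym[OF W' ab[OF w 2(1)]] prev[OF 2]]])
    qed
    show ?thesis
    proof (rule decide_binary[OF w a bin z z_conv k])
      fix w n assume w: "w0 \<sqsubseteq> w" and n: "n \<in> elems w Nat" "first w a n"
      note W' = future_world[OF w]
      \<comment> \<open>A predecessor of \<open>n\<close> differs from \<open>n\<close>, which
        excludes the second alternative in \<open>first\<close>.\<close>
      have "(a \<cdot> j \<^bold>= \<^bold>0) \<in> facts w" if j: "j \<in> elems w Nat" "(n \<^bold>= nsuc j) \<in> facts w" for j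
      proof -
        have "le w j n"
          by (rule le_cong[OF W' le_suc[OF W' j(1)] eq_refl[OF W' j(1)] eq_sym[OF W' j(2)] j(1)])
        then have "(a \<cdot> j \<^bold>= \<^bold>0) \<in> facts w \<or> (j \<^bold>= n) \<in> facts w"
          using n(2) j(1) future_refl[OF W'] unfolding first_def by blast
        then show ?thesis
          using suc_neq_self[OF W' j(1)] eq_trans[OF W' _ j(2)] by blast
      qed
      then show "le w n (k \<cdot> n) \<and> (quarter \<^bold>< g (k \<cdot> n) (z \<cdot> n)) \<in> facts w"
        using b_zero[OF w n(1) b_suc[OF w n(1)]] by blast
    next
      fix n assume n: "n \<in> elems w0 Nat" "(a \<cdot> n \<^bold>= nsuc \<^bold>0) \<in> facts w0"
      have n': "nsuc n \<in> elems w0 Nat"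
        using n(1) by simp
      have "(b \<cdot> nsuc n \<^bold>= nsuc \<^bold>0) \<in> facts w0"
        by (rule eq_trans[OF W eq_sym[OF W ab[OF w n(1)]] n(2)])
      then show ?thesis
        using b_one[OF w n'] n' by blast
    next
      assume zero: "\<And>w n. \<lbrakk>w0 \<sqsubseteq> w; n \<in> elems w Nat\<rbrakk> \<Longrightarrow> (a \<cdot> n \<^bold>= \<^bold>0) \<in> facts w"
      have "le w n (k \<cdot> n) \<and> (quarter \<^bold>< g (k \<cdot> n) (z \<cdot> n)) \<in> facts w" if "w0 \<sqsubseteq> w" "n \<in> elems w Nat" for w n
        using b_zero[OF that b_suc[OF that zero[OF that(1)]]] .
      then show ?thesis
        using z k z_conv unfolding apart_def by blast
    qed
  qed
qed

end

section \<open>From the formula to the worlds\<close>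

lemma formula_lang: "formula w {} \<phi> \<Longrightarrow> \<phi> \<in> lang (wlevel w)"
  by (simp add: formula_def lang_def)

lemma frc_metric:
  "\<lbrakk>closed_trm (tsub e d); \<forall>a\<in>{''met.x'', ''met.y'', ''met.z''}. (a, \<sigma>) \<notin> fvt d\<rbrakk>
   \<Longrightarrow> frc True w e (metric \<sigma> d) = frc True w Var (metric \<sigma> (tsub e d))"
  by (simp add: metric_def tsub_upd_fresh)

lemma frc_cauchy:
  "\<forall>v\<in>{(''cau.e'', Real), (''cau.N'', Nat), (''cau.m'', Nat), (''cau.n'', Nat)}. v \<notin> fvt d \<union> fvt s
   \<Longrightarrow> frc True w e (cauchy d (\<lambda>n. s \<cdot> n)) \<longleftrightarrow> cauchy_seq w (tsub e d) (tsub e s)"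
  by (simp add: cauchy_def cauchy_seq_def up_True frc_nle tsub_upd_fresh)

theorem theorem10:
  fixes X Y :: sort
  shows "{} \<turnstile>
    FORALL ''rhoX'' (X \<rightarrow> X \<rightarrow> Real) (\<lambda>\<rho>X. FORALL ''rhoY'' (Y \<rightarrow> Y \<rightarrow> Real) (\<lambda>\<rho>Y.
    FORALL ''F'' (Nat \<rightarrow> X \<rightarrow> Y) (\<lambda>F. FORALL ''f'' (X \<rightarrow> Y) (\<lambda>f.
    FORALL ''xs'' (Nat \<rightarrow> X) (\<lambda>xs. FORALL ''x'' X (\<lambda>x. FORALL ''eps'' Real (\<lambda>\<epsilon>.
      complete_metric X \<rho>X \<^bold>\<and> metric Y \<rho>Y
      \<^bold>\<and> FORALL ''z'' X (\<lambda>z. converges \<rho>Y (\<lambda>n. F \<cdot> n \<cdot> z) (f \<cdot> z))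
      \<^bold>\<and> converges \<rho>X (\<lambda>n. xs \<cdot> n) x
      \<^bold>\<and> rat 0 \<^bold>< \<epsilon>
      \<^bold>\<longrightarrow>
      (uniformly_close_along \<rho>Y F f xs \<epsilon> \<^bold>\<or> apart_near X \<rho>X \<rho>Y F f x \<epsilon>)
      \<^bold>\<and> (apart_near X \<rho>X \<rho>Y F f x \<epsilon> \<^bold>\<longrightarrow> LPO))))))))"
    (is "{} \<turnstile> All ?a (All ?b (All ?c (All ?d (All ?e (All ?f (All ?g (?H \<^bold>\<longrightarrow> ?C)))))))")
proof (rule kripke_completeness)
  show "All ?a (All ?b (All ?c (All ?d (All ?e (All ?f (All ?g (?H \<^bold>\<longrightarrow> ?C))))))) \<in> lang 0"
    \<comment> \<open>Of this dummy world only the level 0 matters: the statement has no free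
      variables.\<close>
    by (rule formula_lang[of "World 0 {}", simplified])
      (simp add: complete_metric_def metric_def cauchy_def converges_def
        uniformly_close_along_def apart_near_def LPO_def rle_def)
  fix w0
  show "frc True w0 Var (All ?a (All ?b (All ?c (All ?d (All ?e (All ?f (All ?g (?H \<^bold>\<longrightarrow> ?C))))))))"
    \<comment> \<open>The local mode strips the whole prefix of quantifiers and the implication in
      one later world, in which the hypotheses are forced.\<close>
    unfolding frc.simps(6,7) up_True up_False snd_conv
  proof (intro HOL.allI HOL.impI ballI)
    fix w \<rho>X \<rho>Y F f xs x \<epsilon>
    let ?env = "Var(?a := \<rho>X, ?b := \<rho>Y, ?c := F, ?d := f, ?e := xs, ?f := x, ?g := \<epsilon>)"
    assume "w0 \<sqsubseteq> w" and d: "\<rho>X \<in> elems w (X \<rightarrow> X \<rightarrow> Real)" "\<rho>Y \<in> elems w (Y \<rightarrow> Y \<rightarrow> Real)"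
      "F \<in> elems w (Nat \<rightarrow> X \<rightarrow> Y)" "f \<in> elems w (X \<rightarrow> Y)" "xs \<in> elems w (Nat \<rightarrow> X)" "x \<in> elems w X"
      "\<epsilon> \<in> elems w Real" and H: "frc True w ?env ?H"
    then have W: "world w"
      using future_world by blast
    note [simp] = d[THEN elems_closed]
    have H1: "frc True w ?env (complete_metric X (Var ?a))"
      and H2: "frc True w ?env (metric Y (Var ?b))"
      and H3: "frc True w ?env (FORALL ''z'' X (\<lambda>z. converges (Var ?b) (\<lambda>n. Var ?c \<cdot> n \<cdot> z) (Var ?d \<cdot> z)))"
      and H4: "frc True w ?env (converges (Var ?a) (\<lambda>n. Var ?e \<cdot> n) (Var ?f))"
      and H5: "frc True w ?env (rat 0 \<^bold>< Var ?g)"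
      using H unfolding frc.simps(4) by blast+
    have mX: "frc True w Var (metric X \<rho>X)"
      using H1 frc_metric[of ?env "Var ?a" X w] by (simp add: complete_metric_def)
    have mY: "frc True w Var (metric Y \<rho>Y)"
      using H2 frc_metric[of ?env "Var ?b" Y w] by simp
    have complete: "\<exists>l\<in>elems w' X. conv w' \<rho>X (\<lambda>n. s \<cdot> n) l"
      if "w \<sqsubseteq> w'" "s \<in> elems w' (Nat \<rightarrow> X)" "cauchy_seq w' \<rho>X s" for w' s
      using H1 that unfolding complete_metric_def frc.simps(4) frc_True_All frc_True_Imp
      by (simp add: frc_cauchy frc_converges_seq fresh_con_def future_refl[OF future_world])
    have pointwise: "conv w' \<rho>Y (\<lambda>i. F \<cdot> i \<cdot> z) (f \<cdot> z)" if "w \<sqsubseteq> w'" "z \<in> elems w' X" for w' z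
      using H3 that unfolding frc_True_All by (simp add: frc_converges_fun_seq fresh_con_def)
    interpret situation X Y \<rho>X \<rho>Y F f xs x \<epsilon> w
    proof
      show "conv w \<rho>X (\<lambda>n. xs \<cdot> n) x"
        using H4 by (simp add: frc_converges_seq fresh_con_def)
    qed (use W d H5 mX mY complete pointwise in \<open>auto simp: mspace_def\<close>)
    have close: "frc True w ?env (uniformly_close_along (Var ?b) (Var ?c) (Var ?d) (Var ?e) (Var ?g))
        \<longleftrightarrow> (\<exists>N\<in>elems w Nat. close w N)"
      by (simp add: uniformly_close_along_def close_def up_True frc_nle)
    have apart: "frc True w ?env (apart_near X (Var ?a) (Var ?b) (Var ?c) (Var ?d) (Var ?f) (Var ?g)) \<longleftrightarrow> apart w"
      by (simp add: apart_near_def apart_def frc_converges_seq fresh_con_def up_True frc_nle)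
    have "frc False w ?env LPO" if "apart w"
      using apart_LPO[OF that] by (simp add: LPO_def binary_def up_True)
    with dichotomy show "frc False w ?env ?C"
      unfolding frc.simps(4-6) up_False close apart by blast
  qed
qed

end
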